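(* Let $n\ge3$, $r>0$, and let two points be chosen independently and uniformly at random in $\mathcal P_{n,r}$. Then the density $g$ of the distance $t$ between them is $g(t)=0$ for $t\notin[0,\ell_{K+1})$ and $$g(t)=\frac{2t}{A}\Big[\pi+\frac{u}{A}\big(\phi^*(t)-t\big)\Big]\qquad (0\le t<\ell_{K+1}),$$ where $\phi^*(t)=\int_0^tF(s)\,ds$ is given explicitly, for $\ell_k\le t<\ell_{k+1}$, $k\in\{0,\dots,K\}$, by $$\phi^*(t)=\sum_{\nu=0}^{k-1}J_\nu^*(\ell_\nu,\ell_{\nu+1})+J_k^*(\ell_k,t),\qquad J_k^*(s,t)=H_k^*(t)-H_k^*(s),$$ with $H_k^*(t)$ defined by: (i) if $n$ is even and $k\in\{0,\dots,K-1\}$, or $n$ is odd and $t<\lambda$: $H_k^*(t)=t-h_k^*(t,A_1(k),B_1(k))+h_{k+1}^*(t,A_1(k),B_1(k)+\frac{\pi}{n})$; (ii) if $n$ is odd and $t\ge\lambda$ (so $k=K$): $H_K^*(t)=t-h_K^*(t,A_1(K),B_1(K))+h_{K+1}^*(t,A_1(K),B_1(K)+\frac{\pi}{n})-h_{K+1}^*(t,A_2,B_2+\frac{\pi}{n})-h_{K+1}^*(t,A_2,B_2)+h_{K+1}^*(\lambda,A_2,B_2+\frac{\pi}{n})+h_{K+1}^*(\lambda,A_2,B_2)$; (iii) if $n$ is even and $k=K$: $H_K^*(t)=t-h_K^*(t,A_1(K),B_1(K))$. Here $h_k^*(t,a,b)=0$ if $k=0$ or ($k\ne0$ and $t=0$),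 and $h_k^*(t,a,b)=\sum_{i=1}^4\Theta_i(k,a,b)L_i^*(t,a)$ if $k\ne0$ and $t>0$, with $L_1^*(t,a)=\frac{t^2}{2}$, $L_2^*(t,a)=\ln t$, $L_3^*(t,a)=\sqrt{t^2-a^2}+a\arcsin\frac{a}{t}$, $L_4^*(t,a)=\frac12\big(a\sqrt{t^2-a^2}+t^2\arcsin\frac at\big)$.
   Context: $\mathcal P_{n,r}$ ($n\ge3$ integer, $r>0$) denotes the regular polygon with $n$ sides whose circumscribed circle has radius $r$ and centre at the origin; its perimeter is $u=2nr\sin\frac{\pi}{n}$ and its area $A=\frac12nr^2\sin\frac{2\pi}{n}$. $F$ denotes its chord length distribution function: with lines $g(p,\phi)=\{x\cos\phi+y\sin\phi=p\}$ ($p\ge0$, $0\le\phi<2\pi$) and the motion-invariant measure $\mu$ given by $dp\,d\phi$, $F(s)=\frac1u\,\mu(\{g: g\cap\mathcal P_{n,r}\ne\emptyset,\ |g\cap\mathcal P_{n,r}|\le s\})$, where $|g\cap\mathcal P_{n,r}|$ is the chord length. Notation: $K=\lfloor (n-2)/2\rfloor$; $\ell_k=2r\sin(k\pi/n)$; $\lambda=2r\cos^2\frac{\pi}{2n}$; $A_1(k)=2r\sin\frac{k\pi}{n}\sin\frac{(k+1)\pi}{n}$, $B_1(k)=\frac{k\pi}{n}$; $A_2=2r\cos^2\frac{\pi}{2n}$, $B_2=\frac{\pi}{2}(1-\frac1n)$. For integers $k\ge1$ and reals $a,b$: $\Theta_1(k,a,b)=\frac{1}{4r}\csc\frac{\pi}{n}\big(\sin(2b)\csc\frac{2k\pi}{n}-2b\cot\frac{2k\pi}{n}\big)$,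 $\Theta_2(k,a,b)=a\big(\cos b\cot\frac{\pi}{n}\sec\frac{k\pi}{n}-\frac{a}{2r}\sin(2b)\csc\frac{\pi}{n}\csc\frac{2k\pi}{n}\big)$, $\Theta_3(k,a,b)=-\big(\sin b\cot\frac{\pi}{n}\sec\frac{k\pi}{n}+\frac{a}{2r}\cos(2b)\csc\frac{\pi}{n}\csc\frac{2k\pi}{n}\big)$, $\Theta_4(k,a,b)=\frac{1}{2r}\csc\frac{\pi}{n}\cot\frac{2k\pi}{n}$. *)

theory Defs
  imports "HOL-Probability.Probability"
begin

type_synonym point = "real \<times> real"

definition polygon :: "nat \<Rightarrow> real \<Rightarrow> point set" where
  "polygon n r = convex hull {(r * cos (2 * pi * real j / real n), r * sin (2 * pi * real j / real n)) | j. j < n}"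

definition perim :: "nat \<Rightarrow> real \<Rightarrow> real" where
  "perim n r = 2 * real n * r * sin (pi / real n)"

definition area :: "nat \<Rightarrow> real \<Rightarrow> real" where
  "area n r = 1/2 * real n * r^2 * sin (2 * pi / real n)"

definition line :: "real \<Rightarrow> real \<Rightarrow> point set" where
  "line p \<phi> = {z. fst z * cos \<phi> + snd z * sin \<phi> = p}"

text \<open>Chord length |g \<inter> P| (the intersection is a segment; its length is its diameter).\<close>
definition chord_len :: "nat \<Rightarrow> real \<Rightarrow> real \<Rightarrow> real \<Rightarrow> real" where
  "chord_len n r p \<phi> = diameter (line p \<phi> \<inter> polygon n r)"

definition cldf :: "nat \<Rightarrow> real \<Rightarrow> real \<Rightarrow> real" where
  "cldf n r s = measure lborel {z :: real \<times> real. 0 \<le> fst z \<and> 0 \<le> snd z \<and> snd z < 2 * pi \<and>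
      line (fst z) (snd z) \<inter> polygon n r \<noteq> {} \<and> chord_len n r (fst z) (snd z) \<le> s} / perim n r"

definition KK :: "nat \<Rightarrow> nat" where
  "KK n = (n - 2) div 2"

definition ell :: "nat \<Rightarrow> real \<Rightarrow> nat \<Rightarrow> real" where
  "ell n r k = 2 * r * sin (real k * pi / real n)"

definition lam :: "nat \<Rightarrow> real \<Rightarrow> real" where
  "lam n r = 2 * r * (cos (pi / (2 * real n)))^2"

definition A1 :: "nat \<Rightarrow> real \<Rightarrow> nat \<Rightarrow> real" where
  "A1 n r k = 2 * r * sin (real k * pi / real n) * sin (real (k + 1) * pi / real n)"

definition B1 :: "nat \<Rightarrow> nat \<Rightarrow> real" where
  "B1 n k = real k * pi / real n"

definition A2 :: "nat \<Rightarrow> real \<Rightarrow> real" where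
  "A2 n r = 2 * r * (cos (pi / (2 * real n)))^2"

definition B2 :: "nat \<Rightarrow> real" where
  "B2 n = pi / 2 * (1 - 1 / real n)"

definition csc :: "real \<Rightarrow> real" where "csc x = 1 / sin x"
definition sec :: "real \<Rightarrow> real" where "sec x = 1 / cos x"

definition Theta1 :: "nat \<Rightarrow> real \<Rightarrow> nat \<Rightarrow> real \<Rightarrow> real \<Rightarrow> real" where
  "Theta1 n r k a b = 1 / (4 * r) * csc (pi / real n) *
     (sin (2 * b) * csc (2 * real k * pi / real n) - 2 * b * cot (2 * real k * pi / real n))"

definition Theta2 :: "nat \<Rightarrow> real \<Rightarrow> nat \<Rightarrow> real \<Rightarrow> real \<Rightarrow> real" where
  "Theta2 n r k a b = a * (cos b * cot (pi / real n) * sec (real k * pi / real n)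
     - a / (2 * r) * sin (2 * b) * csc (pi / real n) * csc (2 * real k * pi / real n))"

definition Theta3 :: "nat \<Rightarrow> real \<Rightarrow> nat \<Rightarrow> real \<Rightarrow> real \<Rightarrow> real" where
  "Theta3 n r k a b = - (sin b * cot (pi / real n) * sec (real k * pi / real n)
     + a / (2 * r) * cos (2 * b) * csc (pi / real n) * csc (2 * real k * pi / real n))"

definition Theta4 :: "nat \<Rightarrow> real \<Rightarrow> nat \<Rightarrow> real \<Rightarrow> real \<Rightarrow> real" where
  "Theta4 n r k a b = 1 / (2 * r) * csc (pi / real n) * cot (2 * real k * pi / real n)"

definition L1 :: "real \<Rightarrow> real \<Rightarrow> real" where "L1 t a = t^2 / 2"
definition L2 :: "real \<Rightarrow> real \<Rightarrow> real" where "L2 t a = ln t"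
definition L3 :: "real \<Rightarrow> real \<Rightarrow> real" where
  "L3 t a = sqrt (t^2 - a^2) + a * arcsin (a / t)"
definition L4 :: "real \<Rightarrow> real \<Rightarrow> real" where
  "L4 t a = 1/2 * (a * sqrt (t^2 - a^2) + t^2 * arcsin (a / t))"

definition hstar :: "nat \<Rightarrow> real \<Rightarrow> nat \<Rightarrow> real \<Rightarrow> real \<Rightarrow> real \<Rightarrow> real" where
  "hstar n r k t a b =
     (if k = 0 \<or> t = 0 then 0
      else Theta1 n r k a b * L1 t a + Theta2 n r k a b * L2 t a
         + Theta3 n r k a b * L3 t a + Theta4 n r k a b * L4 t a)"

definition Hstar :: "nat \<Rightarrow> real \<Rightarrow> nat \<Rightarrow> real \<Rightarrow> real" where
  "Hstar n r k t =
     (if even n \<and> k = KK n then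
        t - hstar n r (KK n) t (A1 n r (KK n)) (B1 n (KK n))
      else if odd n \<and> lam n r \<le> t then
        t - hstar n r (KK n) t (A1 n r (KK n)) (B1 n (KK n))
          + hstar n r (KK n + 1) t (A1 n r (KK n)) (B1 n (KK n) + pi / real n)
          - hstar n r (KK n + 1) t (A2 n r) (B2 n + pi / real n)
          - hstar n r (KK n + 1) t (A2 n r) (B2 n)
          + hstar n r (KK n + 1) (lam n r) (A2 n r) (B2 n + pi / real n)
          + hstar n r (KK n + 1) (lam n r) (A2 n r) (B2 n)
      else
        t - hstar n r k t (A1 n r k) (B1 n k)
          + hstar n r (k + 1) t (A1 n r k) (B1 n k + pi / real n))"

definition Jstar :: "nat \<Rightarrow> real \<Rightarrow> nat \<Rightarrow> real \<Rightarrow> real \<Rightarrow> real" where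
  "Jstar n r k s t = Hstar n r k t - Hstar n r k s"

definition gdens :: "nat \<Rightarrow> real \<Rightarrow> real \<Rightarrow> real" where
  "gdens n r t =
     (if 0 \<le> t \<and> t < ell n r (KK n + 1) then
        2 * t / area n r * (pi + perim n r / area n r * (integral {0..t} (cldf n r) - t))
      else 0)"

end

theory Submission
  imports Defs
begin

text \<open>
  Write \<open>E s p \<phi>\<close> for "the line with parameters \<open>(p, \<phi>)\<close> contains a chord of length \<open>s\<close>",
  and \<open>T s\<close> for the measure of the lines with this property; so \<open>T 0\<close> is the perimeter \<open>u\<close>, and
  \<open>u (1 - F s) = T s\<close> up to countably many \<open>s\<close>. In polar coordinates for the difference of two
  points, and with the intersection of the body and its translate by \<open>\<rho>\<close> sliced by lines, the density
  of the distance is \<open>2 \<rho> / A\<^sup>2\<close> times the integral of \<open>T\<close> over \<open>[\<rho>, \<infinity>)\<close>; the integral of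
  \<open>T\<close> over \<open>[0, \<infinity>)\<close> is \<open>\<pi> A\<close>. For the polygon, a chord of length \<open>s\<close> in the extreme
  position for its direction joins two sides, say \<open>d\<close> steps apart, whose lines form with it a triangle
  with known angles; this gives its distance from the centre. For \<open>\<ell>\<^sub>k \<le> s < \<ell>\<^sub>k\<^sub>+\<^sub>1\<close> only
  \<open>d = k\<close> and \<open>d = k + 1\<close> occur, and they change when an end of the chord passes a vertex, at an angle
  \<open>arcsin (A\<^sub>1(k) / s)\<close>. Integrating the distance over all directions gives \<open>T s\<close>, which is then
  recognised as \<open>u (1 - H\<^sub>k\<^sup>*')\<close>.
\<close>

subsection \<open>Rotated and polar coordinates\<close>

text \<open>The statement measures short chords by a diameter, over lines with \<open>p\<close>
  \<ge> 0 and a full turn of normals. The proof asks instead for two points of the body at distance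
  \<open>s\<close> on the line. For a compact body this is a closed condition on
  \<open>(s, p, \<phi>)\<close>, hence jointly measurable and open to Tonelli. Signed
  \<open>p\<close> with normals in an open half turn describe almost all the same lines and keep
  \<open>cos \<phi>\<close> nonzero, so rotations and polar coordinates reduce to substitutions in
  one variable. The extremal position is taken on one side only: the greatest \<open>p\<close> for
  \<phi> and the one for \<phi> + pi add up to the length of the interval of admissible
  \<open>p\<close>. Symmetry leaves a window of normals of length pi / n. Started at k pi / n, it
  keeps one end of the chord on a fixed side, while the other end passes a single vertex. Two
  effects near the diameter break this pattern. For even n and k = K the wider pair of sides is
  parallel and its term disappears. For odd n, \<lambda> is the width of the polygon, apothem plus
  radius; for s > \<lambda> directions without any chord appear inside the window, and the terms
  with \<open>A2\<close> and \<open>B2\<close> remove them.\<close>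

definition line_pt :: "real \<Rightarrow> real \<Rightarrow> real \<Rightarrow> point" where
  "line_pt p \<phi> q = (p * cos \<phi> - q * sin \<phi>, p * sin \<phi> + q * cos \<phi>)"

lemma nn_integral_lborel_pair:
  fixes f :: "'a::euclidean_space \<times> 'b::euclidean_space \<Rightarrow> ennreal"
  assumes "f \<in> borel_measurable borel"
  shows "integral\<^sup>N lborel f = (\<integral>\<^sup>+x. \<integral>\<^sup>+y. f (x, y) \<partial>lborel \<partial>lborel)"
    and "integral\<^sup>N lborel f = (\<integral>\<^sup>+y. \<integral>\<^sup>+x. f (x, y) \<partial>lborel \<partial>lborel)"
proof -
  have m: "f \<in> borel_measurable (lborel \<Otimes>\<^sub>M lborel)"
    using assms by (simp add: lborel_prod)
  show "integral\<^sup>N lborel f = (\<integral>\<^sup>+x. \<integral>\<^sup>+y. f (x, y) \<partial>lborel \<partial>lborel)"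
    using lborel.nn_integral_fst[OF m] by (simp add: lborel_prod)
  show "integral\<^sup>N lborel f = (\<integral>\<^sup>+y. \<integral>\<^sup>+x. f (x, y) \<partial>lborel \<partial>lborel)"
    using lborel_pair.nn_integral_snd[of f] m by (simp add: lborel_prod)
qed

lemma nn_integral_lborel_swap:
  fixes f :: "'a::euclidean_space \<Rightarrow> 'b::euclidean_space \<Rightarrow> ennreal"
  assumes "(\<lambda>(x, y). f x y) \<in> borel_measurable (borel \<Otimes>\<^sub>M borel)"
  shows "(\<integral>\<^sup>+x. \<integral>\<^sup>+y. f x y \<partial>lborel \<partial>lborel) = (\<integral>\<^sup>+y. \<integral>\<^sup>+x. f x y \<partial>lborel \<partial>lborel)"
  using nn_integral_lborel_pair[of "\<lambda>(x, y). f x y"] assms by (simp add: borel_prod)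

text \<open>The rotation is split into two affine substitutions of one variable each: at fixed
  \<open>q\<close> the abscissa replaces \<open>p\<close>, then at fixed abscissa the ordinate
  replaces \<open>q\<close>. Their factors \<open>1 / \<bar>cos \<phi>\<bar>\<close> and
  \<open>\<bar>cos \<phi>\<bar>\<close> cancel.\<close>

lemma nn_integral_rotate:
  fixes f :: "point \<Rightarrow> ennreal"
  assumes [measurable]: "f \<in> borel_measurable borel" and c: "cos \<phi> \<noteq> 0"
  shows "integral\<^sup>N lborel f = (\<integral>\<^sup>+p. \<integral>\<^sup>+q. f (line_pt p \<phi> q) \<partial>lborel \<partial>lborel)"
proof -
  let ?c = "cos \<phi>" and ?s = "sin \<phi>"
  have mf[measurable]: "f \<in> borel_measurable (borel \<Otimes>\<^sub>M borel)"
    using assms by (simp add: borel_prod)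
  have shift: "line_pt (q * ?s / ?c + (1 / ?c) * x) \<phi> q = (x, x * tan \<phi> + q / ?c)" for q x
  proof -
    have "q * (?c * ?c) + q * (?s * ?s) = q"
      by (metis distrib_left mult.right_neutral power2_eq_square sin_cos_squared_add2)
    then show ?thesis
      using c by (simp add: line_pt_def tan_def field_simps)
  qed
  have inner: "(\<integral>\<^sup>+p. f (line_pt p \<phi> q) \<partial>lborel) =
      ennreal (1 / \<bar>?c\<bar>) * (\<integral>\<^sup>+x. f (x, x * tan \<phi> + q / ?c) \<partial>lborel)" for q
  proof -
    have "(\<integral>\<^sup>+p. f (line_pt p \<phi> q) \<partial>lborel) = ennreal \<bar>1 / ?c\<bar> *
        (\<integral>\<^sup>+x. f (line_pt (q * ?s / ?c + (1 / ?c) * x) \<phi> q) \<partial>lborel)"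
      by (rule nn_integral_real_affine) (use c in \<open>auto simp: line_pt_def\<close>)
    then show ?thesis unfolding shift by simp
  qed
  have "(\<integral>\<^sup>+p. \<integral>\<^sup>+q. f (line_pt p \<phi> q) \<partial>lborel \<partial>lborel) =
      (\<integral>\<^sup>+q. \<integral>\<^sup>+p. f (line_pt p \<phi> q) \<partial>lborel \<partial>lborel)"
    by (rule nn_integral_lborel_swap) (simp add: line_pt_def)
  also have "\<dots> = ennreal (1 / \<bar>?c\<bar>) * (\<integral>\<^sup>+q. \<integral>\<^sup>+x. f (x, x * tan \<phi> + q / ?c) \<partial>lborel \<partial>lborel)"
    unfolding inner by (rule nn_integral_cmult) measurable
  also have "(\<integral>\<^sup>+q. \<integral>\<^sup>+x. f (x, x * tan \<phi> + q / ?c) \<partial>lborel \<partial>lborel) =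
      (\<integral>\<^sup>+x. \<integral>\<^sup>+q. f (x, x * tan \<phi> + q / ?c) \<partial>lborel \<partial>lborel)"
    by (rule nn_integral_lborel_swap) simp
  also have "(\<integral>\<^sup>+x. \<integral>\<^sup>+q. f (x, x * tan \<phi> + q / ?c) \<partial>lborel \<partial>lborel) =
      (\<integral>\<^sup>+x. ennreal \<bar>?c\<bar> * (\<integral>\<^sup>+y. f (x, y) \<partial>lborel) \<partial>lborel)"
  proof (rule nn_integral_cong)
    fix x
    have "(\<integral>\<^sup>+q. f (x, x * tan \<phi> + q / ?c) \<partial>lborel) = ennreal \<bar>?c\<bar> *
      (\<integral>\<^sup>+y. f (x, x * tan \<phi> + (- x * tan \<phi> * ?c + ?c * y) / ?c) \<partial>lborel)"
      by (rule nn_integral_real_affine) (use c in auto)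
    moreover have "x * tan \<phi> + (- x * tan \<phi> * ?c + ?c * y) / ?c = y" for y
      using c by (simp add: field_simps)
    ultimately show "(\<integral>\<^sup>+q. f (x, x * tan \<phi> + q / ?c) \<partial>lborel) = ennreal \<bar>?c\<bar> * (\<integral>\<^sup>+y. f (x, y) \<partial>lborel)"
      by simp
  qed
  also have "(\<integral>\<^sup>+x. ennreal \<bar>?c\<bar> * (\<integral>\<^sup>+y. f (x, y) \<partial>lborel) \<partial>lborel) =
      ennreal \<bar>?c\<bar> * (\<integral>\<^sup>+x. \<integral>\<^sup>+y. f (x, y) \<partial>lborel \<partial>lborel)"
    by (rule nn_integral_cmult) measurable
  also have "ennreal (1 / \<bar>?c\<bar>) * (ennreal \<bar>?c\<bar> * (\<integral>\<^sup>+x. \<integral>\<^sup>+y. f (x, y) \<partial>lborel \<partial>lborel)) =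
      (\<integral>\<^sup>+x. \<integral>\<^sup>+y. f (x, y) \<partial>lborel \<partial>lborel)"
    using c by (simp add: mult.assoc[symmetric] ennreal_mult[symmetric])
  finally show ?thesis
    using nn_integral_lborel_pair(1)[OF assms(1)] by simp
qed

lemma borel_measurable_tan_real [measurable]: "(tan :: real \<Rightarrow> real) \<in> borel_measurable borel"
  unfolding tan_def by measurable

text \<open>The substitution x = tan \<phi> is made on compact intervals that exhaust the line,
  followed by monotone convergence. \<open>Suc m\<close> keeps every interval nondegenerate, as the
  substitution rule demands.\<close>

lemma nn_integral_tan:
  fixes g :: "real \<Rightarrow> ennreal"
  assumes [measurable]: "g \<in> borel_measurable borel"
  shows "integral\<^sup>N lborel g =
    (\<integral>\<^sup>+\<phi>. indicator {-pi/2<..<pi/2} \<phi> * (ennreal (1 / (cos \<phi>)\<^sup>2) * g (tan \<phi>)) \<partial>lborel)"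
proof -
  let ?I = "\<lambda>m::nat. {- arctan (real m) .. arctan (real m)}"
  have sub: "-pi/2 < x \<and> x < pi/2" if "x \<in> ?I m" for x m
    using that arctan_bounded[of "real m"] by auto
  have step: "(\<integral>\<^sup>+x. g x * indicator {- real (Suc m)..real (Suc m)} x \<partial>lborel) =
     (\<integral>\<^sup>+\<phi>. g (tan \<phi>) * ennreal (inverse ((cos \<phi>)\<^sup>2)) * indicator (?I (Suc m)) \<phi> \<partial>lborel)" for m
  proof -
    have "(\<integral>\<^sup>+x. g x * indicator {tan (- arctan (real (Suc m)))..tan (arctan (real (Suc m)))} x \<partial>lborel) =
      (\<integral>\<^sup>+x. g (tan x) * ennreal (inverse ((cos x)\<^sup>2)) * indicator (?I (Suc m)) x \<partial>lborel)"
    proof (rule nn_integral_substitution_aux)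
      fix x assume "x \<in> ?I (Suc m)"
      with sub have "cos x \<noteq> 0" using cos_gt_zero_pi[of x] by fastforce
      then show "(tan has_real_derivative inverse ((cos x)\<^sup>2)) (at x)" by (rule DERIV_tan)
    next
      show "continuous_on (?I (Suc m)) (\<lambda>x. inverse ((cos x)\<^sup>2))"
        using sub cos_gt_zero_pi by (intro continuous_intros) fastforce
    qed (use zero_less_arctan_iff[of "real (Suc m)"] in \<open>auto simp del: zero_less_arctan_iff\<close>)
    then show ?thesis by (simp only: tan_minus tan_arctan)
  qed
  have inc1: "incseq (\<lambda>m x. g x * indicator {- real (Suc m)..real (Suc m)} x)"
    by (intro incseq_SucI le_funI mult_left_mono) (auto split: split_indicator)
  have "integral\<^sup>N lborel g = (\<integral>\<^sup>+x. (SUP m. g x * indicator {- real (Suc m)..real (Suc m)} x) \<partial>lborel)"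
  proof (rule nn_integral_cong)
    fix x
    obtain m where "\<bar>x\<bar> \<le> real m" using real_arch_simple by blast
    then have "g x * indicator {- real (Suc m)..real (Suc m)} x = g x" by (auto split: split_indicator)
    then show "g x = (SUP m. g x * indicator {- real (Suc m)..real (Suc m)} x)"
      by (intro antisym SUP_upper2[of m] SUP_least) (auto split: split_indicator)
  qed
  also have "\<dots> = (SUP m. \<integral>\<^sup>+x. g x * indicator {- real (Suc m)..real (Suc m)} x \<partial>lborel)"
    by (rule nn_integral_monotone_convergence_SUP[OF inc1]) simp
  also have "\<dots> = (SUP m. \<integral>\<^sup>+\<phi>. g (tan \<phi>) * ennreal (inverse ((cos \<phi>)\<^sup>2)) * indicator (?I (Suc m)) \<phi> \<partial>lborel)"
    unfolding step ..
  also have "\<dots> = (\<integral>\<^sup>+\<phi>. (SUP m. g (tan \<phi>) * ennreal (inverse ((cos \<phi>)\<^sup>2)) * indicator (?I (Suc m)) \<phi>) \<partial>lborel)"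
  proof (rule nn_integral_monotone_convergence_SUP[symmetric])
    have "arctan (real (Suc m)) \<le> arctan (real (Suc (Suc m)))" for m by (simp add: arctan_le_iff)
    then have "?I (Suc m) \<subseteq> ?I (Suc (Suc m))" for m
      by (subst atLeastatMost_subset_iff) (simp del: of_nat_Suc)
    then have "indicator (?I (Suc m)) \<phi> \<le> (indicator (?I (Suc (Suc m))) \<phi> :: ennreal)" for m \<phi>
      by (intro indicator_leI) blast
    then show "incseq (\<lambda>m \<phi>. g (tan \<phi>) * ennreal (inverse ((cos \<phi>)\<^sup>2)) * indicator (?I (Suc m)) \<phi>)"
      by (intro incseq_SucI le_funI mult_left_mono) auto
  qed (simp del: of_nat_Suc)
  also have "\<dots> = (\<integral>\<^sup>+\<phi>. indicator {-pi/2<..<pi/2} \<phi> * (ennreal (1 / (cos \<phi>)\<^sup>2) * g (tan \<phi>)) \<partial>lborel)"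
  proof (rule nn_integral_cong)
    fix \<phi> :: real
    let ?h = "\<lambda>m. g (tan \<phi>) * ennreal (inverse ((cos \<phi>)\<^sup>2)) * indicator (?I (Suc m)) \<phi>"
    show "(SUP m. ?h m) = indicator {-pi/2<..<pi/2} \<phi> * (ennreal (1 / (cos \<phi>)\<^sup>2) * g (tan \<phi>))"
    proof (cases "\<phi> \<in> {-pi/2<..<pi/2}")
      case True
      obtain m where m: "\<bar>tan \<phi>\<bar> \<le> real m" using real_arch_simple by blast
      have "arctan (tan \<phi>) \<le> arctan (real (Suc m))" "arctan (- tan \<phi>) \<le> arctan (real (Suc m))"
        using m by (auto simp: arctan_le_iff simp del: arctan_minus)
      with True have "\<phi> \<in> ?I (Suc m)" by (simp add: arctan_tan arctan_minus)
      then have "?h m = g (tan \<phi>) * ennreal (inverse ((cos \<phi>)\<^sup>2))" by simp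
      then have "(SUP m. ?h m) = g (tan \<phi>) * ennreal (inverse ((cos \<phi>)\<^sup>2))"
        by (intro antisym SUP_upper2[of m] SUP_least) (auto split: split_indicator)
      also have "\<dots> = ennreal (1 / (cos \<phi>)\<^sup>2) * g (tan \<phi>)"
        by (simp add: mult.commute divide_inverse)
      finally show ?thesis using True by simp
    next
      case False
      then have "\<phi> \<notin> ?I (Suc m)" for m using sub by fastforce
      with False show ?thesis by simp
    qed
  qed
  finally show ?thesis .
qed

text \<open>Signed radii over half a turn sweep the plane up to a line. The vector
  \<open>line_pt 0 \<phi> \<rho>\<close> runs along a line with normal \<phi>, so the angle is
  counted from the second axis: x = - y tan \<phi> and y = \<rho> cos \<phi>. The factors |y|, 1 /
  cos^2 \<phi> and cos \<phi> of the three substitutions multiply to |\<rho>|.\<close>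

lemma nn_integral_polar:
  fixes f :: "point \<Rightarrow> ennreal"
  assumes f: "f \<in> borel_measurable borel"
  shows "integral\<^sup>N lborel f =
    (\<integral>\<^sup>+\<phi>. indicator {-pi/2<..<pi/2} \<phi> * (\<integral>\<^sup>+\<rho>. ennreal \<bar>\<rho>\<bar> * f (line_pt 0 \<phi> \<rho>) \<partial>lborel) \<partial>lborel)"
proof -
  note [measurable] = f
  have mf[measurable]: "f \<in> borel_measurable (borel \<Otimes>\<^sub>M borel)"
    using f by (simp add: borel_prod)
  have "integral\<^sup>N lborel f = (\<integral>\<^sup>+y. \<integral>\<^sup>+x. f (x, y) \<partial>lborel \<partial>lborel)"
    by (rule nn_integral_lborel_pair(2)[OF f])
  also have "\<dots> = (\<integral>\<^sup>+y. \<integral>\<^sup>+w. ennreal \<bar>y\<bar> * f (- y * w, y) \<partial>lborel \<partial>lborel)"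
  proof (rule nn_integral_cong_AE)
    show "AE y in lborel. (\<integral>\<^sup>+x. f (x, y) \<partial>lborel) = (\<integral>\<^sup>+w. ennreal \<bar>y\<bar> * f (- y * w, y) \<partial>lborel)"
      using AE_lborel_singleton[of "0::real"]
    proof eventually_elim
      case (elim y)
      have "(\<integral>\<^sup>+x. f (x, y) \<partial>lborel) = ennreal \<bar>- y\<bar> * (\<integral>\<^sup>+w. f (0 + (- y) * w, y) \<partial>lborel)"
        by (rule nn_integral_real_affine) (use elim in auto)
      then show ?case by (simp add: nn_integral_cmult)
    qed
  qed
  also have "\<dots> = (\<integral>\<^sup>+w. \<integral>\<^sup>+y. ennreal \<bar>y\<bar> * f (- y * w, y) \<partial>lborel \<partial>lborel)"
    by (rule nn_integral_lborel_swap) simp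
  also have "\<dots> = (\<integral>\<^sup>+\<phi>. indicator {-pi/2<..<pi/2} \<phi> * (ennreal (1 / (cos \<phi>)\<^sup>2) *
       (\<integral>\<^sup>+y. ennreal \<bar>y\<bar> * f (- y * tan \<phi>, y) \<partial>lborel)) \<partial>lborel)"
    by (rule nn_integral_tan) measurable
  also have "\<dots> = (\<integral>\<^sup>+\<phi>. indicator {-pi/2<..<pi/2} \<phi> *
       (\<integral>\<^sup>+\<rho>. ennreal \<bar>\<rho>\<bar> * f (line_pt 0 \<phi> \<rho>) \<partial>lborel) \<partial>lborel)"
  proof (rule nn_integral_cong)
    fix \<phi> :: real
    show "indicator {-pi/2<..<pi/2} \<phi> * (ennreal (1 / (cos \<phi>)\<^sup>2) *
       (\<integral>\<^sup>+y. ennreal \<bar>y\<bar> * f (- y * tan \<phi>, y) \<partial>lborel)) = indicator {-pi/2<..<pi/2} \<phi> *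
       (\<integral>\<^sup>+\<rho>. ennreal \<bar>\<rho>\<bar> * f (line_pt 0 \<phi> \<rho>) \<partial>lborel)"
    proof (cases "\<phi> \<in> {-pi/2<..<pi/2}")
      case True
      then have c: "cos \<phi> > 0" using cos_gt_zero_pi[of \<phi>] by auto
      have "(\<integral>\<^sup>+y. ennreal \<bar>y\<bar> * f (- y * tan \<phi>, y) \<partial>lborel) =
        ennreal \<bar>cos \<phi>\<bar> * (\<integral>\<^sup>+\<rho>. ennreal \<bar>0 + cos \<phi> * \<rho>\<bar> * f (- (0 + cos \<phi> * \<rho>) * tan \<phi>, 0 + cos \<phi> * \<rho>) \<partial>lborel)"
        by (rule nn_integral_real_affine) (use c in auto)
      also have "(\<integral>\<^sup>+\<rho>. ennreal \<bar>0 + cos \<phi> * \<rho>\<bar> * f (- (0 + cos \<phi> * \<rho>) * tan \<phi>, 0 + cos \<phi> * \<rho>) \<partial>lborel) =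
         (\<integral>\<^sup>+\<rho>. ennreal (cos \<phi>) * (ennreal \<bar>\<rho>\<bar> * f (line_pt 0 \<phi> \<rho>)) \<partial>lborel)"
        by (rule nn_integral_cong)
          (use c in \<open>simp add: line_pt_def tan_def abs_mult ennreal_mult mult_ac\<close>)
      also have "\<dots> = ennreal (cos \<phi>) * (\<integral>\<^sup>+\<rho>. ennreal \<bar>\<rho>\<bar> * f (line_pt 0 \<phi> \<rho>) \<partial>lborel)"
        by (rule nn_integral_cmult) (simp add: line_pt_def)
      finally show ?thesis
        using True c by (simp add: mult.assoc[symmetric] ennreal_mult[symmetric] power2_eq_square)
    qed simp
  qed
  finally show ?thesis .
qed

subsection \<open>Chords of convex bodies\<close>

lemma sin_cos_squared_scaled:
  fixes a x :: real
  shows "a * (cos x * cos x) + a * (sin x * sin x) = a" "a * (sin x * sin x) + a * (cos x * cos x) = a"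
  by (simp_all add: distrib_left[symmetric] sin_cos_squared_add3 add.commute)

lemma norm_line_pt: "(norm (line_pt p \<phi> q))\<^sup>2 = p\<^sup>2 + q\<^sup>2"
proof -
  have "(p * cos \<phi> - q * sin \<phi>)\<^sup>2 + (p * sin \<phi> + q * cos \<phi>)\<^sup>2 = (p\<^sup>2 + q\<^sup>2) * (cos \<phi> * cos \<phi> + sin \<phi> * sin \<phi>)"
    by algebra
  then have "(p * cos \<phi> - q * sin \<phi>)\<^sup>2 + (p * sin \<phi> + q * cos \<phi>)\<^sup>2 = p\<^sup>2 + q\<^sup>2"
    unfolding sin_cos_squared_add3 by simp
  then show ?thesis by (simp add: line_pt_def norm_Pair)
qed

lemma line_pt_diff: "line_pt p \<phi> q - line_pt p' \<phi> q' = line_pt (p - p') \<phi> (q - q')"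
  and line_pt_add: "line_pt p \<phi> q + line_pt p' \<phi> q' = line_pt (p + p') \<phi> (q + q')"
  and line_pt_scaleR: "c *\<^sub>R line_pt p \<phi> q = line_pt (c * p) \<phi> (c * q)"
  by (simp_all add: line_pt_def algebra_simps)

lemma dist_line_pt: "dist (line_pt p \<phi> q) (line_pt p \<phi> q') = \<bar>q - q'\<bar>"
proof (rule power2_eq_imp_eq)
  show "(dist (line_pt p \<phi> q) (line_pt p \<phi> q'))\<^sup>2 = \<bar>q - q'\<bar>\<^sup>2"
    by (simp add: dist_norm line_pt_diff norm_line_pt)
qed auto

lemma abs_le_of_line_pt:
  assumes "norm (line_pt p \<phi> q) \<le> B"
  shows "\<bar>q\<bar> \<le> B"
proof -
  have "0 \<le> B" using assms norm_ge_zero order_trans by blast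
  have "q\<^sup>2 \<le> (norm (line_pt p \<phi> q))\<^sup>2" by (simp add: norm_line_pt)
  also have "\<dots> \<le> B\<^sup>2" using assms by (intro power_mono) auto
  finally show ?thesis using \<open>0 \<le> B\<close> by (metis abs_le_square_iff abs_of_nonneg)
qed

lemma line_eq_range: "line p \<phi> = range (line_pt p \<phi>)"
proof (intro set_eqI iffI)
  fix z assume "z \<in> line p \<phi>"
  then have z: "fst z * cos \<phi> + snd z * sin \<phi> = p" by (simp add: line_def)
  have "line_pt p \<phi> (snd z * cos \<phi> - fst z * sin \<phi>) = z"
    unfolding line_pt_def z[symmetric] by (simp add: algebra_simps sin_cos_squared_scaled prod_eq_iff)
  then show "z \<in> range (line_pt p \<phi>)" by (metis rangeI)
next
  fix z assume "z \<in> range (line_pt p \<phi>)"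
  then obtain q where "z = line_pt p \<phi> q" by blast
  then show "z \<in> line p \<phi>" by (simp add: line_def line_pt_def algebra_simps sin_cos_squared_scaled)
qed

lemma continuous_on_line_pt [continuous_intros]:
  fixes A :: "'a :: t2_space set"
  assumes "continuous_on A f" "continuous_on A g" "continuous_on A h"
  shows "continuous_on A (\<lambda>x. line_pt (f x) (g x) (h x))"
  unfolding line_pt_def by (intro continuous_intros assms)

lemma borel_measurable_line_pt [measurable (raw)]:
  assumes [measurable]: "f \<in> borel_measurable M" "g \<in> borel_measurable M" "h \<in> borel_measurable M"
  shows "(\<lambda>x. line_pt (f x) (g x) (h x)) \<in> borel_measurable M"
  unfolding line_pt_def by (intro borel_measurable_Pair) measurable

lemma line_pt_plus_pi: "line_pt p (\<phi> + pi) q = line_pt (- p) \<phi> (- q)"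
  by (simp add: line_pt_def)

lemma slice_cases:
  fixes S :: "point set"
  assumes "compact S" "convex S"
  obtains "{q. line_pt p \<phi> q \<in> S} = {}"
  | a b where "a \<le> b" "{q. line_pt p \<phi> q \<in> S} = {a..b}"
proof -
  let ?A = "{q. line_pt p \<phi> q \<in> S}"
  have "closed ?A"
    using closed_vimage[OF compact_imp_closed[OF assms(1)], of "line_pt p \<phi>"]
    by (simp add: vimage_def continuous_on_line_pt)
  moreover have "bounded ?A"
  proof -
    obtain B where B: "\<And>z. z \<in> S \<Longrightarrow> norm z \<le> B"
      using compact_imp_bounded[OF assms(1)] bounded_iff by blast
    have "\<bar>q\<bar> \<le> B" if "q \<in> ?A" for q
      using abs_le_of_line_pt B that by blast
    then show ?thesis by (auto simp: bounded_iff)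
  qed
  moreover have "convex ?A"
  proof (rule convexI, simp)
    fix x y u v :: real
    assume *: "line_pt p \<phi> x \<in> S" "line_pt p \<phi> y \<in> S" "0 \<le> u" "0 \<le> v" "u + v = 1"
    have "u *\<^sub>R line_pt p \<phi> x + v *\<^sub>R line_pt p \<phi> y = line_pt ((u + v) * p) \<phi> (u * x + v * y)"
      by (simp add: line_pt_scaleR line_pt_add algebra_simps)
    with * convexD[OF assms(2) *] show "line_pt p \<phi> (u * x + v * y) \<in> S" by simp
  qed
  ultimately obtain a b where "?A = {a..b}"
    using connected_compact_interval_1[of ?A] convex_connected compact_eq_bounded_closed by (auto simp: box_real)
  then show thesis using that by (cases "a \<le> b") auto
qed

lemma diameter_line_Int:
  assumes "{q. line_pt p \<phi> q \<in> S} = {a..b}" "a \<le> b"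
  shows "diameter (line p \<phi> \<inter> S) = b - a"
proof -
  have eq: "line p \<phi> \<inter> S = line_pt p \<phi> ` {a..b}"
    using assms(1) by (auto simp: line_eq_range)
  have "diameter (line_pt p \<phi> ` {a..b}) \<le> b - a"
    by (rule diameter_le) (use assms(2) in \<open>auto simp: dist_norm[symmetric] dist_line_pt\<close>)
  moreover have "b - a \<le> diameter (line_pt p \<phi> ` {a..b})"
  proof -
    have "bounded (line_pt p \<phi> ` {a..b})"
      by (intro compact_imp_bounded compact_continuous_image continuous_intros) auto
    from diameter_bounded_bound[OF this, of "line_pt p \<phi> b" "line_pt p \<phi> a"] assms(2)
    show ?thesis by (simp add: dist_line_pt)
  qed
  ultimately show ?thesis unfolding eq by simp
qed

definition has_chord :: "point set \<Rightarrow> real \<Rightarrow> real \<Rightarrow> real \<Rightarrow> bool" where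
  "has_chord S s p \<phi> \<longleftrightarrow> (\<exists>q. line_pt p \<phi> q \<in> S \<and> line_pt p \<phi> (q + s) \<in> S)"

lemma has_chord_iff_diameter:
  assumes "compact S" "convex S" "0 \<le> s"
  shows "has_chord S s p \<phi> \<longleftrightarrow> line p \<phi> \<inter> S \<noteq> {} \<and> s \<le> diameter (line p \<phi> \<inter> S)"
proof (rule slice_cases[OF assms(1,2), of p \<phi>])
  assume e: "{q. line_pt p \<phi> q \<in> S} = {}"
  then have "line p \<phi> \<inter> S = {}" by (auto simp: line_eq_range)
  with e show ?thesis by (auto simp: has_chord_def)
next
  fix a b assume ab: "a \<le> b" "{q. line_pt p \<phi> q \<in> S} = {a..b}"
  then have mem: "line_pt p \<phi> q \<in> S \<longleftrightarrow> a \<le> q \<and> q \<le> b" for q by auto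
  have "line p \<phi> \<inter> S \<noteq> {}" using ab(1) mem[of a] by (auto simp: line_eq_range)
  moreover have "has_chord S s p \<phi> \<longleftrightarrow> s \<le> b - a"
    unfolding has_chord_def mem using assms(3) by (auto intro: exI[of _ a])
  ultimately show ?thesis by (simp add: diameter_line_Int[OF ab(2,1)])
qed

text \<open>The only obstacle is the existential over \<open>q\<close>. A norm bound for
  \<open>S\<close> confines \<open>q\<close> to a compact interval, and projecting a closed set
  along a compact factor keeps it closed.\<close>

lemma closed_has_chord:
  assumes "compact S"
  shows "closed {(s, p, \<phi>). has_chord S s p \<phi>}"
proof -
  obtain B where B: "\<And>z. z \<in> S \<Longrightarrow> norm z \<le> B"
    using compact_imp_bounded[OF assms] bounded_iff by blast
  have bd: "\<bar>q\<bar> \<le> B" if "line_pt p \<phi> q \<in> S" for p \<phi> q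
    using abs_le_of_line_pt B that by blast
  let ?T = "{(q, s, p, \<phi>). line_pt p \<phi> q \<in> S \<and> line_pt p \<phi> (q + s) \<in> S}"
  have "?T = (\<lambda>x. line_pt (fst (snd (snd x))) (snd (snd (snd x))) (fst x)) -` S \<inter>
     (\<lambda>x. line_pt (fst (snd (snd x))) (snd (snd (snd x))) (fst x + fst (snd x))) -` S" by auto
  moreover have "closed \<dots>"
    by (intro closed_Int closed_vimage compact_imp_closed assms continuous_intros)
  ultimately have "closed ?T" by simp
  then have "closed {y. \<exists>q. q \<in> {-B..B} \<and> (q, y) \<in> ?T}"
    by (rule closed_compact_projection[rotated]) simp
  also have "{y. \<exists>q. q \<in> {-B..B} \<and> (q, y) \<in> ?T} = {(s, p, \<phi>). has_chord S s p \<phi>}"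
  proof (intro set_eqI iffI)
    fix y assume "y \<in> {(s, p, \<phi>). has_chord S s p \<phi>}"
    then obtain s p \<phi> q where *: "y = (s, p, \<phi>)" "line_pt p \<phi> q \<in> S" "line_pt p \<phi> (q + s) \<in> S"
      by (auto simp: has_chord_def)
    with bd[OF *(2)] have "q \<in> {-B..B}" by auto
    with * show "y \<in> {y. \<exists>q. q \<in> {-B..B} \<and> (q, y) \<in> ?T}" by auto
  qed (auto simp: has_chord_def)
  finally show ?thesis .
qed

text \<open>If the chord has length L, both sides are max 0 (L - \<rho>): the left set is the part
  of the chord that a shift by \<rho> keeps inside \<open>S\<close>, the right one the interval of
  lengths from \<rho> to L. This is what turns intersections with translates into chord
  lengths.\<close>

lemma emeasure_overlap:
  assumes "compact S" "convex S" "0 \<le> \<rho>"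
  shows "emeasure lborel {q. line_pt p \<phi> q \<in> S \<and> line_pt p \<phi> (q + \<rho>) \<in> S} =
    emeasure lborel {\<sigma>. \<rho> \<le> \<sigma> \<and> has_chord S \<sigma> p \<phi>}"
proof (cases rule: slice_cases[OF assms(1,2), where p = p and \<phi> = \<phi>])
  case 1
  then have no: "line_pt p \<phi> q \<notin> S" for q by blast
  have 1: "{q. line_pt p \<phi> q \<in> S \<and> line_pt p \<phi> (q + \<rho>) \<in> S} = {}"
    using no by blast
  have 2: "{\<sigma>. \<rho> \<le> \<sigma> \<and> has_chord S \<sigma> p \<phi>} = {}"
    unfolding has_chord_def using no by blast
  show ?thesis unfolding 1 2 ..
next
  case (2 a b)
  have mem: "line_pt p \<phi> q \<in> S \<longleftrightarrow> a \<le> q \<and> q \<le> b" for q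
    using arg_cong[OF 2(2), of "\<lambda>A. q \<in> A"] by (simp only: mem_Collect_eq atLeastAtMost_iff)
  have 1: "{q. line_pt p \<phi> q \<in> S \<and> line_pt p \<phi> (q + \<rho>) \<in> S} = {a..b - \<rho>}"
    unfolding mem using assms(3) by auto
  have 2: "{\<sigma>. \<rho> \<le> \<sigma> \<and> has_chord S \<sigma> p \<phi>} = {\<rho>..b - a}"
  proof (intro set_eqI iffI)
    fix \<sigma> assume "\<sigma> \<in> {\<rho>..b - a}"
    then have "a \<le> a \<and> a \<le> b \<and> a \<le> a + \<sigma> \<and> a + \<sigma> \<le> b" using assms(3) by auto
    then show "\<sigma> \<in> {\<sigma>. \<rho> \<le> \<sigma> \<and> has_chord S \<sigma> p \<phi>}"
      using \<open>\<sigma> \<in> {\<rho>..b - a}\<close> unfolding has_chord_def mem by auto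
  qed (auto simp: has_chord_def mem)
  show ?thesis
    unfolding 1 2 by (cases "a \<le> b - \<rho>") auto
qed

subsection \<open>The measure of lines with long chords\<close>

definition chords :: "point set \<Rightarrow> (real \<times> real \<times> real) set" where
  "chords S = {(s, p, \<phi>). has_chord S s p \<phi>}"

lemma chords_measurable: "compact S \<Longrightarrow> chords S \<in> sets (borel \<Otimes>\<^sub>M borel \<Otimes>\<^sub>M borel)"
  unfolding chords_def borel_prod by (rule borel_closed[OF closed_has_chord])

text \<open>The \<open>T s\<close> of the overview, as an iterated integral of an indicator rather
  than the measure of a set, so that Tonelli applies directly when it is integrated over
  \<open>s\<close>.\<close>

definition line_measure :: "point set \<Rightarrow> real \<Rightarrow> ennreal" where
  "line_measure S s = (\<integral>\<^sup>+\<phi>. \<integral>\<^sup>+p. indicator {-pi/2<..<pi/2} \<phi> * indicator (chords S) (s, p, \<phi>) \<partial>lborel \<partial>lborel)"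

lemma line_measure_eq_emeasure:
  assumes "compact S"
  shows "line_measure S s = (\<integral>\<^sup>+\<phi>. indicator {-pi/2<..<pi/2} \<phi> * emeasure lborel {p. has_chord S s p \<phi>} \<partial>lborel)"
proof -
  note [measurable] = chords_measurable[OF assms]
  have "(\<integral>\<^sup>+p. indicator (chords S) (s, p, \<phi>) \<partial>lborel) = emeasure lborel {p. has_chord S s p \<phi>}" for \<phi>
  proof -
    have "(\<integral>\<^sup>+p. indicator (chords S) (s, p, \<phi>) \<partial>lborel) = (\<integral>\<^sup>+p. indicator {p. (s, p, \<phi>) \<in> chords S} p \<partial>lborel)"
      by (intro nn_integral_cong) (simp add: indicator_def)
    also have "\<dots> = emeasure lborel {p. (s, p, \<phi>) \<in> chords S}"
      by (rule nn_integral_indicator) measurable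
    finally show ?thesis by (simp add: chords_def)
  qed
  then show ?thesis
    unfolding line_measure_def by (simp add: nn_integral_cmult)
qed

lemma nn_integral_even:
  fixes g :: "real \<Rightarrow> ennreal"
  assumes [measurable]: "g \<in> borel_measurable borel"
  shows "(\<integral>\<^sup>+x. g \<bar>x\<bar> \<partial>lborel) = 2 * (\<integral>\<^sup>+x. indicator {0..} x * g x \<partial>lborel)"
proof -
  have "(\<integral>\<^sup>+x. g \<bar>x\<bar> \<partial>lborel) = (\<integral>\<^sup>+x. indicator {0..} x * g x + indicator {0..} (- x) * g (- x) \<partial>lborel)"
    using AE_lborel_singleton[of "0::real"]
    by (intro nn_integral_cong_AE) (auto elim!: eventually_mono split: split_indicator)
  also have "\<dots> = (\<integral>\<^sup>+x. indicator {0..} x * g x \<partial>lborel) + (\<integral>\<^sup>+x. indicator {0..} (- x) * g (- x) \<partial>lborel)"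
    by (rule nn_integral_add) auto
  also have "(\<integral>\<^sup>+x. indicator {0..} (- x) * g (- x) \<partial>lborel) = (\<integral>\<^sup>+x. indicator {0..} x * g x \<partial>lborel)"
    by (subst nn_integral_real_affine[where c = "-1" and t = 0]) auto
  finally show ?thesis by (simp add: mult_2)
qed

lemma borel_measurable_indicator_atLeast [measurable (raw)]:
  fixes f g :: "'a \<Rightarrow> real"
  assumes [measurable]: "f \<in> borel_measurable M" "g \<in> borel_measurable M"
  shows "(\<lambda>x. indicator {f x..} (g x) :: ennreal) \<in> borel_measurable M"
proof -
  have "(\<lambda>x. if f x \<le> g x then 1 else 0 :: ennreal) \<in> borel_measurable M" by measurable
  then show ?thesis by (simp add: indicator_def)
qed

lemma nn_integral_overlap:
  assumes "compact S" "convex S"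
  shows "(\<integral>\<^sup>+q. indicator S (line_pt p \<phi> q) * indicator S (line_pt p \<phi> (q + \<rho>)) \<partial>lborel) =
    (\<integral>\<^sup>+\<sigma>. indicator {\<bar>\<rho>\<bar>..} \<sigma> * indicator (chords S) (\<sigma>, p, \<phi>) \<partial>lborel)"
proof -
  note [measurable] = chords_measurable[OF assms(1)]
  have [measurable]: "S \<in> sets borel" using assms(1) by (simp add: borel_compact)
  have *: "(\<integral>\<^sup>+q. indicator S (line_pt p \<phi> q) * indicator S (line_pt p \<phi> (q + \<rho>)) \<partial>lborel) =
    (\<integral>\<^sup>+\<sigma>. indicator {\<rho>..} \<sigma> * indicator (chords S) (\<sigma>, p, \<phi>) \<partial>lborel)" if "\<rho> \<ge> 0" for \<rho>
  proof -
    have "(\<integral>\<^sup>+q. indicator S (line_pt p \<phi> q) * indicator S (line_pt p \<phi> (q + \<rho>)) \<partial>lborel) =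
      (\<integral>\<^sup>+q. indicator {q. line_pt p \<phi> q \<in> S \<and> line_pt p \<phi> (q + \<rho>) \<in> S} q \<partial>lborel)"
      by (intro nn_integral_cong) (simp split: split_indicator)
    also have "\<dots> = emeasure lborel {q. line_pt p \<phi> q \<in> S \<and> line_pt p \<phi> (q + \<rho>) \<in> S}"
      by (rule nn_integral_indicator) measurable
    also have "\<dots> = emeasure lborel {\<sigma>. \<rho> \<le> \<sigma> \<and> (\<sigma>, p, \<phi>) \<in> chords S}"
      using emeasure_overlap[OF assms that] by (simp add: chords_def)
    also have "\<dots> = (\<integral>\<^sup>+\<sigma>. indicator {\<sigma>. \<rho> \<le> \<sigma> \<and> (\<sigma>, p, \<phi>) \<in> chords S} \<sigma> \<partial>lborel)"
      by (rule nn_integral_indicator[symmetric]) measurable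
    also have "\<dots> = (\<integral>\<^sup>+\<sigma>. indicator {\<rho>..} \<sigma> * indicator (chords S) (\<sigma>, p, \<phi>) \<partial>lborel)"
      by (intro nn_integral_cong) (simp split: split_indicator)
    finally show ?thesis .
  qed
  show ?thesis
  proof (cases "\<rho> \<ge> 0")
    case True
    then show ?thesis using *[of \<rho>] by simp
  next
    \<comment> \<open>A shift of \<open>q\<close> by - \<rho> exchanges the two factors and reduces
      a negative displacement to a positive one.\<close>
    case False
    have "(\<integral>\<^sup>+q. indicator S (line_pt p \<phi> q) * indicator S (line_pt p \<phi> (q + \<rho>)) \<partial>lborel) =
      (\<integral>\<^sup>+q. indicator S (line_pt p \<phi> (q + - \<rho>)) * indicator S (line_pt p \<phi> q) \<partial>lborel)"
      by (subst nn_integral_real_affine[where c = 1 and t = "- \<rho>"]) (auto simp: add.commute)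
    also have "\<dots> = (\<integral>\<^sup>+q. indicator S (line_pt p \<phi> q) * indicator S (line_pt p \<phi> (q + - \<rho>)) \<partial>lborel)"
      by (simp add: mult.commute)
    finally show ?thesis using *[of "- \<rho>"] False by simp
  qed
qed

lemma nn_integral_line_measure:
  assumes "compact S" and [measurable]: "w \<in> borel_measurable borel"
  shows "(\<integral>\<^sup>+\<phi>. indicator {-pi/2<..<pi/2} \<phi> * (\<integral>\<^sup>+p. \<integral>\<^sup>+\<sigma>. w \<sigma> * indicator (chords S) (\<sigma>, p, \<phi>) \<partial>lborel \<partial>lborel) \<partial>lborel) =
    (\<integral>\<^sup>+\<sigma>. w \<sigma> * line_measure S \<sigma> \<partial>lborel)"
proof -
  note [measurable] = chords_measurable[OF assms(1)]
  let ?I = "indicator {-pi/2<..<pi/2} :: real \<Rightarrow> ennreal"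
  have "(\<integral>\<^sup>+\<phi>. ?I \<phi> * (\<integral>\<^sup>+p. \<integral>\<^sup>+\<sigma>. w \<sigma> * indicator (chords S) (\<sigma>, p, \<phi>) \<partial>lborel \<partial>lborel) \<partial>lborel) =
    (\<integral>\<^sup>+\<phi>. ?I \<phi> * (\<integral>\<^sup>+\<sigma>. \<integral>\<^sup>+p. w \<sigma> * indicator (chords S) (\<sigma>, p, \<phi>) \<partial>lborel \<partial>lborel) \<partial>lborel)"
    by (subst nn_integral_lborel_swap) simp_all
  also have "\<dots> = (\<integral>\<^sup>+\<phi>. \<integral>\<^sup>+\<sigma>. ?I \<phi> * (\<integral>\<^sup>+p. w \<sigma> * indicator (chords S) (\<sigma>, p, \<phi>) \<partial>lborel) \<partial>lborel \<partial>lborel)"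
    by (subst nn_integral_cmult) simp_all
  also have "\<dots> = (\<integral>\<^sup>+\<sigma>. \<integral>\<^sup>+\<phi>. ?I \<phi> * (\<integral>\<^sup>+p. w \<sigma> * indicator (chords S) (\<sigma>, p, \<phi>) \<partial>lborel) \<partial>lborel \<partial>lborel)"
    by (rule nn_integral_lborel_swap) simp
  also have "\<dots> = (\<integral>\<^sup>+\<sigma>. w \<sigma> * line_measure S \<sigma> \<partial>lborel)"
    unfolding line_measure_def by (simp add: nn_integral_cmult mult.left_commute)
  finally show ?thesis .
qed

text \<open>For each normal the chord lengths integrate over \<open>p\<close> to the area, by
  slicing; the half turn of normals contributes the factor pi.\<close>

lemma nn_integral_total_chord_length:
  assumes "compact S" "convex S"
  shows "(\<integral>\<^sup>+\<sigma>. indicator {0..} \<sigma> * line_measure S \<sigma> \<partial>lborel) = ennreal pi * emeasure lborel S"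
proof -
  have [measurable]: "S \<in> sets borel" using assms(1) by (simp add: borel_compact)
  let ?I = "indicator {-pi/2<..<pi/2} :: real \<Rightarrow> ennreal"
  have "(\<integral>\<^sup>+\<sigma>. indicator {0..} \<sigma> * line_measure S \<sigma> \<partial>lborel) =
    (\<integral>\<^sup>+\<phi>. ?I \<phi> * (\<integral>\<^sup>+p. \<integral>\<^sup>+\<sigma>. indicator {0..} \<sigma> * indicator (chords S) (\<sigma>, p, \<phi>) \<partial>lborel \<partial>lborel) \<partial>lborel)"
    by (rule nn_integral_line_measure[symmetric, OF assms(1)]) simp
  also have "\<dots> = (\<integral>\<^sup>+\<phi>. ?I \<phi> * (\<integral>\<^sup>+p. \<integral>\<^sup>+q. indicator S (line_pt p \<phi> q) \<partial>lborel \<partial>lborel) \<partial>lborel)"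
    using nn_integral_overlap[OF assms, where \<rho> = 0] by (simp flip: indicator_inter_arith)
  also have "\<dots> = (\<integral>\<^sup>+\<phi>. ?I \<phi> * emeasure lborel S \<partial>lborel)"
  proof (rule nn_integral_cong)
    fix \<phi> :: real
    show "?I \<phi> * (\<integral>\<^sup>+p. \<integral>\<^sup>+q. indicator S (line_pt p \<phi> q) \<partial>lborel \<partial>lborel) = ?I \<phi> * emeasure lborel S"
    proof (cases "\<phi> \<in> {-pi/2<..<pi/2}")
      case True
      then have "cos \<phi> \<noteq> 0" using cos_gt_zero_pi[of \<phi>] by auto
      from nn_integral_rotate[of "indicator S", OF _ this] show ?thesis by simp
    qed simp
  qed
  also have "\<dots> = ennreal pi * emeasure lborel S"
    by (subst nn_integral_multc) simp_all
  finally show ?thesis .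
qed

section \<open>The distance of two points and the measure of lines\<close>

lemma nn_integral_translate:
  fixes f :: "'a::euclidean_space \<Rightarrow> ennreal"
  assumes [measurable]: "f \<in> borel_measurable borel"
  shows "(\<integral>\<^sup>+y. f y \<partial>lborel) = (\<integral>\<^sup>+y. f (c + y) \<partial>lborel)"
  by (subst lborel_distr_plus[symmetric, of c], subst nn_integral_distr) auto

text \<open>For the displacement v between the two points, the inner integral is the measure of
  \<open>S\<close> intersected with a translate by v. With v in polar coordinates, that intersection
  is sliced by the lines parallel to v, that is with the polar angle of v as \<phi>; on each line it
  is the overlap of a chord with its own shift, which \<open>nn_integral_overlap\<close> expresses
  by longer chords. The integrand is even in \<rho>, hence the factor 2.\<close>

lemma emeasure_pairs_at_distance:
  assumes "compact S" "convex S"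
  shows "emeasure lborel {z \<in> S \<times> S. dist (fst z) (snd z) \<le> t} =
    2 * (\<integral>\<^sup>+\<rho>. indicator {0..t} \<rho> * (ennreal \<rho> * (\<integral>\<^sup>+\<sigma>. indicator {\<rho>..} \<sigma> * line_measure S \<sigma> \<partial>lborel)) \<partial>lborel)"
proof -
  note [measurable] = chords_measurable[OF assms(1)]
  have S[measurable]: "S \<in> sets borel" using assms(1) by (simp add: borel_compact)
  let ?I = "indicator {-pi/2<..<pi/2} :: real \<Rightarrow> ennreal"
  let ?D = "\<lambda>v :: point. indicator {..t} (norm v) :: ennreal"
  have "emeasure lborel {z \<in> S \<times> S. dist (fst z) (snd z) \<le> t} =
      (\<integral>\<^sup>+z. indicator {z \<in> S \<times> S. dist (fst z) (snd z) \<le> t} z \<partial>lborel)"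
  proof (rule nn_integral_indicator[symmetric])
    have "closed (S \<times> S \<inter> {z. dist (fst z) (snd z) \<le> t})"
      using assms(1) by (intro closed_Int closed_Times compact_imp_closed closed_Collect_le continuous_intros)
    then show "{z \<in> S \<times> S. dist (fst z) (snd z) \<le> t} \<in> sets lborel"
      by (simp add: Int_def)
  qed
  also have "\<dots> = (\<integral>\<^sup>+z. indicator S (fst z) * indicator S (snd z) * ?D (snd z - fst z) \<partial>lborel)"
    by (intro nn_integral_cong) (auto simp: dist_norm norm_minus_commute split: split_indicator)
  also have "\<dots> = (\<integral>\<^sup>+x. \<integral>\<^sup>+y. indicator S x * indicator S y * ?D (y - x) \<partial>lborel \<partial>lborel)"
  proof (subst nn_integral_lborel_pair(1))
    have "(\<lambda>z. indicator S (fst z) * indicator S (snd z) * ?D (snd z - fst z)) \<in> borel_measurable (borel \<Otimes>\<^sub>M borel)"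
      by measurable
    then show "(\<lambda>z. indicator S (fst z) * indicator S (snd z) * ?D (snd z - fst z)) \<in> borel_measurable borel"
      by (simp add: borel_prod)
  qed simp
  also have "\<dots> = (\<integral>\<^sup>+x. \<integral>\<^sup>+v. indicator S x * indicator S (x + v) * ?D v \<partial>lborel \<partial>lborel)"
  proof (rule nn_integral_cong)
    fix x :: point
    show "(\<integral>\<^sup>+y. indicator S x * indicator S y * ?D (y - x) \<partial>lborel) =
      (\<integral>\<^sup>+v. indicator S x * indicator S (x + v) * ?D v \<partial>lborel)"
      by (subst nn_integral_translate[where c = x]) simp_all
  qed
  also have "\<dots> = (\<integral>\<^sup>+v. \<integral>\<^sup>+x. indicator S x * indicator S (x + v) * ?D v \<partial>lborel \<partial>lborel)"
    by (rule nn_integral_lborel_swap) simp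
  also have "\<dots> = (\<integral>\<^sup>+v. ?D v * (\<integral>\<^sup>+x. indicator S x * indicator S (x + v) \<partial>lborel) \<partial>lborel)"
    by (simp add: nn_integral_cmult mult.commute)
  also have "\<dots> = (\<integral>\<^sup>+\<phi>. ?I \<phi> * (\<integral>\<^sup>+\<rho>. ennreal \<bar>\<rho>\<bar> * (?D (line_pt 0 \<phi> \<rho>) *
       (\<integral>\<^sup>+x. indicator S x * indicator S (x + line_pt 0 \<phi> \<rho>) \<partial>lborel)) \<partial>lborel) \<partial>lborel)"
    by (rule nn_integral_polar) simp
  also have "\<dots> = (\<integral>\<^sup>+\<phi>. ?I \<phi> * (\<integral>\<^sup>+\<rho>. ennreal \<bar>\<rho>\<bar> * (indicator {..t} \<bar>\<rho>\<bar> *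
       (\<integral>\<^sup>+p. \<integral>\<^sup>+\<sigma>. indicator {\<bar>\<rho>\<bar>..} \<sigma> * indicator (chords S) (\<sigma>, p, \<phi>) \<partial>lborel \<partial>lborel)) \<partial>lborel) \<partial>lborel)"
  proof (rule nn_integral_cong)
    fix \<phi> :: real
    show "?I \<phi> * (\<integral>\<^sup>+\<rho>. ennreal \<bar>\<rho>\<bar> * (?D (line_pt 0 \<phi> \<rho>) *
       (\<integral>\<^sup>+x. indicator S x * indicator S (x + line_pt 0 \<phi> \<rho>) \<partial>lborel)) \<partial>lborel) =
      ?I \<phi> * (\<integral>\<^sup>+\<rho>. ennreal \<bar>\<rho>\<bar> * (indicator {..t} \<bar>\<rho>\<bar> *
       (\<integral>\<^sup>+p. \<integral>\<^sup>+\<sigma>. indicator {\<bar>\<rho>\<bar>..} \<sigma> * indicator (chords S) (\<sigma>, p, \<phi>) \<partial>lborel \<partial>lborel)) \<partial>lborel)"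
    proof (cases "\<phi> \<in> {-pi/2<..<pi/2}")
      case True
      then have c: "cos \<phi> \<noteq> 0" using cos_gt_zero_pi[of \<phi>] by auto
      have "(\<integral>\<^sup>+x. indicator S x * indicator S (x + line_pt 0 \<phi> \<rho>) \<partial>lborel) =
        (\<integral>\<^sup>+p. \<integral>\<^sup>+\<sigma>. indicator {\<bar>\<rho>\<bar>..} \<sigma> * indicator (chords S) (\<sigma>, p, \<phi>) \<partial>lborel \<partial>lborel)" for \<rho>
        by (subst nn_integral_rotate[OF _ c]) (simp_all add: line_pt_add nn_integral_overlap[OF assms])
      moreover have "norm (line_pt 0 \<phi> \<rho>) = \<bar>\<rho>\<bar>" for \<rho>
        using dist_line_pt[of 0 \<phi> \<rho> 0] by (simp add: dist_norm line_pt_diff)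
      ultimately show ?thesis by simp
    qed simp
  qed
  also have "\<dots> = (\<integral>\<^sup>+\<phi>. ?I \<phi> * (2 * (\<integral>\<^sup>+\<rho>. indicator {0..} \<rho> * (ennreal \<rho> * (indicator {..t} \<rho> *
       (\<integral>\<^sup>+p. \<integral>\<^sup>+\<sigma>. indicator {\<rho>..} \<sigma> * indicator (chords S) (\<sigma>, p, \<phi>) \<partial>lborel \<partial>lborel))) \<partial>lborel)) \<partial>lborel)"
    by (subst nn_integral_even) simp_all
  also have "\<dots> = (\<integral>\<^sup>+\<phi>. \<integral>\<^sup>+\<rho>. 2 * (indicator {0..t} \<rho> * (ennreal \<rho> * (?I \<phi> *
       (\<integral>\<^sup>+p. \<integral>\<^sup>+\<sigma>. indicator {\<rho>..} \<sigma> * indicator (chords S) (\<sigma>, p, \<phi>) \<partial>lborel \<partial>lborel)))) \<partial>lborel \<partial>lborel)"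
    apply (subst nn_integral_cmult[symmetric], simp)+
    apply (intro nn_integral_cong)
    apply (auto simp: mult_ac split: split_indicator)
    done
  also have "\<dots> = (\<integral>\<^sup>+\<rho>. \<integral>\<^sup>+\<phi>. 2 * (indicator {0..t} \<rho> * (ennreal \<rho> * (?I \<phi> *
       (\<integral>\<^sup>+p. \<integral>\<^sup>+\<sigma>. indicator {\<rho>..} \<sigma> * indicator (chords S) (\<sigma>, p, \<phi>) \<partial>lborel \<partial>lborel)))) \<partial>lborel \<partial>lborel)"
    by (rule nn_integral_lborel_swap) simp
  also have "\<dots> = (\<integral>\<^sup>+\<rho>. 2 * (indicator {0..t} \<rho> * (ennreal \<rho> * (\<integral>\<^sup>+\<sigma>. indicator {\<rho>..} \<sigma> * line_measure S \<sigma> \<partial>lborel))) \<partial>lborel)"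
    by (simp add: nn_integral_cmult nn_integral_line_measure[OF assms(1), symmetric])
  also have "\<dots> = 2 * (\<integral>\<^sup>+\<rho>. indicator {0..t} \<rho> * (ennreal \<rho> * (\<integral>\<^sup>+\<sigma>. indicator {\<rho>..} \<sigma> * line_measure S \<sigma> \<partial>lborel)) \<partial>lborel)"
    unfolding line_measure_def by (rule nn_integral_cmult) simp
  finally show ?thesis .
qed

text \<open>The parameters \<open>(p, \<phi> + pi)\<close> and \<open>(- p, \<phi>)\<close> denote
  the same line, whence the hypothesis on \<open>G\<close>. The integral \<open>I\<close> over
  nonnegative \<open>p\<close> has period 2 pi, and \<open>I \<phi> + I (\<phi> + pi)\<close> is the
  integral over all \<open>p\<close>. So the full turn is cut at pi / 2 and 3 pi / 2, the middle arc
  is moved back by pi and the last one by 2 pi.\<close>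

lemma nn_integral_half_plane_lines:
  fixes G :: "real \<times> real \<Rightarrow> ennreal"
  assumes [measurable]: "G \<in> borel_measurable (borel \<Otimes>\<^sub>M borel)"
    and pi: "\<And>p \<phi>. G (p, \<phi> + pi) = G (- p, \<phi>)"
  shows "(\<integral>\<^sup>+z. indicator ({0..} \<times> {0..<2 * pi}) z * G z \<partial>lborel) =
    (\<integral>\<^sup>+\<phi>. indicator {-pi/2<..<pi/2} \<phi> * (\<integral>\<^sup>+p. G (p, \<phi>) \<partial>lborel) \<partial>lborel)"
proof -
  define I where "I \<phi> = (\<integral>\<^sup>+p. indicator {0..} p * G (p, \<phi>) \<partial>lborel)" for \<phi>
  have [measurable]: "I \<in> borel_measurable borel" unfolding I_def by simp
  have I_2pi: "I (\<phi> + 2 * pi) = I \<phi>" for \<phi>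
    using pi[of _ "\<phi> + pi"] pi[of _ \<phi>] by (simp add: I_def add.assoc)
  have J: "(\<integral>\<^sup>+p. G (p, \<phi>) \<partial>lborel) = I \<phi> + I (\<phi> + pi)" for \<phi>
  proof -
    have "(\<integral>\<^sup>+p. G (p, \<phi>) \<partial>lborel) = (\<integral>\<^sup>+p. indicator {0..} p * G (p, \<phi>) + indicator {0..} (- p) * G (p, \<phi>) \<partial>lborel)"
      using AE_lborel_singleton[of "0::real"]
      by (intro nn_integral_cong_AE) (auto elim!: eventually_mono split: split_indicator)
    also have "\<dots> = I \<phi> + (\<integral>\<^sup>+p. indicator {0..} (- p) * G (p, \<phi>) \<partial>lborel)"
      unfolding I_def by (rule nn_integral_add) auto
    also have "(\<integral>\<^sup>+p. indicator {0..} (- p) * G (p, \<phi>) \<partial>lborel) = I (\<phi> + pi)"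
      unfolding I_def pi by (subst nn_integral_real_affine[where c = "-1" and t = 0]) auto
    finally show ?thesis .
  qed
  have "(\<integral>\<^sup>+z. indicator ({0..} \<times> {0..<2 * pi}) z * G z \<partial>lborel) =
    (\<integral>\<^sup>+\<phi>. \<integral>\<^sup>+p. indicator ({0..} \<times> {0..<2 * pi}) (p, \<phi>) * G (p, \<phi>) \<partial>lborel \<partial>lborel)"
    by (rule nn_integral_lborel_pair(2)) (simp add: borel_prod[symmetric])
  also have "\<dots> = (\<integral>\<^sup>+\<phi>. indicator {0..<2 * pi} \<phi> * I \<phi> \<partial>lborel)"
    unfolding I_def by (subst nn_integral_cmult[symmetric], simp)
      (auto intro!: nn_integral_cong split: split_indicator)
  also have "\<dots> = (\<integral>\<^sup>+\<phi>. indicator {0..<pi/2} \<phi> * I \<phi> + indicator {pi/2<..<3*pi/2} \<phi> * I \<phi> +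
       indicator {3*pi/2<..<2*pi} \<phi> * I \<phi> \<partial>lborel)"
  proof (rule nn_integral_cong_AE)
    show "AE \<phi> in lborel. indicator {0..<2 * pi} \<phi> * I \<phi> = indicator {0..<pi/2} \<phi> * I \<phi> + indicator {pi/2<..<3*pi/2} \<phi> * I \<phi> +
       indicator {3*pi/2<..<2*pi} \<phi> * I \<phi>"
      using AE_lborel_singleton[of "pi/2"] AE_lborel_singleton[of "3*pi/2"]
    proof eventually_elim
      case (elim \<phi>)
      then show ?case using pi_gt_zero by (auto split: split_indicator)
    qed
  qed
  also have "\<dots> = (\<integral>\<^sup>+\<phi>. indicator {0..<pi/2} \<phi> * I \<phi> \<partial>lborel) + (\<integral>\<^sup>+\<phi>. indicator {pi/2<..<3*pi/2} \<phi> * I \<phi> \<partial>lborel) +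
       (\<integral>\<^sup>+\<phi>. indicator {3*pi/2<..<2*pi} \<phi> * I \<phi> \<partial>lborel)"
    by (simp add: nn_integral_add)
  also have "(\<integral>\<^sup>+\<phi>. indicator {pi/2<..<3*pi/2} \<phi> * I \<phi> \<partial>lborel) =
      (\<integral>\<^sup>+\<phi>. indicator {-pi/2<..<pi/2} \<phi> * I (\<phi> + pi) \<partial>lborel)"
    by (subst nn_integral_real_affine[where c = 1 and t = pi])
      (auto intro!: nn_integral_cong simp: add.commute split: split_indicator)
  also have "(\<integral>\<^sup>+\<phi>. indicator {3*pi/2<..<2*pi} \<phi> * I \<phi> \<partial>lborel) =
      (\<integral>\<^sup>+\<phi>. indicator {-pi/2<..<0} \<phi> * I \<phi> \<partial>lborel)"
    by (subst nn_integral_real_affine[where c = 1 and t = "2 * pi"])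
      (auto intro!: nn_integral_cong simp: add.commute[of "2 * pi"] I_2pi split: split_indicator)
  also have "(\<integral>\<^sup>+\<phi>. indicator {0..<pi/2} \<phi> * I \<phi> \<partial>lborel) + (\<integral>\<^sup>+\<phi>. indicator {-pi/2<..<pi/2} \<phi> * I (\<phi> + pi) \<partial>lborel) +
      (\<integral>\<^sup>+\<phi>. indicator {-pi/2<..<0} \<phi> * I \<phi> \<partial>lborel) =
      (\<integral>\<^sup>+\<phi>. indicator {0..<pi/2} \<phi> * I \<phi> + indicator {-pi/2<..<pi/2} \<phi> * I (\<phi> + pi) + indicator {-pi/2<..<0} \<phi> * I \<phi> \<partial>lborel)"
    by (simp add: nn_integral_add)
  also have "\<dots> = (\<integral>\<^sup>+\<phi>. indicator {-pi/2<..<pi/2} \<phi> * (\<integral>\<^sup>+p. G (p, \<phi>) \<partial>lborel) \<partial>lborel)"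
    unfolding J by (intro nn_integral_cong) (auto simp: add.commute split: split_indicator)
  finally show ?thesis .
qed

lemma has_chord_plus_pi: "has_chord S s p (\<phi> + pi) \<longleftrightarrow> has_chord S s (- p) \<phi>"
proof
  assume "has_chord S s p (\<phi> + pi)"
  then obtain q where "line_pt (- p) \<phi> (- q) \<in> S" "line_pt (- p) \<phi> (- (q + s)) \<in> S"
    by (auto simp: has_chord_def line_pt_plus_pi)
  then show "has_chord S s (- p) \<phi>"
    unfolding has_chord_def by (intro exI[of _ "- (q + s)"]) (simp add: add.commute)
next
  assume "has_chord S s (- p) \<phi>"
  then obtain q where "line_pt (- p) \<phi> q \<in> S" "line_pt (- p) \<phi> (q + s) \<in> S"
    by (auto simp: has_chord_def)
  then show "has_chord S s p (\<phi> + pi)"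
    unfolding has_chord_def line_pt_plus_pi by (intro exI[of _ "- (q + s)"]) (simp add: add.commute)
qed

lemma emeasure_chords_half_plane:
  assumes "compact S"
  shows "{z. 0 \<le> fst z \<and> 0 \<le> snd z \<and> snd z < 2 * pi \<and> has_chord S s (fst z) (snd z)} \<in> sets lborel" (is "?A \<in> _")
    and "emeasure lborel {z. 0 \<le> fst z \<and> 0 \<le> snd z \<and> snd z < 2 * pi \<and> has_chord S s (fst z) (snd z)} = line_measure S s"
proof -
  note [measurable] = chords_measurable[OF assms]
  have eq: "?A = {0..} \<times> {0..<2*pi} \<inter> {z. (s, fst z, snd z) \<in> chords S}"
    by (auto simp: chords_def)
  have "{z \<in> space (borel \<Otimes>\<^sub>M borel). (s, fst z, snd z) \<in> chords S} \<in> sets (borel \<Otimes>\<^sub>M borel)" by measurable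
  then have "{z. (s, fst z, snd z) \<in> chords S} \<in> sets (borel \<Otimes>\<^sub>M borel)" by (simp add: space_pair_measure)
  moreover have "{0..} \<times> {0..<2*pi} \<in> sets (borel \<Otimes>\<^sub>M borel :: (real \<times> real) measure)" by measurable
  ultimately have "?A \<in> sets (borel \<Otimes>\<^sub>M borel)" unfolding eq by (rule sets.Int[rotated])
  then show A: "?A \<in> sets lborel" by (simp only: borel_prod sets_lborel)
  have "emeasure lborel ?A = (\<integral>\<^sup>+z. indicator ?A z \<partial>lborel)"
    using A by (rule nn_integral_indicator[symmetric])
  also have "\<dots> = (\<integral>\<^sup>+z. indicator ({0..} \<times> {0..<2 * pi}) z * indicator (chords S) (s, fst z, snd z) \<partial>lborel)"
    by (intro nn_integral_cong) (auto simp: eq split: split_indicator)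
  also have "\<dots> = (\<integral>\<^sup>+\<phi>. indicator {-pi/2<..<pi/2} \<phi> * (\<integral>\<^sup>+p. indicator (chords S) (s, fst (p, \<phi>), snd (p, \<phi>)) \<partial>lborel) \<partial>lborel)"
  proof (rule nn_integral_half_plane_lines)
    show "(\<lambda>z. indicator (chords S) (s, fst z, snd z)) \<in> borel_measurable (borel \<Otimes>\<^sub>M borel)"
      by measurable
  qed (simp add: chords_def has_chord_plus_pi indicator_def)
  also have "\<dots> = line_measure S s"
    unfolding line_measure_def by (simp add: nn_integral_cmult)
  finally show "emeasure lborel ?A = line_measure S s" .
qed

section \<open>Short chords against long chords\<close>

lemma has_chord_mono:
  assumes "convex S" "has_chord S s p \<phi>" "0 \<le> s'" "s' \<le> s"
  shows "has_chord S s' p \<phi>"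
proof -
  obtain q where q: "line_pt p \<phi> q \<in> S" "line_pt p \<phi> (q + s) \<in> S"
    using assms(2) by (auto simp: has_chord_def)
  show ?thesis
  proof (cases "s = 0")
    case False
    have "(1 - s' / s) *\<^sub>R line_pt p \<phi> q + (s' / s) *\<^sub>R line_pt p \<phi> (q + s) \<in> S"
      using False assms(3,4) by (intro convexD[OF assms(1) q]) auto
    also have "(1 - s' / s) *\<^sub>R line_pt p \<phi> q + (s' / s) *\<^sub>R line_pt p \<phi> (q + s) = line_pt p \<phi> (q + s')"
    proof -
      have "(1 - s' / s) * p + s' / s * p = p" "(1 - s' / s) * q + s' / s * (q + s) = q + s'"
        using False by (simp_all add: field_simps)
      then show ?thesis by (simp add: line_pt_scaleR line_pt_add)
    qed
    finally show ?thesis using q(1) by (auto simp: has_chord_def)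
  qed (use assms in auto)
qed

lemma line_measure_antimono:
  assumes "compact S" "convex S" "0 \<le> s'" "s' \<le> s"
  shows "line_measure S s \<le> line_measure S s'"
  unfolding emeasure_chords_half_plane(2)[OF assms(1), symmetric]
  using has_chord_mono[OF assms(2) _ assms(3,4)] emeasure_chords_half_plane(1)[OF assms(1)]
  by (intro emeasure_mono) auto

text \<open>The numerator of the chord length distribution function, for an arbitrary body.\<close>

definition short_chord_measure :: "point set \<Rightarrow> real \<Rightarrow> real" where
  "short_chord_measure S s = measure lborel {z :: real \<times> real. 0 \<le> fst z \<and> 0 \<le> snd z \<and> snd z < 2 * pi \<and>
      line (fst z) (snd z) \<inter> S \<noteq> {} \<and> diameter (line (fst z) (snd z) \<inter> S) \<le> s}"

text \<open>\<open>D 0 - D s\<close> collects the lines with chords shorter than \<open>s\<close>,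
  and \<open>D 0 - D s'\<close> those with chords shorter than \<open>s'\<close>; the lines with
  chords of length at most \<open>s\<close> lie between. The bounds meet as \<open>s'\<close> tends
  to \<open>s\<close> wherever \<open>line_measure S\<close> is continuous from the right.\<close>

lemma short_chord_measure_bounds:
  assumes "compact S" "convex S" "line_measure S 0 < \<infinity>" "0 \<le> s" "s < s'"
  shows "enn2real (line_measure S 0) - enn2real (line_measure S s) \<le> short_chord_measure S s"
    and "short_chord_measure S s \<le> enn2real (line_measure S 0) - enn2real (line_measure S s')"
proof -
  define D where "D s = {z :: real \<times> real. 0 \<le> fst z \<and> 0 \<le> snd z \<and> snd z < 2 * pi \<and> has_chord S s (fst z) (snd z)}" for s
  have D: "D s \<in> sets lborel" "emeasure lborel (D s) = line_measure S s" for s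
    unfolding D_def by (rule emeasure_chords_half_plane[OF assms(1)])+
  have fin: "emeasure lborel (D s) < \<infinity>" if "0 \<le> s" for s
    using line_measure_antimono[OF assms(1,2) order_refl that] assms(3) unfolding D by (rule le_less_trans)
  have sub: "D s \<subseteq> D s'" if "0 \<le> s'" "s' \<le> s" for s s'
    using has_chord_mono[OF assms(2) _ that] by (auto simp: D_def)
  have diff: "measure lborel (D 0 - D s) = enn2real (line_measure S 0) - enn2real (line_measure S s)" if "0 \<le> s" for s
    using measure_Diff[OF _ D(1) D(1) sub[OF _ that]] fin[of 0] by (simp add: measure_def D(2))
  define M where "M = {z :: real \<times> real. 0 \<le> fst z \<and> 0 \<le> snd z \<and> snd z < 2 * pi \<and>
      line (fst z) (snd z) \<inter> S \<noteq> {} \<and> diameter (line (fst z) (snd z) \<inter> S) \<le> s}"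
  \<comment> \<open>This settles the measurability of \<open>M\<close>: a chord is longer than
    \<open>s\<close> iff it reaches \<open>s + 1 / (m + 1)\<close> for some
    \<open>m\<close>.\<close>
  have M_eq: "M = D 0 - (\<Union>m. D (s + 1 / real (Suc m)))"
  proof -
    have "(\<exists>m. s + 1 / real (Suc m) \<le> c) \<longleftrightarrow> s < c" for c
    proof
      assume "s < c"
      then obtain m where "1 / real (Suc m) < c - s"
        using nat_approx_posE[of "c - s"] by auto
      then show "\<exists>m. s + 1 / real (Suc m) \<le> c" by (intro exI[of _ m]) simp
    next
      assume "\<exists>m. s + 1 / real (Suc m) \<le> c"
      then obtain m where "s + 1 / real (Suc m) \<le> c" by blast
      moreover have "1 / real (Suc m) > 0" by simp
      ultimately show "s < c" by linarith
    qed
    moreover have "0 \<le> diameter (line p \<phi> \<inter> S)" for p \<phi>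
      using assms(1) by (intro diameter_ge_0 bounded_Int) (simp add: compact_imp_bounded)
    ultimately show ?thesis
      unfolding M_def D_def using assms(4)
      by (auto simp: has_chord_iff_diameter[OF assms(1,2)] not_le simp del: of_nat_Suc)
        (meson not_le)+
  qed
  then have M: "M \<in> sets lborel" using D(1) by auto
  have "0 \<le> diameter (line p \<phi> \<inter> S)" for p \<phi>
    using assms(1) by (intro diameter_ge_0 bounded_Int) (simp add: compact_imp_bounded)
  then have inc: "D 0 - D s \<subseteq> M" "M \<subseteq> D 0 - D s'"
    using assms(4,5) unfolding M_def D_def
    by (auto simp: has_chord_iff_diameter[OF assms(1,2)])
  have fM: "D 0 - D s \<in> fmeasurable lborel" "M \<in> fmeasurable lborel" "D 0 - D s' \<in> fmeasurable lborel"
  proof -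
    have "D 0 \<in> fmeasurable lborel" using D(1) fin[of 0] by (intro fmeasurableI) auto
    then show "D 0 - D s \<in> fmeasurable lborel" "M \<in> fmeasurable lborel" "D 0 - D s' \<in> fmeasurable lborel"
      using D(1) M M_eq by (auto intro: fmeasurableI2[of "D 0"])
  qed
  show "enn2real (line_measure S 0) - enn2real (line_measure S s) \<le> short_chord_measure S s"
    using measure_mono_fmeasurable[OF inc(1) fmeasurableD[OF fM(1)] fM(2)] diff[OF assms(4)]
    by (simp add: short_chord_measure_def M_def)
  show "short_chord_measure S s \<le> enn2real (line_measure S 0) - enn2real (line_measure S s')"
    using measure_mono_fmeasurable[OF inc(2) fmeasurableD[OF fM(2)] fM(3)] diff[of s'] assms(4,5)
    by (simp add: short_chord_measure_def M_def)
qed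

text \<open>A monotone function has only countably many discontinuities, so the distinction between
  chords of length \<open>> s\<close> and of length \<open>\<ge> s\<close> is irrelevant.\<close>

lemma countable_short_chord_measure:
  assumes "compact S" "convex S" "line_measure S 0 < \<infinity>"
  shows "countable {s \<in> {0..}. short_chord_measure S s \<noteq> enn2real (line_measure S 0) - enn2real (line_measure S s)}"
proof -
  define f where "f s = - enn2real (line_measure S s)" for s
  have "mono_on {0..} f"
  proof (rule mono_onI)
    fix s' s :: real assume "s' \<in> {0..}" "s \<in> {0..}" "s' \<le> s"
    then have "line_measure S s \<le> line_measure S s'" "line_measure S s' \<le> line_measure S 0"
      using line_measure_antimono[OF assms(1,2)] by auto
    then show "f s' \<le> f s"
      unfolding f_def using assms(3) by (simp add: enn2real_mono)
  qed
  then have ctbl: "countable {s \<in> {0..}. \<not> continuous (at s within {0..}) f}"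
    by (rule mono_on_ctble_discont)
  have eq: "short_chord_measure S s = enn2real (line_measure S 0) + f s"
    if s: "0 \<le> s" and c: "continuous (at s within {0..}) f" for s
  proof (rule antisym)
    have "(f \<longlongrightarrow> f s) (at_right s)"
      using c[unfolded continuous_within] by (rule tendsto_mono[OF at_le, rotated]) (use s in auto)
    then have lim: "((\<lambda>s'. enn2real (line_measure S 0) + f s') \<longlongrightarrow> enn2real (line_measure S 0) + f s) (at_right s)"
      by (intro tendsto_intros)
    have "eventually (\<lambda>s'. short_chord_measure S s \<le> enn2real (line_measure S 0) + f s') (at_right s)"
      using short_chord_measure_bounds(2)[OF assms s] by (auto simp: eventually_at_right_field f_def intro: exI[of _ "s + 1"])
    then show "short_chord_measure S s \<le> enn2real (line_measure S 0) + f s"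
      by (rule tendsto_lowerbound[OF lim]) simp
    show "enn2real (line_measure S 0) + f s \<le> short_chord_measure S s"
      using short_chord_measure_bounds(1)[OF assms s, of "s + 1"] by (simp add: f_def)
  qed
  show ?thesis
    by (rule countable_subset[OF _ ctbl]) (use eq in \<open>auto simp: f_def\<close>)
qed

subsection \<open>Geometry of the regular polygon\<close>

text \<open>The vertices sit at the even multiples of pi / n, so the outward normals of the sides
  point along the odd ones. Allowing every integer \<open>m\<close> avoids reductions modulo
  \<open>n\<close>.\<close>

definition facet_angle :: "nat \<Rightarrow> real \<Rightarrow> bool" where
  "facet_angle n \<theta> \<longleftrightarrow> (\<exists>m::int. \<theta> = of_int (2 * m + 1) * pi / real n)"

lemma inner_line_pt: "line_pt p \<phi> q \<bullet> (cos \<theta>, sin \<theta>) = p * cos (\<theta> - \<phi>) + q * sin (\<theta> - \<phi>)"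
  by (simp add: line_pt_def inner_prod_def cos_diff sin_diff algebra_simps)

lemma line_pt_change_angle:
  "line_pt a \<theta> \<tau> = line_pt (a * cos (\<theta> - \<phi>) - \<tau> * sin (\<theta> - \<phi>)) \<phi> (a * sin (\<theta> - \<phi>) + \<tau> * cos (\<theta> - \<phi>))"
proof -
  have 1: "cos \<theta> = cos (\<theta> - \<phi>) * cos \<phi> - sin (\<theta> - \<phi>) * sin \<phi>"
    using cos_add[of "\<theta> - \<phi>" \<phi>] by simp
  have 2: "sin \<theta> = sin (\<theta> - \<phi>) * cos \<phi> + cos (\<theta> - \<phi>) * sin \<phi>"
    using sin_add[of "\<theta> - \<phi>" \<phi>] by simp
  show ?thesis unfolding line_pt_def 1 2 by (simp add: algebra_simps)
qed

lemma cos_add_int_2pi: "cos (x + of_int j * (2 * pi)) = cos x"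
  and sin_add_int_2pi: "sin (x + of_int j * (2 * pi)) = sin x"
  using cos_integer_2pi[of "of_int j"] sin_integer_2pi[of "of_int j"]
  by (simp_all add: cos_add sin_add mult.commute)

text \<open>This is the inequality behind the half-planes of the sides: a vertex direction and a
  side normal differ by an odd multiple of pi / n, and modulo 2 pi none of these is closer to 0 than
  pi / n. Reduction modulo 2 n and reflection at n bring the angle into [0, pi], where the cosine
  decreases.\<close>

lemma cos_odd_multiple_le:
  fixes k :: int
  assumes "n > 0" "odd k"
  shows "cos (of_int k * pi / real n) \<le> cos (pi / real n)"
proof -
  define i where "i = k mod (2 * int n)"
  have i: "0 \<le> i" "i < 2 * int n" using assms(1) by (simp_all add: i_def)
  have "odd i"
    using assms(2) unfolding i_def by (metis dvd_mod_iff dvd_triv_left)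
  then have i1: "1 \<le> i" using i(1) by (cases "i = 0") auto
  have k: "k = i + 2 * int n * (k div (2 * int n))" by (simp add: i_def)
  have "of_int k * pi / real n = of_int i * pi / real n + of_int (k div (2 * int n)) * (2 * pi)"
    using assms(1) by (subst k) (simp add: field_simps)
  then have eq: "cos (of_int k * pi / real n) = cos (of_int i * pi / real n)"
    by (simp only: cos_add_int_2pi)
  show ?thesis
  proof (cases "i \<le> int n")
    case True
    have "cos (of_int i * pi / real n) \<le> cos (pi / real n)"
    proof (rule cos_monotone_0_pi_le)
      show "pi / real n \<le> of_int i * pi / real n"
        using assms(1) i1 by (intro divide_right_mono) auto
      show "of_int i * pi / real n \<le> pi"
        using assms(1) True by (simp add: field_simps)
    qed simp
    then show ?thesis unfolding eq .
  next
    case False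
    have "cos (of_int i * pi / real n) = cos (2 * pi - of_int i * pi / real n)"
      by (simp add: cos_diff)
    also have "2 * pi - of_int i * pi / real n = of_int (2 * int n - i) * pi / real n"
      using assms(1) by (simp add: field_simps)
    also have "cos (of_int (2 * int n - i) * pi / real n) \<le> cos (pi / real n)"
    proof (rule cos_monotone_0_pi_le)
      have "(1::real) \<le> of_int (2 * int n - i)" using i(2) by linarith
      then show "pi / real n \<le> of_int (2 * int n - i) * pi / real n"
        by (intro divide_right_mono) auto
      have "of_int (2 * int n - i) \<le> real n" using False by linarith
      then show "of_int (2 * int n - i) * pi / real n \<le> pi"
        using assms(1) by (simp add: field_simps)
    qed simp
    finally show ?thesis unfolding eq .
  qed
qed

locale regular_polygon =
  fixes n :: nat and r :: real
  assumes n_ge: "n \<ge> 3" and r_pos: "r > 0"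
begin

abbreviation "P \<equiv> polygon n r"
abbreviation "apothem \<equiv> r * cos (pi / real n)"

text \<open>With integer indices, the rotations and the reflection of the polygon are the index maps
  \<open>m + c\<close> and \<open>- m\<close>.\<close>

definition vertex :: "int \<Rightarrow> point" where
  "vertex m = (r * cos (2 * pi * of_int m / real n), r * sin (2 * pi * of_int m / real n))"

lemma n_pos [simp]: "0 < n" "n \<noteq> 0" using n_ge by simp_all

lemma pi_n_bounds: "0 < pi / real n" "pi / real n \<le> pi / 3" "pi / real n < pi / 2"
proof -
  show "pi / real n \<le> pi / 3" using n_ge by (intro divide_left_mono) auto
  then show "pi / real n < pi / 2" using pi_gt_zero by linarith
qed simp

lemma vertex_mod: "vertex (m mod int n) = vertex m"
proof -
  have "2 * pi * of_int m / real n = 2 * pi * of_int (m mod int n) / real n + of_int (m div int n) * (2 * pi)"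
  proof -
    have m: "m = m mod int n + int n * (m div int n)" by simp
    have "of_int m = (of_int (m mod int n) + real n * of_int (m div int n) :: real)"
      by (subst m, simp only: of_int_add of_int_mult of_int_of_nat_eq)
    then show ?thesis by (simp add: field_simps)
  qed
  then show ?thesis
    by (simp only: vertex_def cos_add_int_2pi sin_add_int_2pi)
qed

lemma polygon_eq_hull: "P = convex hull (range vertex)"
proof -
  have "{(r * cos (2 * pi * real j / real n), r * sin (2 * pi * real j / real n)) | j. j < n} = range vertex"
  proof (intro set_eqI iffI)
    fix z assume "z \<in> {(r * cos (2 * pi * real j / real n), r * sin (2 * pi * real j / real n)) | j. j < n}"
    then obtain j where "z = vertex (int j)" by (auto simp: vertex_def)
    then show "z \<in> range vertex" by blast
  next
    fix z assume "z \<in> range vertex"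
    then obtain m where "z = vertex m" by blast
    then have "z = vertex (int (nat (m mod int n)))" using n_ge by (simp add: vertex_mod)
    moreover have "nat (m mod int n) < n" using n_ge by (simp add: nat_less_iff)
    ultimately show "z \<in> {(r * cos (2 * pi * real j / real n), r * sin (2 * pi * real j / real n)) | j. j < n}"
      by (auto simp: vertex_def intro!: exI[of _ "nat (m mod int n)"])
  qed
  then show ?thesis by (simp add: polygon_def)
qed

lemma vertex_in: "vertex m \<in> P"
  unfolding polygon_eq_hull by (simp add: hull_inc)

lemma compact_polygon: "compact P"
proof -
  have "{(r * cos (2 * pi * real j / real n), r * sin (2 * pi * real j / real n)) | j. j < n} =
     (\<lambda>j. (r * cos (2 * pi * real j / real n), r * sin (2 * pi * real j / real n))) ` {..<n}" by auto
  then show ?thesis unfolding polygon_def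
    by (intro compact_convex_hull finite_imp_compact) auto
qed

lemma convex_polygon: "convex P"
  by (simp add: polygon_def)

lemma polygon_inner_le:
  assumes "\<And>m. vertex m \<bullet> v \<le> b" "z \<in> P"
  shows "z \<bullet> v \<le> b"
proof -
  have "range vertex \<subseteq> {z. v \<bullet> z \<le> b}" using assms(1) by (auto simp: inner_commute)
  then have "P \<subseteq> {z. v \<bullet> z \<le> b}"
    unfolding polygon_eq_hull by (rule hull_minimal) (rule convex_halfspace_le)
  then show ?thesis using assms(2) by (auto simp: inner_commute)
qed

lemma vertex_inner: "vertex m \<bullet> (cos \<theta>, sin \<theta>) = r * cos (2 * pi * of_int m / real n - \<theta>)"
  by (simp add: vertex_def inner_prod_def cos_diff algebra_simps)

lemma polygon_facet:
  assumes "z \<in> P" "facet_angle n \<theta>"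
  shows "z \<bullet> (cos \<theta>, sin \<theta>) \<le> apothem"
proof (rule polygon_inner_le[OF _ assms(1)])
  fix m
  obtain j :: int where j: "\<theta> = of_int (2 * j + 1) * pi / real n"
    using assms(2) by (auto simp: facet_angle_def)
  have "2 * pi * of_int m / real n - \<theta> = of_int (2 * (m - j) - 1) * pi / real n"
    unfolding j by (simp add: algebra_simps add_divide_distrib diff_divide_distrib)
  then have "cos (2 * pi * of_int m / real n - \<theta>) \<le> cos (pi / real n)"
    using cos_odd_multiple_le[of n "2 * (m - j) - 1"] n_ge by simp
  then show "vertex m \<bullet> (cos \<theta>, sin \<theta>) \<le> apothem"
    unfolding vertex_inner using r_pos by (intro mult_left_mono) auto
qed

lemma polygon_inner_le_radius:
  assumes "z \<in> P"
  shows "z \<bullet> (cos \<theta>, sin \<theta>) \<le> r"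
proof (rule polygon_inner_le[OF _ assms])
  fix m show "vertex m \<bullet> (cos \<theta>, sin \<theta>) \<le> r"
    unfolding vertex_inner using r_pos by (simp add: mult_le_cancel_left1)
qed

text \<open>Here \<tau> is the signed distance from the midpoint of the side, whose half-length is
  \<open>r * sin (pi / real n)\<close>; the point is a convex combination of two neighbouring
  vertices.\<close>

lemma side_in_polygon:
  assumes "facet_angle n \<theta>" "\<bar>\<tau>\<bar> \<le> r * sin (pi / real n)"
  shows "line_pt apothem \<theta> \<tau> \<in> P"
proof -
  obtain m :: int where m: "\<theta> = of_int (2 * m + 1) * pi / real n"
    using assms(1) by (auto simp: facet_angle_def)
  define h where "h = r * sin (pi / real n)"
  have h: "h > 0" using r_pos pi_n_bounds sin_gt_zero2[of "pi / real n"] by (simp add: h_def)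
  have e: "2 * pi * of_int m / real n = \<theta> - pi / real n" "2 * pi * of_int (m + 1) / real n = \<theta> + pi / real n"
    unfolding m by (simp_all add: algebra_simps add_divide_distrib)
  have v: "vertex m = line_pt apothem \<theta> (- h)" "vertex (m + 1) = line_pt apothem \<theta> h"
    unfolding vertex_def e by (simp_all add: line_pt_def h_def cos_diff sin_diff cos_add sin_add algebra_simps)
  have "((h - \<tau>) / (2 * h)) *\<^sub>R vertex m + ((h + \<tau>) / (2 * h)) *\<^sub>R vertex (m + 1) \<in> P"
    using assms(2) h by (intro convexD[OF convex_polygon vertex_in vertex_in]) (auto simp: h_def[symmetric] field_simps)
  also have "((h - \<tau>) / (2 * h)) *\<^sub>R vertex m + ((h + \<tau>) / (2 * h)) *\<^sub>R vertex (m + 1) = line_pt apothem \<theta> \<tau>"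
  proof -
    have "(h - \<tau>) / (2 * h) * apothem + (h + \<tau>) / (2 * h) * apothem = apothem"
      "(h - \<tau>) / (2 * h) * (- h) + (h + \<tau>) / (2 * h) * h = \<tau>"
      using h by (simp_all add: field_simps)
    then show ?thesis unfolding v line_pt_scaleR line_pt_add by simp
  qed
  finally show ?thesis .
qed

lemma polygon_rotate:
  assumes "line_pt p \<phi> q \<in> P"
  shows "line_pt p (\<phi> + of_int c * (2 * pi / real n)) q \<in> P"
proof -
  define \<alpha> where "\<alpha> = of_int c * (2 * pi / real n)"
  let ?f = "\<lambda>z :: point. (fst z * cos \<alpha> - snd z * sin \<alpha>, fst z * sin \<alpha> + snd z * cos \<alpha>)"
  have lin: "linear ?f"
    by (rule linearI) (auto simp: algebra_simps)
  have "?f (vertex m) = vertex (m + c)" for m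
  proof -
    have "2 * pi * of_int (m + c) / real n = 2 * pi * of_int m / real n + \<alpha>"
      by (simp add: \<alpha>_def algebra_simps add_divide_distrib)
    then show ?thesis by (simp add: vertex_def cos_add sin_add algebra_simps)
  qed
  then have "?f ` range vertex \<subseteq> range vertex" by auto
  then have "?f ` P \<subseteq> P"
    unfolding polygon_eq_hull convex_hull_linear_image[OF lin] by (rule hull_mono)
  moreover have "?f (line_pt p \<phi> q) = line_pt p (\<phi> + \<alpha>) q"
    by (simp add: line_pt_def cos_add sin_add algebra_simps)
  ultimately show ?thesis using assms by (auto simp: \<alpha>_def)
qed

lemma polygon_reflect:
  assumes "line_pt p \<phi> q \<in> P"
  shows "line_pt p (- \<phi>) (- q) \<in> P"
proof -
  let ?f = "\<lambda>z :: point. (fst z, - snd z)"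
  have lin: "linear ?f" by (rule linearI) auto
  have "?f (vertex m) = vertex (- m)" for m by (simp add: vertex_def)
  then have "?f ` range vertex \<subseteq> range vertex" by auto
  then have "?f ` P \<subseteq> P"
    unfolding polygon_eq_hull convex_hull_linear_image[OF lin] by (rule hull_mono)
  moreover have "?f (line_pt p \<phi> q) = line_pt p (- \<phi>) (- q)"
    by (simp add: line_pt_def)
  ultimately show ?thesis using assms by auto
qed

lemma has_chord_rotate: "has_chord P s p (\<phi> + of_int c * (2 * pi / real n)) \<longleftrightarrow> has_chord P s p \<phi>"
proof -
  have "line_pt p (\<phi> + of_int c * (2 * pi / real n)) q \<in> P \<longleftrightarrow> line_pt p \<phi> q \<in> P" for q
    using polygon_rotate[of p \<phi> q c] polygon_rotate[of p "\<phi> + of_int c * (2 * pi / real n)" q "- c"]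
    by (auto simp: algebra_simps)
  then show ?thesis by (simp add: has_chord_def)
qed

lemma has_chord_reflect: "has_chord P s p (- \<phi>) \<longleftrightarrow> has_chord P s p \<phi>"
proof -
  have *: "has_chord P s p (- \<phi>)" if "has_chord P s p \<phi>" for \<phi>
  proof -
    from that obtain q where "line_pt p \<phi> q \<in> P" "line_pt p \<phi> (q + s) \<in> P"
      by (auto simp: has_chord_def)
    from this[THEN polygon_reflect] show ?thesis
      unfolding has_chord_def by (intro exI[of _ "- (q + s)"]) (simp add: add.commute)
  qed
  show ?thesis using *[of \<phi>] *[of "- \<phi>"] by auto
qed

text \<open>A chord of length \<open>s\<close> cuts off a triangle from the angle formed by the two side lines
  with normals \<open>c \<plusminus> \<delta>\<close>; this bounds its distance \<open>p\<close> from the centre.\<close>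

lemma has_chord_upper:
  assumes "has_chord P s p (c + \<psi>)" "facet_angle n (c + \<delta>)" "facet_angle n (c - \<delta>)"
    and "0 \<le> sin (\<delta> - \<psi>)" "0 \<le> sin (\<delta> + \<psi>)"
  shows "p * sin (2 * \<delta>) + s * sin (\<delta> - \<psi>) * sin (\<delta> + \<psi>) \<le> 2 * apothem * sin \<delta> * cos \<psi>"
proof -
  from assms(1) obtain q where q: "line_pt p (c + \<psi>) q \<in> P" "line_pt p (c + \<psi>) (q + s) \<in> P"
    by (auto simp: has_chord_def)
  have 1: "p * cos (\<delta> - \<psi>) + (q + s) * sin (\<delta> - \<psi>) \<le> apothem"
    using polygon_facet[OF q(2) assms(2)] by (simp add: inner_line_pt)
  have "p * cos (- (\<delta> + \<psi>)) + q * sin (- (\<delta> + \<psi>)) \<le> apothem"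
    using polygon_facet[OF q(1) assms(3)] unfolding inner_line_pt by (simp add: algebra_simps)
  then have 2: "p * cos (\<delta> + \<psi>) - q * sin (\<delta> + \<psi>) \<le> apothem"
    unfolding cos_minus sin_minus by simp
  \<comment> \<open>These weights eliminate \<open>q\<close>, the unknown position of the chord on
    its line.\<close>
  have "(p * cos (\<delta> - \<psi>) + (q + s) * sin (\<delta> - \<psi>)) * sin (\<delta> + \<psi>) +
        (p * cos (\<delta> + \<psi>) - q * sin (\<delta> + \<psi>)) * sin (\<delta> - \<psi>) \<le>
        apothem * sin (\<delta> + \<psi>) + apothem * sin (\<delta> - \<psi>)"
    using mult_right_mono[OF 1 assms(5)] mult_right_mono[OF 2 assms(4)] by linarith
  moreover have "(p * cos (\<delta> - \<psi>) + (q + s) * sin (\<delta> - \<psi>)) * sin (\<delta> + \<psi>) +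
        (p * cos (\<delta> + \<psi>) - q * sin (\<delta> + \<psi>)) * sin (\<delta> - \<psi>) =
        p * sin (2 * \<delta>) + s * sin (\<delta> - \<psi>) * sin (\<delta> + \<psi>)"
  proof -
    have "sin (2 * \<delta>) = sin (\<delta> + \<psi>) * cos (\<delta> - \<psi>) + cos (\<delta> + \<psi>) * sin (\<delta> - \<psi>)"
      using sin_add[of "\<delta> + \<psi>" "\<delta> - \<psi>"] by simp
    then show ?thesis by algebra
  qed
  moreover have "apothem * sin (\<delta> + \<psi>) + apothem * sin (\<delta> - \<psi>) = 2 * apothem * sin \<delta> * cos \<psi>"
    unfolding sin_add sin_diff by algebra
  ultimately show ?thesis by simp
qed

text \<open>Both ends of the chord are projected to a side normal. The polygon extends to
  \<open>apothem\<close> in that direction and at most to \<open>r\<close> in the opposite one, or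
  to \<open>apothem\<close> if a parallel side lies there; the projected length
  \<open>s * \<bar>sin (\<theta> - \<phi>)\<bar>\<close> cannot exceed the sum.\<close>

lemma has_chord_strip:
  assumes "has_chord P s p \<phi>" "facet_angle n \<theta>"
  shows "s * \<bar>sin (\<theta> - \<phi>)\<bar> \<le> apothem + r"
    and "facet_angle n (\<theta> + pi) \<Longrightarrow> s * \<bar>sin (\<theta> - \<phi>)\<bar> \<le> 2 * apothem"
proof -
  from assms(1) obtain q where q: "line_pt p \<phi> q \<in> P" "line_pt p \<phi> (q + s) \<in> P"
    by (auto simp: has_chord_def)
  have *: "s * \<bar>sin (\<theta> - \<phi>)\<bar> \<le> apothem + b" if "\<And>z. z \<in> P \<Longrightarrow> z \<bullet> (cos (\<theta> + pi), sin (\<theta> + pi)) \<le> b" for b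
  proof -
    have "p * cos (\<theta> - \<phi>) + q * sin (\<theta> - \<phi>) \<le> apothem" "p * cos (\<theta> - \<phi>) + (q + s) * sin (\<theta> - \<phi>) \<le> apothem"
      using polygon_facet[OF q(1) assms(2)] polygon_facet[OF q(2) assms(2)] by (simp_all add: inner_line_pt)
    moreover have "- (p * cos (\<theta> - \<phi>) + q * sin (\<theta> - \<phi>)) \<le> b" "- (p * cos (\<theta> - \<phi>) + (q + s) * sin (\<theta> - \<phi>)) \<le> b"
      using that[OF q(1)] that[OF q(2)] unfolding inner_line_pt[symmetric] by (simp_all add: inner_prod_def)
    ultimately show ?thesis by (cases "sin (\<theta> - \<phi>) \<ge> 0") (simp_all add: algebra_simps)
  qed
  show "s * \<bar>sin (\<theta> - \<phi>)\<bar> \<le> apothem + r"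
    by (rule *) (rule polygon_inner_le_radius)
  show "s * \<bar>sin (\<theta> - \<phi>)\<bar> \<le> 2 * apothem" if "facet_angle n (\<theta> + pi)"
    using *[OF polygon_facet[OF _ that]] by simp
qed

text \<open>The signed distance from the centre at which a chord of length \<open>s\<close> with
  normal \<open>c + \<psi>\<close> ends exactly on the side lines with normals c \<plusminus>
  \<delta>, that is, the case of equality in \<open>has_chord_upper\<close>. By rotation it does not
  depend on \<open>c\<close>.\<close>

definition chord_pos :: "real \<Rightarrow> real \<Rightarrow> real \<Rightarrow> real" where
  "chord_pos \<delta> s \<psi> = (2 * apothem * sin \<delta> * cos \<psi> - s * sin (\<delta> - \<psi>) * sin (\<delta> + \<psi>)) / sin (2 * \<delta>)"

text \<open>By the law of sines the chord cuts lengths s sin (\<delta> \<plusminus> \<psi>) / sin (2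
  \<delta>) off the two side lines, counted from their intersection. On each line the near vertex
  lies at r sin (\<delta> - pi / n) / cos \<delta> from that point and the far vertex at r sin
  (\<delta> + pi / n) / cos \<delta>. The last four hypotheses say that both ends of the chord fall
  between these vertices.\<close>

lemma has_chord_attained:
  assumes "facet_angle n (c + \<delta>)" "facet_angle n (c - \<delta>)" "0 < \<delta>" "\<delta> < pi / 2"
    and "2 * r * sin \<delta> * sin (\<delta> - pi / real n) \<le> s * sin (\<delta> - \<psi>)"
    and "s * sin (\<delta> - \<psi>) \<le> 2 * r * sin \<delta> * sin (\<delta> + pi / real n)"
    and "2 * r * sin \<delta> * sin (\<delta> - pi / real n) \<le> s * sin (\<delta> + \<psi>)"
    and "s * sin (\<delta> + \<psi>) \<le> 2 * r * sin \<delta> * sin (\<delta> + pi / real n)"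
  shows "has_chord P s (chord_pos \<delta> s \<psi>) (c + \<psi>)"
proof -
  have S: "sin \<delta> > 0" using assms(3,4) by (intro sin_gt_zero) auto
  have C: "cos \<delta> > 0" using assms(3,4) by (intro cos_gt_zero) auto
  define S C where "S = sin \<delta>" and "C = cos \<delta>"
  have SC: "S > 0" "C > 0" "S * S + C * C = 1" using S C sin_cos_squared_add3[of \<delta>] by (simp_all add: S_def C_def add.commute)
  have sin2: "sin (2 * \<delta>) = 2 * S * C" by (simp add: sin_double S_def C_def)
  have clear: "u + (v - w) / (2 * S * C) * y = (u * (2 * S * C) + v * y - w * y) / (2 * S * C)" for u v w y
    using SC by (simp add: field_simps)
  \<comment> \<open>Up to orientation, the offset of an endpoint from the midpoint of its side:
    \<open>apothem\<close> times tan \<delta>, which reaches the intersection of the side lines,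
    minus the length cut off.\<close>
  define \<tau> where "\<tau> = (\<lambda>x. (2 * apothem * S * S - s * x) / (2 * S * C))"
  have \<tau>: "\<bar>\<tau> x\<bar> \<le> r * sin (pi / real n)"
    if "2 * r * S * sin (\<delta> - pi / real n) \<le> s * x" "s * x \<le> 2 * r * S * sin (\<delta> + pi / real n)" for x
  proof -
    have "2 * apothem * S * S - s * x \<le> r * sin (pi / real n) * (2 * S * C)"
      "- (r * sin (pi / real n) * (2 * S * C)) \<le> 2 * apothem * S * S - s * x"
      using that by (simp_all add: sin_add sin_diff S_def C_def algebra_simps)
    then show ?thesis
      using SC unfolding \<tau>_def abs_le_iff by (simp add: pos_divide_le_eq pos_le_divide_eq minus_divide_left[symmetric] minus_le_iff)
  qed
  have m1: "line_pt apothem (c - \<delta>) (\<tau> (sin (\<delta> - \<psi>))) \<in> P"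
    by (rule side_in_polygon[OF assms(2) \<tau>]) (use assms(5,6) in \<open>simp_all add: S_def\<close>)
  have m2: "line_pt apothem (c + \<delta>) (- \<tau> (sin (\<delta> + \<psi>))) \<in> P"
    by (rule side_in_polygon[OF assms(1)]) (use \<tau>[of "sin (\<delta> + \<psi>)"] assms(7,8) in \<open>simp_all add: S_def\<close>)
  define q where "q = - apothem * sin (\<delta> + \<psi>) + \<tau> (sin (\<delta> - \<psi>)) * cos (\<delta> + \<psi>)"
  have angles: "c - \<delta> - (c + \<psi>) = - (\<delta> + \<psi>)" "c + \<delta> - (c + \<psi>) = \<delta> - \<psi>" by simp_all
  have 1: "line_pt apothem (c - \<delta>) (\<tau> (sin (\<delta> - \<psi>))) = line_pt (chord_pos \<delta> s \<psi>) (c + \<psi>) q"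
  proof -
    have "apothem * cos (\<delta> + \<psi>) + \<tau> (sin (\<delta> - \<psi>)) * sin (\<delta> + \<psi>) = chord_pos \<delta> s \<psi>"
    proof -
      have "apothem * cos (\<delta> + \<psi>) * (2 * S * C) + (2 * apothem * S * S) * sin (\<delta> + \<psi>) =
         2 * apothem * S * cos \<psi>"
        using SC(3) unfolding cos_add sin_add S_def[symmetric] C_def[symmetric] by algebra
      then show ?thesis
        unfolding \<tau>_def chord_pos_def sin2 S_def[symmetric] clear by simp
    qed
    then show ?thesis
      by (subst line_pt_change_angle[of _ _ _ "c + \<psi>"]) (simp only: angles cos_minus sin_minus q_def, simp)
  qed
  have 2: "line_pt apothem (c + \<delta>) (- \<tau> (sin (\<delta> + \<psi>))) = line_pt (chord_pos \<delta> s \<psi>) (c + \<psi>) (q + s)"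
  proof -
    have "apothem * cos (\<delta> - \<psi>) + \<tau> (sin (\<delta> + \<psi>)) * sin (\<delta> - \<psi>) = chord_pos \<delta> s \<psi>"
    proof -
      have "apothem * cos (\<delta> - \<psi>) * (2 * S * C) + (2 * apothem * S * S) * sin (\<delta> - \<psi>) =
         2 * apothem * S * cos \<psi>"
        using SC(3) unfolding cos_diff sin_diff S_def[symmetric] C_def[symmetric] by algebra
      then show ?thesis
        unfolding \<tau>_def chord_pos_def sin2 S_def[symmetric] clear by (simp add: mult_ac)
    qed
    moreover have "apothem * sin (\<delta> - \<psi>) - \<tau> (sin (\<delta> + \<psi>)) * cos (\<delta> - \<psi>) = q + s"
    proof -
      have a: "apothem * (sin (\<delta> - \<psi>) + sin (\<delta> + \<psi>)) * (2 * S * C) =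
        (2 * apothem * S * S) * (cos (\<delta> + \<psi>) + cos (\<delta> - \<psi>))"
        unfolding cos_add sin_add cos_diff sin_diff S_def[symmetric] C_def[symmetric] by algebra
      have b: "sin (\<delta> - \<psi>) * cos (\<delta> + \<psi>) + sin (\<delta> + \<psi>) * cos (\<delta> - \<psi>) = 2 * S * C"
        using sin_add[of "\<delta> + \<psi>" "\<delta> - \<psi>"] sin_double[of \<delta>] by (simp add: S_def C_def algebra_simps)
      have "(q + s) * (2 * S * C) = - apothem * sin (\<delta> + \<psi>) * (2 * S * C) +
          (2 * apothem * S * S - s * sin (\<delta> - \<psi>)) * cos (\<delta> + \<psi>) + s * (2 * S * C)"
        using SC by (simp add: q_def \<tau>_def field_simps)
      also have "\<dots> = apothem * sin (\<delta> - \<psi>) * (2 * S * C) - (2 * apothem * S * S - s * sin (\<delta> + \<psi>)) * cos (\<delta> - \<psi>)"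
        unfolding b[symmetric] using a unfolding b[symmetric] by (simp add: algebra_simps)
      also have "\<dots> = (apothem * sin (\<delta> - \<psi>) - \<tau> (sin (\<delta> + \<psi>)) * cos (\<delta> - \<psi>)) * (2 * S * C)"
        using SC by (simp add: \<tau>_def field_simps)
      finally show ?thesis using SC by simp
    qed
    ultimately show ?thesis
      by (subst line_pt_change_angle[of _ _ _ "c + \<psi>"]) (simp only: angles, simp)
  qed
  show ?thesis
    using m1 m2 unfolding 1 2 has_chord_def by blast
qed

end

subsection \<open>Extremal chords and periodicity\<close>

lemma has_integral_period_shift:
  fixes f :: "real \<Rightarrow> real"
  assumes "\<And>x. f (x + T) = f x" "(f has_integral J) {a..b}"
  shows "(f has_integral J) {a + of_int k * T..b + of_int k * T}"
proof -
  have nat: "f (x + real m * T) = f x" for x m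
  proof (induction m)
    case (Suc m)
    then show ?case using assms(1)[of "x + real m * T"] by (simp add: algebra_simps)
  qed simp
  have "f (x + of_int k * T) = f x" for x
  proof (cases "k \<ge> 0")
    case True
    then show ?thesis using nat[of x "nat k"] by simp
  next
    case False
    then show ?thesis using nat[of "x + of_int k * T" "nat (- k)"] by simp
  qed
  then have "f \<circ> (+) (of_int k * T) = f" by (auto simp: add.commute)
  then show ?thesis
    using has_integral_shift_Icc_real[of f "of_int k * T" J a b] assms(2) by simp
qed

lemma has_integral_periodic:
  fixes f :: "real \<Rightarrow> real"
  assumes "T > 0" "\<And>x. f (x + T) = f x" "(f has_integral J) {a..a + T}"
  shows "(f has_integral (real m * J)) {b..b + real m * T}"
proof -
  note shift = has_integral_period_shift[of f T, OF assms(2)]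
  have *: "(f has_integral J) {b..b + T}" for b
  proof -
    \<comment> \<open>The translate of the base period that contains \<open>b\<close> starts at
      \<open>c\<close>; its part before \<open>b\<close> is then moved by one period to the
      end.\<close>
    define k where "k = \<lfloor>(b - a) / T\<rfloor>"
    define c where "c = a + of_int k * T"
    have "of_int k \<le> (b - a) / T" "(b - a) / T < of_int k + 1" unfolding k_def by linarith+
    then have cb: "c \<le> b" "b < c + T"
      using assms(1) by (simp_all add: c_def field_simps)
    have J: "(f has_integral J) {c..c + T}"
      using shift[OF assms(3), of k] by (simp add: c_def algebra_simps)
    have int: "f integrable_on {c..b}" "f integrable_on {b..c + T}"
      using integrable_on_subinterval[of f "{c..c + T}"] J cb by (auto simp: has_integral_integrable_integral)
    then obtain i j where ij: "(f has_integral i) {c..b}" "(f has_integral j) {b..c + T}" by blast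
    have "(f has_integral (i + j)) {c..c + T}"
      by (rule has_integral_combine[OF _ _ ij]) (use cb in auto)
    with J have "J = i + j" by (rule has_integral_unique)
    moreover have "(f has_integral i) {c + T..b + T}"
      using shift[OF ij(1), of 1] by simp
    then have "(f has_integral (j + i)) {b..b + T}"
      by (rule has_integral_combine[OF _ _ ij(2), rotated 2]) (use cb in auto)
    ultimately show ?thesis by (simp add: add.commute)
  qed
  show ?thesis
  proof (induction m)
    case (Suc m)
    have "(f has_integral (real m * J + J)) {b..b + real m * T + T}"
      by (rule has_integral_combine[OF _ _ Suc *]) (use assms(1) in auto)
    then show ?case by (simp add: algebra_simps)
  qed (simp add: has_integral_refl)
qed

text \<open>The conditions on the two endpoints are affine in \<open>(p, q)\<close>, so the
  admissible pairs form a compact convex set; its projection to \<open>p\<close> is empty or a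
  compact interval.\<close>

lemma has_chord_cases:
  assumes "compact S" "convex S"
  obtains "{p. has_chord S s p \<phi>} = {}"
  | a b where "a \<le> b" "{p. has_chord S s p \<phi>} = {a..b}"
proof -
  let ?f = "\<lambda>z. line_pt (fst z) \<phi> (snd z)" and ?g = "\<lambda>z. line_pt (fst z) \<phi> (snd z + s)"
  let ?K = "?f -` S \<inter> ?g -` S"
  obtain B where B: "\<And>z. z \<in> S \<Longrightarrow> norm z \<le> B"
    using compact_imp_bounded[OF assms(1)] bounded_iff by blast
  have "norm z \<le> B" if "z \<in> ?K" for z
  proof -
    have "(norm z)\<^sup>2 = (norm (?f z))\<^sup>2"
      unfolding norm_line_pt by (simp add: norm_prod_def)
    then have "norm z = norm (?f z)" by (simp add: power2_eq_iff_nonneg)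
    then show ?thesis using B that by simp
  qed
  then have "bounded ?K" unfolding bounded_iff by blast
  moreover have "closed ?K"
    by (intro closed_Int closed_vimage compact_imp_closed assms continuous_intros)
  ultimately have "compact ?K" by (simp add: compact_eq_bounded_closed)
  then have "compact (fst ` ?K)"
    by (intro compact_continuous_image continuous_intros)
  moreover have "convex (fst ` ?K)"
  proof (rule convex_linear_image[OF linear_fst])
    show "convex ?K"
    proof (rule convexI)
      fix x y u v assume *: "x \<in> ?K" "y \<in> ?K" "0 \<le> u" "0 \<le> v" "u + v = (1::real)"
      have "?f (u *\<^sub>R x + v *\<^sub>R y) = u *\<^sub>R ?f x + v *\<^sub>R ?f y"
        by (simp add: line_pt_scaleR line_pt_add)
      moreover have "?g (u *\<^sub>R x + v *\<^sub>R y) = u *\<^sub>R ?g x + v *\<^sub>R ?g y"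
      proof -
        have "u * snd x + v * snd y + s = u * (snd x + s) + v * (snd y + s)"
          using *(5) by algebra
        then show ?thesis by (simp add: line_pt_scaleR line_pt_add)
      qed
      ultimately show "u *\<^sub>R x + v *\<^sub>R y \<in> ?K"
        using * convexD[OF assms(2)] by simp
    qed
  qed
  moreover have "fst ` ?K = {p. has_chord S s p \<phi>}"
  proof (intro set_eqI iffI)
    fix p assume "p \<in> {p. has_chord S s p \<phi>}"
    then obtain q where "(p, q) \<in> ?K" by (auto simp: has_chord_def)
    then show "p \<in> fst ` ?K" by (rule image_eqI[rotated]) simp
  next
    fix p assume "p \<in> fst ` ?K"
    then obtain z where z: "z \<in> ?K" "p = fst z" by blast
    then have "line_pt p \<phi> (snd z) \<in> S" "line_pt p \<phi> (snd z + s) \<in> S" by simp_all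
    then show "p \<in> {p. has_chord S s p \<phi>}" by (auto simp only: has_chord_def)
  qed
  ultimately have "compact {p. has_chord S s p \<phi>}" "connected {p. has_chord S s p \<phi>}"
    by (simp_all add: convex_connected)
  then obtain a b where "{p. has_chord S s p \<phi>} = {a..b}"
    using connected_compact_interval_1[of "{p. has_chord S s p \<phi>}"] by (auto simp: box_real)
  then show thesis using that by (cases "a \<le> b") auto
qed

text \<open>The default 0 makes the values at \<phi> and \<phi> + pi add up to the measure of the
  admissible \<open>p\<close> also when there are none.\<close>

definition chord_top :: "point set \<Rightarrow> real \<Rightarrow> real \<Rightarrow> real" where
  "chord_top S s \<phi> = (if \<exists>p. has_chord S s p \<phi> then Sup {p. has_chord S s p \<phi>} else 0)"

lemma chord_top_eq:
  assumes "has_chord S s p \<phi>" "\<And>p'. has_chord S s p' \<phi> \<Longrightarrow> p' \<le> p"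
  shows "chord_top S s \<phi> = p"
proof -
  have "Sup {p. has_chord S s p \<phi>} = p" by (rule cSup_eq_maximum) (use assms in auto)
  then show ?thesis using assms(1) by (auto simp: chord_top_def)
qed

text \<open>Reversing the normal turns \<open>p\<close> into \<open>- p\<close>, so
  \<open>- chord_top S s (\<phi> + pi)\<close> is the lower end of the interval whose upper end is
  \<open>chord_top S s \<phi>\<close>.\<close>

lemma emeasure_has_chord:
  assumes "compact S" "convex S"
  shows "0 \<le> chord_top S s \<phi> + chord_top S s (\<phi> + pi)"
    and "emeasure lborel {p. has_chord S s p \<phi>} = ennreal (chord_top S s \<phi> + chord_top S s (\<phi> + pi))"
proof -
  have "0 \<le> chord_top S s \<phi> + chord_top S s (\<phi> + pi) \<and>
    emeasure lborel {p. has_chord S s p \<phi>} = ennreal (chord_top S s \<phi> + chord_top S s (\<phi> + pi))"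
  proof (cases rule: has_chord_cases[OF assms, where s = s and \<phi> = \<phi>])
    case 1
    then have "\<not> has_chord S s p \<phi>" for p by blast
    then show ?thesis by (simp add: chord_top_def has_chord_plus_pi)
  next
    case (2 a b)
    have mem: "has_chord S s p \<phi> \<longleftrightarrow> a \<le> p \<and> p \<le> b" for p
      using arg_cong[OF 2(2), of "\<lambda>A. p \<in> A"] by (simp only: mem_Collect_eq atLeastAtMost_iff)
    have "chord_top S s \<phi> = b" "chord_top S s (\<phi> + pi) = - a"
      using 2(1) by (auto intro!: chord_top_eq simp: mem has_chord_plus_pi)
    then show ?thesis unfolding 2(2) using 2(1) by simp
  qed
  then show "0 \<le> chord_top S s \<phi> + chord_top S s (\<phi> + pi)"
    and "emeasure lborel {p. has_chord S s p \<phi>} = ennreal (chord_top S s \<phi> + chord_top S s (\<phi> + pi))" by auto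
qed

lemma nn_integral_half_period:
  fixes f :: "real \<Rightarrow> real"
  assumes nonneg: "\<And>\<phi>. 0 \<le> f \<phi> + f (\<phi> + pi)" and J: "(f has_integral J) {- pi / 2..- pi / 2 + 2 * pi}"
  shows "(\<integral>\<^sup>+\<phi>. indicator {-pi/2<..<pi/2} \<phi> * ennreal (f \<phi> + f (\<phi> + pi)) \<partial>lborel) = ennreal J"
    and "0 \<le> J"
proof -
  have "f integrable_on {- pi / 2..pi / 2}" "f integrable_on {pi / 2..- pi / 2 + 2 * pi}"
    using integrable_on_subinterval[of f "{- pi / 2..- pi / 2 + 2 * pi}"] J
    by (auto simp: has_integral_integrable_integral)
  then obtain i j where ij: "(f has_integral i) {- pi / 2..pi / 2}" "(f has_integral j) {pi / 2..- pi / 2 + 2 * pi}"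
    by blast
  have "(f has_integral (i + j)) {- pi / 2..- pi / 2 + 2 * pi}"
    by (rule has_integral_combine[OF _ _ ij]) auto
  then have J_eq: "J = i + j" using J has_integral_unique by blast
  have "((f \<circ> (+) pi) has_integral j) {- pi / 2..pi / 2}"
    using ij(2) unfolding has_integral_shift_Icc_real by (simp add: field_simps)
  then have j: "((\<lambda>\<phi>. f (\<phi> + pi)) has_integral j) {- pi / 2..pi / 2}"
    by (simp add: o_def add.commute)
  have sum: "((\<lambda>\<phi>. f \<phi> + f (\<phi> + pi)) has_integral J) {- pi / 2..pi / 2}"
    unfolding J_eq by (rule has_integral_add[OF ij(1) j])
  have "(\<integral>\<^sup>+\<phi>. indicator {-pi/2<..<pi/2} \<phi> * ennreal (f \<phi> + f (\<phi> + pi)) \<partial>lborel) =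
      (\<integral>\<^sup>+\<phi>. ennreal (f \<phi> + f (\<phi> + pi)) * indicator {-pi/2..pi/2} \<phi> \<partial>lborel)"
  proof (rule nn_integral_cong_AE)
    show "AE \<phi> in lborel. indicator {-pi/2<..<pi/2} \<phi> * ennreal (f \<phi> + f (\<phi> + pi)) =
      ennreal (f \<phi> + f (\<phi> + pi)) * indicator {-pi/2..pi/2} \<phi>"
      using AE_lborel_singleton[of "- pi / 2"] AE_lborel_singleton[of "pi / 2"]
      by eventually_elim (auto split: split_indicator)
  qed
  also have "\<dots> = ennreal J"
    by (rule nn_integral_has_integral_lebesgue'[OF nonneg sum])
  finally show "(\<integral>\<^sup>+\<phi>. indicator {-pi/2<..<pi/2} \<phi> * ennreal (f \<phi> + f (\<phi> + pi)) \<partial>lborel) = ennreal J" .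
  show "0 \<le> J"
    by (rule has_integral_nonneg[OF sum nonneg])
qed

lemma line_measure_has_integral:
  assumes "compact S" "convex S" "(chord_top S s has_integral J) {- pi / 2..- pi / 2 + 2 * pi}"
  shows "line_measure S s = ennreal J" "0 \<le> J"
  unfolding line_measure_eq_emeasure[OF assms(1)] emeasure_has_chord(2)[OF assms(1,2)]
  by (rule nn_integral_half_period[OF emeasure_has_chord(1)[OF assms(1,2)] assms(3)])+

section \<open>Symmetry of the polygon and the integrated extremal distance\<close>

context regular_polygon
begin

lemma chord_top_period: "chord_top P s (\<phi> + 2 * pi / real n) = chord_top P s \<phi>"
  using has_chord_rotate[of s _ \<phi> 1] by (simp add: chord_top_def)

lemma chord_top_even: "chord_top P s (- \<phi>) = chord_top P s \<phi>"
  by (simp add: chord_top_def has_chord_reflect)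

text \<open>An even function of period 2 pi / n is symmetric about every multiple of pi / n. So the
  window and its mirror image at the left end fill one period, and the full turn consists of 2 n
  copies of the window.\<close>

lemma line_measure_polygon:
  assumes "(chord_top P s has_integral J) {real k * pi / real n..real k * pi / real n + pi / real n}"
  shows "line_measure P s = ennreal (2 * real n * J)" "0 \<le> J"
proof -
  let ?t = "chord_top P s" and ?c = "real k * pi / real n" and ?T = "2 * pi / real n"
  note per = has_integral_period_shift[of ?t ?T, OF chord_top_period]
  have "((\<lambda>x. ?t (- x)) has_integral J) {- (?c + pi / real n)..- ?c}"
    using assms by (subst has_integral_reflect_real)
  then have "(?t has_integral J) {- (?c + pi / real n) + of_int (int k) * ?T..- ?c + of_int (int k) * ?T}"
    unfolding chord_top_even by (rule per)
  moreover have "- (?c + pi / real n) + of_int (int k) * ?T = ?c - pi / real n" "- ?c + of_int (int k) * ?T = ?c"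
    by (simp_all add: field_simps)
  ultimately have "(?t has_integral J) {?c - pi / real n..?c}" by (simp only:)
  then have "(?t has_integral (J + J)) {?c - pi / real n..?c + pi / real n}"
    by (rule has_integral_combine[OF _ _ _ assms, rotated 2]) auto
  then have "(?t has_integral (2 * J)) {?c - pi / real n..?c - pi / real n + ?T}"
    by (simp add: algebra_simps)
  from has_integral_periodic[OF _ chord_top_period this, of n "- pi / 2"]
  have *: "(?t has_integral (real n * (2 * J))) {- pi / 2..- pi / 2 + 2 * pi}"
    by simp
  show "line_measure P s = ennreal (2 * real n * J)"
    using line_measure_has_integral(1)[OF compact_polygon convex_polygon *] by (simp add: mult_ac)
  show "0 \<le> J"
    using line_measure_has_integral(2)[OF compact_polygon convex_polygon *] by (simp add: zero_le_mult_iff)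
qed

text \<open>The antiderivative of \<open>chord_pos\<close> in \<psi>, by 2 sin (\<delta> - \<psi>)
  sin (\<delta> + \<psi>) = cos (2 \<psi>) - cos (2 \<delta>), normalised to be odd. For \<delta> =
  0 the division by zero makes it 0, which matches the value 0 of \<open>hstar\<close> for k =
  0.\<close>

definition chord_pos_int :: "real \<Rightarrow> real \<Rightarrow> real \<Rightarrow> real" where
  "chord_pos_int \<delta> s \<psi> = (2 * apothem * sin \<delta> * sin \<psi> - s / 2 * (sin (2 * \<psi>) / 2 - \<psi> * cos (2 * \<delta>))) / sin (2 * \<delta>)"

lemma chord_pos_int_0 [simp]: "chord_pos_int \<delta> s 0 = 0"
  by (simp add: chord_pos_int_def)

lemma chord_pos_int_minus: "chord_pos_int \<delta> s (- \<psi>) = - chord_pos_int \<delta> s \<psi>"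
proof -
  have "2 * apothem * sin \<delta> * sin (- \<psi>) - s / 2 * (sin (2 * - \<psi>) / 2 - - \<psi> * cos (2 * \<delta>)) =
     - (2 * apothem * sin \<delta> * sin \<psi> - s / 2 * (sin (2 * \<psi>) / 2 - \<psi> * cos (2 * \<delta>)))"
    by (simp add: right_diff_distrib)
  then show ?thesis unfolding chord_pos_int_def by (simp only: minus_divide_left)
qed

lemma DERIV_chord_pos_int:
  assumes "sin (2 * \<delta>) \<noteq> 0"
  shows "(chord_pos_int \<delta> s has_real_derivative chord_pos \<delta> s \<psi>) (at \<psi>)"
proof -
  have sum: "(\<delta> + \<psi>) - (\<delta> - \<psi>) = 2 * \<psi>" "(\<delta> + \<psi>) + (\<delta> - \<psi>) = 2 * \<delta>" by simp_all
  have "cos (2 * \<psi>) - cos (2 * \<delta>) = 2 * (sin (\<delta> - \<psi>) * sin (\<delta> + \<psi>))"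
    unfolding sum[symmetric] cos_diff[of "\<delta> + \<psi>" "\<delta> - \<psi>"] cos_add[of "\<delta> + \<psi>" "\<delta> - \<psi>"] by simp
  then have "s / 2 * (cos (2 * \<psi>) - cos (2 * \<delta>)) = s * sin (\<delta> - \<psi>) * sin (\<delta> + \<psi>)" by simp
  then show ?thesis
    unfolding chord_pos_int_def[abs_def] chord_pos_def using assms
    by (auto intro!: derivative_eq_intros)
qed

lemma chord_top_has_integral_piece:
  assumes "sin (2 * \<delta>) \<noteq> 0" "a \<le> b"
    and "\<And>\<phi>. a < \<phi> \<Longrightarrow> \<phi> < b \<Longrightarrow> chord_top P s (c + \<phi>) = chord_pos \<delta> s (\<phi> - e)"
  shows "(chord_top P s has_integral (chord_pos_int \<delta> s (b - e) - chord_pos_int \<delta> s (a - e))) {c + a..c + b}"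
proof -
  have shift: "((\<lambda>\<phi>. \<phi> - e) has_real_derivative 1) (at \<phi>)" for \<phi>
    by (auto intro!: derivative_eq_intros)
  have deriv: "((\<lambda>\<phi>. chord_pos_int \<delta> s (\<phi> - e)) has_real_derivative chord_pos \<delta> s (\<phi> - e)) (at \<phi>)" for \<phi>
    using DERIV_chain2[OF DERIV_chord_pos_int[OF assms(1)] shift] by simp
  have "((\<lambda>\<phi>. chord_pos \<delta> s (\<phi> - e)) has_integral (chord_pos_int \<delta> s (b - e) - chord_pos_int \<delta> s (a - e))) {a..b}"
    by (intro fundamental_theorem_of_calculus assms(2))
      (auto simp: has_real_derivative_iff_has_vector_derivative[symmetric] intro: has_field_derivative_at_within deriv)
  then have "((\<lambda>\<phi>. chord_top P s (c + \<phi>)) has_integral (chord_pos_int \<delta> s (b - e) - chord_pos_int \<delta> s (a - e))) {a..b}"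
    by (rule has_integral_spike_interior[of _ _ a b, unfolded box_real]) (use assms(3) in auto)
  then show ?thesis
    using has_integral_shift_Icc_real[of "chord_top P s" c _ a b] by (simp add: o_def add.commute)
qed

end

subsection \<open>Explicit measure of lines with long chords\<close>

text \<open>The case \<open>s = 0\<close> is included, with \<open>a / 0 = 0\<close>: it belongs to
  the lowest range and is where the perimeter is computed.\<close>

lemma arcsin_divide_le:
  fixes a s x :: real
  assumes "0 \<le> a" "a \<le> s" "0 \<le> x" "x \<le> pi / 2"
  shows "arcsin (a / s) \<le> x \<longleftrightarrow> a \<le> s * sin x"
proof (cases "s = 0")
  case False
  then have s: "s > 0" using assms by simp
  have "a / s \<le> 1" "-1 \<le> a / s" using assms(1,2) s by (simp_all add: field_simps)
  moreover have "- (pi / 2) \<le> x" using assms(3) pi_gt_zero by linarith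
  ultimately have "arcsin (a / s) \<le> x \<longleftrightarrow> a / s \<le> sin x"
    using arcsin_le_iff[of "a / s" x] assms(4) by simp
  then show ?thesis using s by (simp add: field_simps)
qed (use assms in simp)

lemma le_arcsin_divide:
  fixes a s x :: real
  assumes "0 \<le> a" "a \<le> s" "0 < s" "0 \<le> x" "x \<le> pi / 2"
  shows "x \<le> arcsin (a / s) \<longleftrightarrow> s * sin x \<le> a"
proof -
  have "a / s \<le> 1" "-1 \<le> a / s" using assms by (simp_all add: field_simps)
  moreover have "- (pi / 2) \<le> x" using assms pi_gt_zero by linarith
  ultimately have "x \<le> arcsin (a / s) \<longleftrightarrow> sin x \<le> a / s"
    using le_arcsin_iff[of "a / s" x] assms(5) by simp
  then show ?thesis using assms(3) by (simp add: field_simps)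
qed

lemma has_integral_combine3:
  fixes f :: "real \<Rightarrow> real"
  assumes "a \<le> b" "b \<le> c" "c \<le> d" "(f has_integral i) {a..b}" "(f has_integral j) {b..c}" "(f has_integral k) {c..d}"
  shows "(f has_integral (i + j + k)) {a..d}"
  by (rule has_integral_combine[OF _ assms(3) has_integral_combine[OF assms(1,2,4,5)] assms(6)]) (use assms in auto)

context regular_polygon
begin

definition ang :: "nat \<Rightarrow> real" where "ang d = real d * pi / real n"

lemma ang_0 [simp]: "ang 0 = 0" by (simp add: ang_def)

lemma ang_Suc: "ang (Suc d) = ang d + pi / real n"
  by (simp add: ang_def field_simps)

lemma ang_nonneg [simp]: "0 \<le> ang d" by (simp add: ang_def)

lemma ang_pos: "0 < d \<Longrightarrow> 0 < ang d" by (simp add: ang_def)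

lemma ang_le_half: "2 * d \<le> n \<Longrightarrow> ang d \<le> pi / 2"
proof -
  assume "2 * d \<le> n"
  then have "2 * real d \<le> real n" by linarith
  then have "real d / real n \<le> 1 / 2" by (simp add: field_simps)
  from mult_left_mono[OF this, of pi] show ?thesis by (simp add: ang_def mult.commute)
qed

lemma ang_less_half: "2 * d < n \<Longrightarrow> ang d < pi / 2"
proof -
  assume "2 * d < n"
  then have "2 * real d < real n" by linarith
  then have "real d / real n < 1 / 2" by (simp add: field_simps)
  from mult_strict_left_mono[OF this, of pi] show ?thesis by (simp add: ang_def mult.commute)
qed

lemma sin_ang_nonneg: "2 * d \<le> n \<Longrightarrow> 0 \<le> sin (ang d)"
  using ang_le_half[of d] ang_nonneg[of d] pi_gt_zero by (intro sin_ge_zero) linarith+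

lemma sin_ang_pos: "0 < d \<Longrightarrow> 2 * d \<le> n \<Longrightarrow> 0 < sin (ang d)"
  using ang_le_half[of d] ang_pos[of d] pi_gt_zero by (intro sin_gt_zero) linarith+

lemma A1_eq: "A1 n r d = 2 * r * sin (ang d) * sin (ang (Suc d))"
  by (simp add: A1_def ang_def)

lemma ell_eq: "ell n r d = 2 * r * sin (ang d)"
  by (simp add: ell_def ang_def)

lemma facet_angleI: "\<theta> = of_int (2 * m + 1) * pi / real n \<Longrightarrow> facet_angle n \<theta>"
  by (auto simp: facet_angle_def)

lemma facet_sum: "facet_angle n (ang k + ang (Suc k))"
  by (rule facet_angleI[of _ "int k"]) (simp add: ang_def field_simps)

lemma facet_diff: "facet_angle n (ang k - ang (Suc k))"
  by (rule facet_angleI[of _ "-1"]) (simp add: ang_Suc)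

lemma facet_diff': "facet_angle n (ang (Suc k) - ang k)"
  by (rule facet_angleI[of _ 0]) (simp add: ang_Suc)

lemma chord_top_upper:
  assumes "facet_angle n (c + \<delta>)" "facet_angle n (c - \<delta>)" "0 < \<delta>" "\<delta> < pi / 2" "\<bar>\<psi>\<bar> \<le> \<delta>"
    and "has_chord P s (chord_pos \<delta> s \<psi>) (c + \<psi>)"
  shows "chord_top P s (c + \<psi>) = chord_pos \<delta> s \<psi>"
proof (rule chord_top_eq[OF assms(6)])
  fix p' assume p': "has_chord P s p' (c + \<psi>)"
  have "0 \<le> sin (\<delta> - \<psi>)" "0 \<le> sin (\<delta> + \<psi>)"
    using assms(3-5) by (auto intro!: sin_ge_zero)
  from has_chord_upper[OF p' assms(1,2) this]
  have "p' * sin (2 * \<delta>) \<le> 2 * apothem * sin \<delta> * cos \<psi> - s * sin (\<delta> - \<psi>) * sin (\<delta> + \<psi>)" by simp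
  moreover have "sin (2 * \<delta>) > 0" using assms(3,4) by (intro sin_gt_zero) auto
  ultimately show "p' \<le> chord_pos \<delta> s \<psi>"
    unfolding chord_pos_def by (simp add: pos_le_divide_eq)
qed

text \<open>The normals of the sides are ang k \<plusminus> ang (k + 1), that is (2 k + 1) pi / n
  and - pi / n, so the sides are k + 1 steps apart. As \<phi> \<ge> 0, the smaller of the two sines
  is the one with \<delta> - \<phi>, so of the four vertex conditions one lower and one upper bound
  imply the rest; their right-hand sides are \<open>A1 n r k\<close> and
  \<open>A1 n r (Suc k)\<close>.\<close>

lemma chord_top_wide:
  assumes k: "2 * Suc k < n" and \<phi>: "0 \<le> \<phi>" "\<phi> \<le> pi / real n" and s: "0 \<le> s"
    and lo: "A1 n r k \<le> s * sin (ang (Suc k) - \<phi>)" and hi: "s * sin (ang (Suc k) + \<phi>) \<le> A1 n r (Suc k)"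
  shows "chord_top P s (ang k + \<phi>) = chord_pos (ang (Suc k)) s \<phi>"
proof -
  let ?d = "ang (Suc k)"
  have "\<phi> \<le> ?d" using \<phi> ang_nonneg[of k] ang_Suc[of k] by linarith
  then have d: "0 < ?d" "?d < pi / 2" "\<bar>\<phi>\<bar> \<le> ?d"
    using ang_less_half[OF k] ang_pos[of "Suc k"] \<phi> by auto
  have "sin (?d + \<phi>) - sin (?d - \<phi>) = 2 * cos ?d * sin \<phi>"
    by (simp add: sin_add sin_diff)
  moreover have "0 \<le> cos ?d" using d by (intro cos_ge_zero) auto
  moreover have "0 \<le> sin \<phi>" using \<phi> pi_n_bounds pi_gt_zero by (intro sin_ge_zero) linarith+
  ultimately have "sin (?d - \<phi>) \<le> sin (?d + \<phi>)"
    by (smt (verit) mult_nonneg_nonneg)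
  then have le: "s * sin (?d - \<phi>) \<le> s * sin (?d + \<phi>)" using s by (rule mult_left_mono)
  have e: "2 * r * sin ?d * sin (?d - pi / real n) = A1 n r k" "2 * r * sin ?d * sin (?d + pi / real n) = A1 n r (Suc k)"
    unfolding A1_eq ang_Suc[of "Suc k"] by (simp_all add: ang_Suc[of k])
  have "has_chord P s (chord_pos ?d s \<phi>) (ang k + \<phi>)"
    by (rule has_chord_attained[OF facet_sum facet_diff d(1,2)]; unfold e) (use lo hi le in linarith)+
  then show ?thesis by (rule chord_top_upper[OF facet_sum facet_diff d])
qed

text \<open>The side with normal (2 k + 1) pi / n is kept and the one with normal - pi / n is
  replaced by its neighbour with normal pi / n; the centre is now ang (k + 1) and the half-angle ang
  k. Hypothesis \<open>hi\<close> reverses \<open>lo\<close> of \<open>chord_top_wide\<close>: at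
  equality the end of the chord is the common vertex of the two neighbours. The lower vertex
  conditions follow from \<open>ell n r k \<le> s\<close>.\<close>

lemma chord_top_narrow:
  assumes k: "0 < k" "2 * Suc k \<le> n" and \<phi>: "0 \<le> \<phi>" "\<phi> \<le> pi / real n" and s: "ell n r k \<le> s"
    and hi: "s * sin (ang (Suc k) - \<phi>) \<le> A1 n r k"
  shows "has_chord P s (chord_pos (ang k) s (\<phi> - pi / real n)) (ang k + \<phi>)"
    and "chord_top P s (ang k + \<phi>) = chord_pos (ang k) s (\<phi> - pi / real n)"
proof -
  let ?d = "ang k" and ?c = "ang (Suc k)" and ?\<psi> = "\<phi> - pi / real n"
  have c: "?c + ?\<psi> = ang k + \<phi>" by (simp add: ang_Suc)
  have fc: "facet_angle n (?c + ?d)" "facet_angle n (?c - ?d)"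
    using facet_sum[of k] facet_diff'[of k] by (simp_all add: add.commute)
  have "1 * pi / real n \<le> ang k" unfolding ang_def using k(1) by (intro divide_right_mono mult_right_mono) auto
  then have d: "0 < ?d" "?d < pi / 2" "\<bar>?\<psi>\<bar> \<le> ?d" "pi / real n \<le> ?d"
    using ang_less_half[of k] ang_pos[of k] k \<phi> by auto
  have sd: "0 < sin ?d" using d by (intro sin_gt_zero) auto
  have s0: "0 \<le> s" using s sd r_pos unfolding ell_eq by (meson less_imp_le mult_pos_pos order_trans zero_less_numeral)
  have "sin (?d - ?\<psi>) - sin (?d + ?\<psi>) = 2 * cos ?d * sin (- ?\<psi>)"
    unfolding sin_add sin_diff[of ?d ?\<psi>] sin_minus by simp
  moreover have "0 \<le> cos ?d" using d by (intro cos_ge_zero) auto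
  moreover have "0 \<le> sin (- ?\<psi>)" using \<phi> pi_n_bounds pi_gt_zero by (intro sin_ge_zero) linarith+
  ultimately have "sin (?d + ?\<psi>) \<le> sin (?d - ?\<psi>)"
    by (smt (verit) mult_nonneg_nonneg)
  then have le: "s * sin (?d + ?\<psi>) \<le> s * sin (?d - ?\<psi>)" using s0 by (rule mult_left_mono)
  have "sin (?d - pi / real n) \<le> sin (?d + ?\<psi>)"
    using d \<phi> pi_n_bounds by (intro sin_monotone_2pi_le) linarith+
  moreover have "0 \<le> sin (?d - pi / real n)" using d pi_n_bounds(1) by (intro sin_ge_zero) linarith+
  ultimately have lo: "2 * r * sin ?d * sin (?d - pi / real n) \<le> s * sin (?d + ?\<psi>)"
    using s s0 unfolding ell_eq by (intro mult_mono) auto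
  have e: "2 * r * sin ?d * sin (?d + pi / real n) = A1 n r k"
    unfolding A1_eq by (simp add: ang_Suc)
  have "?d - ?\<psi> = ang (Suc k) - \<phi>" by (simp add: ang_Suc)
  then have hi': "s * sin (?d - ?\<psi>) \<le> A1 n r k" using hi by (simp only:)
  have h: "has_chord P s (chord_pos ?d s ?\<psi>) (?c + ?\<psi>)"
    by (rule has_chord_attained[OF fc d(1,2)]; (unfold e)?) (use lo le hi' in linarith)+
  then show "has_chord P s (chord_pos ?d s ?\<psi>) (ang k + \<phi>)" unfolding c .
  show "chord_top P s (ang k + \<phi>) = chord_pos ?d s ?\<psi>"
    using chord_top_upper[OF fc d(1,2,3) h] unfolding c .
qed

text \<open>The half-angle pi / 2 makes the two sides of the wider pair parallel. Their distance is
  twice the apothem, which equals \<open>A1 n r k\<close>, and the projected chord is longer than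
  that.\<close>

lemma no_chord_even:
  assumes k: "2 * Suc k = n" and "A1 n r k < s * sin (ang (Suc k) - \<phi>)" "0 \<le> s"
  shows "\<not> has_chord P s p (ang k + \<phi>)"
proof
  assume h: "has_chord P s p (ang k + \<phi>)"
  have half: "ang (Suc k) = pi / 2" using k by (auto simp: ang_def field_simps)
  have "facet_angle n (ang k + ang (Suc k) + pi)"
  proof (rule facet_angleI[of _ "int k + int (Suc k)"])
    have nk: "real n = 2 * real k + 2" unfolding k[symmetric] by simp
    have "ang k + ang (Suc k) + (2 * real k + 2) * pi / real n = of_int (2 * (int k + int (Suc k)) + 1) * pi / real n"
      by (simp add: ang_def field_simps)
    moreover have "(2 * real k + 2) * pi / real n = pi" unfolding nk[symmetric] by simp
    ultimately show "ang k + ang (Suc k) + pi = of_int (2 * (int k + int (Suc k)) + 1) * pi / real n"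
      by (simp only:)
  qed
  from has_chord_strip(2)[OF h facet_sum this]
  have "s * \<bar>sin (ang (Suc k) - \<phi>)\<bar> \<le> 2 * apothem" by simp
  moreover have "2 * apothem = A1 n r k"
  proof -
    have "ang k = pi / 2 - pi / real n" using half by (simp add: ang_Suc)
    then show ?thesis unfolding A1_eq half by (simp add: sin_diff)
  qed
  moreover have "s * sin (ang (Suc k) - \<phi>) \<le> s * \<bar>sin (ang (Suc k) - \<phi>)\<bar>"
    using assms(3) by (intro mult_left_mono) auto
  ultimately show False using assms(2) by linarith
qed

text \<open>For odd n this is the distance from a side to the opposite vertex.\<close>

lemma lam_eq: "lam n r = apothem + r"
proof -
  have "2 * (cos (pi / (2 * real n)))\<^sup>2 = cos (pi / real n) + 1"
    using cos_double_cos[of "pi / (2 * real n)"] by simp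
  then show ?thesis by (simp only: lam_def mult.assoc mult.left_commute[of 2 r]) (simp add: distrib_left)
qed

text \<open>The obstruction is the side with normal - pi / n: in that direction the polygon has
  width at most \<lambda>, less than the projected chord.\<close>

lemma no_chord_odd:
  assumes "lam n r < s * sin (ang (Suc k) + \<phi>)" "0 \<le> s"
  shows "\<not> has_chord P s p (ang k + \<phi>)"
proof
  assume h: "has_chord P s p (ang k + \<phi>)"
  have "ang k - ang (Suc k) - (ang k + \<phi>) = - (ang (Suc k) + \<phi>)" by simp
  with has_chord_strip(1)[OF h facet_diff[of k]] have "s * \<bar>sin (ang (Suc k) + \<phi>)\<bar> \<le> lam n r"
    unfolding lam_eq by (simp only: sin_minus abs_minus_cancel)
  moreover have "s * sin (ang (Suc k) + \<phi>) \<le> s * \<bar>sin (ang (Suc k) + \<phi>)\<bar>"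
    using assms(2) by (intro mult_left_mono) auto
  ultimately show False using assms(1) by linarith
qed

lemma has_chord_le_diameter:
  assumes "has_chord P s p \<phi>"
  shows "s \<le> 2 * r"
proof -
  obtain q where q: "line_pt p \<phi> q \<in> P" "line_pt p \<phi> (q + s) \<in> P"
    using assms by (auto simp: has_chord_def)
  have "line_pt p \<phi> (q + s) \<bullet> (cos (\<phi> + pi / 2), sin (\<phi> + pi / 2)) \<le> r"
    by (rule polygon_inner_le_radius[OF q(2)])
  then have "q + s \<le> r" unfolding inner_line_pt by simp
  moreover have "line_pt p \<phi> q \<bullet> (cos (\<phi> - pi / 2), sin (\<phi> - pi / 2)) \<le> r"
    by (rule polygon_inner_le_radius[OF q(1)])
  then have "- q \<le> r" unfolding inner_line_pt by simp
  ultimately show ?thesis by linarith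
qed

lemma A1_bounds:
  assumes "2 * Suc k \<le> n" "ell n r k \<le> s"
  shows "0 \<le> A1 n r k" "A1 n r k \<le> s" "0 \<le> s"
proof -
  have a: "0 \<le> sin (ang k)" "0 \<le> sin (ang (Suc k))"
    using assms(1) by (auto intro!: sin_ang_nonneg)
  have "A1 n r k = ell n r k * sin (ang (Suc k))" by (simp add: A1_eq ell_eq)
  also have "\<dots> \<le> ell n r k * 1"
    using a r_pos by (intro mult_left_mono) (auto simp: ell_eq)
  finally show "A1 n r k \<le> s" using assms(2) by simp
  show "0 \<le> A1 n r k" using a r_pos by (simp add: A1_eq)
  then show "0 \<le> s" using \<open>A1 n r k \<le> s\<close> by simp
qed

text \<open>\<open>A1 n r k\<close> is both \<open>ell n r k * sin (ang (Suc k))\<close> and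
  \<open>ell n r (Suc k) * sin (ang k)\<close>. So the two bounds on \<open>s\<close> are exactly
  what places the transition angle inside the window.\<close>

lemma arcsin_A1_bounds:
  assumes "2 * Suc k \<le> n" "ell n r k \<le> s" "s < ell n r (Suc k)"
  shows "arcsin (A1 n r k / s) \<le> ang (Suc k)" "ang k \<le> arcsin (A1 n r k / s)"
proof -
  have a: "0 \<le> sin (ang k)" "0 \<le> sin (ang (Suc k))"
    using assms(1) by (auto intro!: sin_ang_nonneg)
  note b = A1_bounds[OF assms(1,2)]
  have "A1 n r k \<le> s * sin (ang (Suc k))"
    using mult_right_mono[OF assms(2) a(2)] by (simp add: A1_eq ell_eq mult_ac)
  then show "arcsin (A1 n r k / s) \<le> ang (Suc k)"
    using arcsin_divide_le[OF b(1,2)] ang_le_half[OF assms(1)] by simp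
  show "ang k \<le> arcsin (A1 n r k / s)"
  proof (cases "s = 0")
    case True
    have "sin (ang k) \<le> 0" using assms(2) True r_pos by (simp add: ell_eq mult_le_0_iff)
    then have "\<not> 0 < k" using sin_ang_pos[of k] assms(1) by auto
    then show ?thesis using True by simp
  next
    case False
    have "s * sin (ang k) \<le> A1 n r k"
      using mult_right_mono[OF less_imp_le[OF assms(3)] a(1)] by (simp add: A1_eq ell_eq mult_ac)
    then show ?thesis
      using le_arcsin_divide[OF b(1,2)] b(3) False ang_le_half[of k] assms(1) by simp
  qed
qed

text \<open>At the upper end of the window \<psi> = 0, where \<open>chord_pos_int\<close> vanishes,
  so only the transition angle contributes. For k = 0 the transition sits at the end of the window
  and the interval is a single point.\<close>

lemma narrow_has_integral:
  assumes "2 * Suc k \<le> n" "ell n r k \<le> s" "s < ell n r (Suc k)"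
  defines "\<eta> \<equiv> arcsin (A1 n r k / s)"
  shows "(chord_top P s has_integral (- chord_pos_int (ang k) s (ang k - \<eta>))) {ang k + (ang (Suc k) - \<eta>)..ang k + pi / real n}"
proof (cases "k = 0")
  case True
  have "\<eta> = 0" using True by (simp add: \<eta>_def A1_eq)
  then show ?thesis using True has_integral_refl(2)[of "chord_top P s" "pi / real n"]
    by (simp add: chord_pos_int_def ang_Suc)
next
  case False
  note ab = arcsin_A1_bounds[OF assms(1-3), folded \<eta>_def]
  note b = A1_bounds[OF assms(1,2)]
  have "sin (2 * ang k) > 0"
  proof (rule sin_gt_zero)
    have "2 * k < n" using assms(1) by simp
    then show "0 < 2 * ang k" "2 * ang k < pi"
      using False ang_less_half[of k] ang_pos[of k] by auto
  qed
  moreover have "chord_top P s (ang k + \<phi>) = chord_pos (ang k) s (\<phi> - pi / real n)"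
    if "ang (Suc k) - \<eta> < \<phi>" "\<phi> < pi / real n" for \<phi>
  proof (rule chord_top_narrow(2))
    have "0 < ell n r k" using sin_ang_pos[of k] False r_pos assms(1) by (simp add: ell_eq)
    then have s: "s > 0" using assms(2) by linarith
    have "ang (Suc k) - \<phi> \<le> pi / 2" using ang_le_half[OF assms(1)] that ab by linarith
    moreover have "0 \<le> ang (Suc k) - \<phi>" using that ang_nonneg[of k] ang_Suc[of k] by linarith
    moreover have "ang (Suc k) - \<phi> \<le> \<eta>" using that by simp
    ultimately show "s * sin (ang (Suc k) - \<phi>) \<le> A1 n r k"
      using le_arcsin_divide[OF b(1,2) s, of "ang (Suc k) - \<phi>"] by (simp add: \<eta>_def)
  qed (use that ab False assms in auto)
  ultimately have "(chord_top P s has_integral (chord_pos_int (ang k) s (pi / real n - pi / real n) -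
      chord_pos_int (ang k) s (ang (Suc k) - \<eta> - pi / real n))) {ang k + (ang (Suc k) - \<eta>)..ang k + pi / real n}"
    by (intro chord_top_has_integral_piece) (use ab in \<open>auto simp: ang_Suc\<close>)
  then show ?thesis by (simp add: ang_Suc algebra_simps)
qed

text \<open>An arbitrary part of the window before the transition is allowed, because the odd case
  cuts a gap out of it.\<close>

lemma wide_has_integral:
  assumes k: "2 * Suc k < n" and s: "ell n r k \<le> s" "s < ell n r (Suc k)"
    and ab: "0 \<le> a" "a \<le> b" "b \<le> ang (Suc k) - arcsin (A1 n r k / s)"
    and hi: "\<And>\<phi>. a < \<phi> \<Longrightarrow> \<phi> < b \<Longrightarrow> s * sin (ang (Suc k) + \<phi>) \<le> A1 n r (Suc k)"
  shows "(chord_top P s has_integral (chord_pos_int (ang (Suc k)) s b - chord_pos_int (ang (Suc k)) s a)) {ang k + a..ang k + b}"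
proof -
  have k': "2 * Suc k \<le> n" using k by simp
  note e = arcsin_A1_bounds[OF k' s]
  note b = A1_bounds[OF k' s(1)]
  have "sin (2 * ang (Suc k)) > 0"
    using ang_less_half[OF k] ang_pos[of "Suc k"] by (intro sin_gt_zero) linarith+
  moreover have "chord_top P s (ang k + \<phi>) = chord_pos (ang (Suc k)) s (\<phi> - 0)"
    if "a < \<phi>" "\<phi> < b" for \<phi>
  proof -
    have "\<phi> \<le> pi / real n" using that ab(3) e(2) ang_Suc[of k] by linarith
    moreover have "arcsin (A1 n r k / s) \<le> ang (Suc k) - \<phi>" using that ab(3) by linarith
    moreover have "0 \<le> ang (Suc k) - \<phi>" "ang (Suc k) - \<phi> \<le> pi / 2"
      using calculation(1) ang_nonneg[of k] that ab(1) ang_less_half[OF k] ang_Suc[of k] by linarith+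
    ultimately show ?thesis
      using that ab b arcsin_divide_le[OF b(1,2), of "ang (Suc k) - \<phi>"] hi
      by (simp only: diff_0_right) (intro chord_top_wide[OF k], auto)
  qed
  ultimately have "(chord_top P s has_integral (chord_pos_int (ang (Suc k)) s (b - 0) - chord_pos_int (ang (Suc k)) s (a - 0))) {ang k + a..ang k + b}"
    by (intro chord_top_has_integral_piece) (use ab in auto)
  then show ?thesis by simp
qed

text \<open>Only the far vertex of the wider pair could interfere. If ang (k + 2) \<le> pi / 2, the
  bound \<open>s < ell n r (Suc k)\<close> keeps the chord before it. Otherwise n = 2 k + 3, where
  \<open>A1 n r (Suc k)\<close> equals \<lambda>, and the projected chord has length at most s \<le>
  \<lambda>.\<close>

lemma line_measure_regular:
  assumes k: "2 * Suc k < n" and s: "ell n r k \<le> s" "s < ell n r (Suc k)"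
    and wide: "2 * Suc (Suc k) \<le> n \<or> s \<le> lam n r"
  defines "\<eta> \<equiv> arcsin (A1 n r k / s)"
  shows "line_measure P s = ennreal (2 * real n * (chord_pos_int (ang (Suc k)) s (ang (Suc k) - \<eta>)
      - chord_pos_int (ang k) s (ang k - \<eta>)))" (is "_ = ennreal (2 * real n * ?J)")
    and "0 \<le> chord_pos_int (ang (Suc k)) s (ang (Suc k) - \<eta>) - chord_pos_int (ang k) s (ang k - \<eta>)"
proof -
  have k': "2 * Suc k \<le> n" using k by simp
  note ab = arcsin_A1_bounds[OF k' s, folded \<eta>_def] and b = A1_bounds[OF k' s(1)]
  have "(chord_top P s has_integral (chord_pos_int (ang (Suc k)) s (ang (Suc k) - \<eta>) - chord_pos_int (ang (Suc k)) s 0))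
      {ang k + 0..ang k + (ang (Suc k) - \<eta>)}"
  proof (rule wide_has_integral[OF k s])
    fix \<phi> assume \<phi>: "0 < \<phi>" "\<phi> < ang (Suc k) - \<eta>"
    then have \<phi>': "\<phi> \<le> pi / real n" using ab(2) ang_Suc[of k] by linarith
    have sn: "0 \<le> sin (ang (Suc k) + \<phi>)"
      using \<phi> \<phi>' ang_less_half[OF k] ang_nonneg[of "Suc k"] pi_n_bounds by (intro sin_ge_zero) linarith+
    show "s * sin (ang (Suc k) + \<phi>) \<le> A1 n r (Suc k)"
    proof (cases "2 * Suc (Suc k) \<le> n")
      case True
      have "sin (ang (Suc k) + \<phi>) \<le> sin (ang (Suc (Suc k)))"
        using \<phi> \<phi>' ang_le_half[OF True] ang_nonneg[of "Suc k"] pi_gt_zero ang_Suc[of "Suc k"]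
        by (intro sin_monotone_2pi_le) linarith+
      then show ?thesis
        unfolding A1_eq using s(2) b(3) sn by (intro mult_mono) (auto simp: ell_eq)
    next
      case False
      then have n: "n = 2 * k + 3" using k by simp
      have "real n = 2 * real k + 3" unfolding n by simp
      then have "ang (Suc k) = pi / 2 - pi / (2 * real n)" "ang (Suc (Suc k)) = pi / 2 + pi / (2 * real n)"
        unfolding ang_def by (simp_all add: field_simps)
      then have "A1 n r (Suc k) = lam n r"
        unfolding A1_eq lam_def by (simp add: sin_add sin_diff power2_eq_square)
      moreover have "s * sin (ang (Suc k) + \<phi>) \<le> s * 1" using b(3) by (intro mult_left_mono) auto
      ultimately show ?thesis using wide False by simp
    qed
  qed (use ab in \<open>auto simp: \<eta>_def\<close>)
  then have "(chord_top P s has_integral (chord_pos_int (ang (Suc k)) s (ang (Suc k) - \<eta>) - chord_pos_int (ang (Suc k)) s 0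
      + - chord_pos_int (ang k) s (ang k - \<eta>))) {ang k + 0..ang k + pi / real n}"
    by (rule has_integral_combine[OF _ _ _ narrow_has_integral[OF k' s, folded \<eta>_def], rotated 2])
      (use ab ang_Suc[of k] in auto)
  then have J: "(chord_top P s has_integral ?J) {real k * pi / real n..real k * pi / real n + pi / real n}"
    by (simp add: ang_def)
  show "line_measure P s = ennreal (2 * real n * ?J)" "0 \<le> ?J"
    by (rule line_measure_polygon[OF J])+
qed

text \<open>Before the transition the parallel sides leave no room, so \<open>chord_top\<close>
  takes its default 0 there and only the narrower pair contributes.\<close>

lemma line_measure_even:
  assumes k: "2 * Suc k = n" and s: "ell n r k \<le> s" "s < ell n r (Suc k)"
  defines "\<eta> \<equiv> arcsin (A1 n r k / s)"
  shows "line_measure P s = ennreal (2 * real n * - chord_pos_int (ang k) s (ang k - \<eta>))"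
    and "0 \<le> - chord_pos_int (ang k) s (ang k - \<eta>)"
proof -
  have k': "2 * Suc k \<le> n" using k by simp
  note ab = arcsin_A1_bounds[OF k' s, folded \<eta>_def] and b = A1_bounds[OF k' s(1)]
  have "((\<lambda>_. 0) has_integral 0) {ang k..ang k + (ang (Suc k) - \<eta>)}" by (rule has_integral_0)
  then have "(chord_top P s has_integral 0) {ang k..ang k + (ang (Suc k) - \<eta>)}"
  proof (rule has_integral_spike_interior[of _ 0 "ang k" "ang k + (ang (Suc k) - \<eta>)" "chord_top P s", unfolded box_real])
    fix x assume x: "x \<in> {ang k<..<ang k + (ang (Suc k) - \<eta>)}"
    define \<phi> where "\<phi> = x - ang k"
    have \<phi>: "0 < \<phi>" "\<eta> < ang (Suc k) - \<phi>" using x by (auto simp: \<phi>_def)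
    have "0 \<le> \<eta>" using ab(2) ang_nonneg[of k] by linarith
    then have "A1 n r k < s * sin (ang (Suc k) - \<phi>)"
    proof -
      have n3: "0 < k" using k n_ge by simp
      have "0 < ell n r k" using sin_ang_pos[of k] n3 r_pos k by (simp add: ell_eq)
      then have "0 < s" using s(1) by linarith
      then show ?thesis
        using le_arcsin_divide[OF b(1,2), of "ang (Suc k) - \<phi>"] \<phi> \<open>0 \<le> \<eta>\<close> ang_le_half[OF k']
        by (simp add: \<eta>_def not_le[symmetric])
    qed
    then have "\<not> has_chord P s p (ang k + \<phi>)" for p
      by (rule no_chord_even[OF k _ b(3)])
    then show "chord_top P s x = 0" by (simp add: chord_top_def \<phi>_def)
  qed
  then have "(chord_top P s has_integral (0 + - chord_pos_int (ang k) s (ang k - \<eta>))) {ang k..ang k + pi / real n}"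
    by (rule has_integral_combine[OF _ _ _ narrow_has_integral[OF k' s, folded \<eta>_def], rotated 2])
      (use ab ang_Suc[of k] in auto)
  then have J: "(chord_top P s has_integral (- chord_pos_int (ang k) s (ang k - \<eta>))) {real k * pi / real n..real k * pi / real n + pi / real n}"
    by (simp add: ang_def)
  show "line_measure P s = ennreal (2 * real n * - chord_pos_int (ang k) s (ang k - \<eta>))" "0 \<le> - chord_pos_int (ang k) s (ang k - \<eta>)"
    by (rule line_measure_polygon[OF J])+
qed

text \<open>The chord of the wider pair fails where s sin (ang (k + 1) + \<phi>) > \<lambda> = s sin
  \<theta>. This is an interval \<open>(?u, ?v)\<close> of \<phi>, symmetric about pi / (2 n), and
  the wider pair is integrated over \<open>[0, ?u]\<close> and \<open>[?v, ?w]\<close> only. As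
  \<open>B2 n\<close> is ang (k + 1), the ends are \<open>?u = \<theta> - B2 n\<close> and
  \<open>?v = B2 n + pi / n - \<theta>\<close>; since \<open>chord_pos_int\<close> is odd, both
  enter with a minus sign.\<close>

lemma line_measure_odd:
  assumes k: "n = 2 * k + 3" and s: "lam n r < s" "s < ell n r (Suc k)"
  defines "\<eta> \<equiv> arcsin (A1 n r k / s)" and "\<theta> \<equiv> arcsin (A2 n r / s)"
  shows "line_measure P s = ennreal (2 * real n * (chord_pos_int (ang (Suc k)) s (ang (Suc k) - \<eta>)
      - chord_pos_int (ang k) s (ang k - \<eta>)
      - chord_pos_int (ang (Suc k)) s (B2 n + pi / real n - \<theta>) - chord_pos_int (ang (Suc k)) s (B2 n - \<theta>)))"
      (is "_ = ennreal (2 * real n * ?J)")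
    and "0 \<le> chord_pos_int (ang (Suc k)) s (ang (Suc k) - \<eta>) - chord_pos_int (ang k) s (ang k - \<eta>)
      - chord_pos_int (ang (Suc k)) s (B2 n + pi / real n - \<theta>) - chord_pos_int (ang (Suc k)) s (B2 n - \<theta>)"
proof -
  define x where "x = pi / (2 * real n)"
  have nk: "real n = 2 * real k + 3" unfolding k by simp
  have k2: "2 * Suc k < n" using k by simp
  then have k': "2 * Suc k \<le> n" by simp
  have x: "0 < x" "x \<le> pi / 6" "pi / real n = 2 * x"
  proof -
    have "x = (pi / real n) / 2" by (simp add: x_def)
    moreover have "y / 2 \<le> pi / 6" if "y \<le> pi / 3" for y :: real using that by simp
    ultimately show "x \<le> pi / 6" using pi_n_bounds(2) by (simp only:)
    show "pi / real n = 2 * x" by (simp add: x_def)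
  qed (simp add: x_def)
  have angs: "ang (Suc k) = pi / 2 - x" "ang (Suc (Suc k)) = pi / 2 + x" "ang k = pi / 2 - 3 * x"
  proof -
    show *: "ang (Suc k) = pi / 2 - x" unfolding ang_def x_def using nk by (simp add: field_simps)
    show "ang (Suc (Suc k)) = pi / 2 + x" "ang k = pi / 2 - 3 * x"
      using * ang_Suc[of k] ang_Suc[of "Suc k"] x(3) by simp_all
  qed
  have B2: "B2 n = pi / 2 - x" by (simp add: B2_def x_def right_diff_distrib)
  have cx: "0 < cos x" using x by (intro cos_gt_zero) auto
  have cx1: "cos x \<le> 1" by simp
  have lam: "lam n r = 2 * r * (cos x * cos x)" "A2 n r = lam n r"
    by (simp_all add: lam_def A2_def x_def power2_eq_square)
  have ellS: "ell n r (Suc k) = 2 * r * cos x" unfolding ell_eq angs by (simp add: sin_diff)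
  have lam0: "0 < lam n r" using lam cx r_pos by simp
  then have s0: "0 < s" using s by simp
  have A1k: "A1 n r k = 2 * r * cos (3 * x) * cos x" unfolding A1_eq angs by (simp add: sin_diff)
  have A1S: "A1 n r (Suc k) = lam n r"
    unfolding A1_eq angs lam by (simp add: sin_diff sin_add)
  have c3: "cos (3 * x) \<le> cos (2 * x) * cos x"
  proof -
    have "cos (3 * x) = cos (2 * x) * cos x - sin (2 * x) * sin x"
      using cos_add[of "2 * x" x] by simp
    moreover have "0 \<le> sin (2 * x) * sin x"
      using x by (intro mult_nonneg_nonneg sin_ge_zero) auto
    ultimately show ?thesis by linarith
  qed
  have ell_le: "ell n r k \<le> s"
  proof -
    have "ell n r k = 2 * r * cos (3 * x)" unfolding ell_eq angs by (simp add: sin_diff)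
    also have "cos (3 * x) \<le> cos x * cos x"
    proof -
      have "cos (2 * x) \<le> cos x" using x by (intro cos_monotone_0_pi_le) auto
      then have "cos (2 * x) * cos x \<le> cos x * cos x" using cx by (intro mult_right_mono) auto
      then show ?thesis using c3 by linarith
    qed
    then have "2 * r * cos (3 * x) \<le> lam n r" unfolding lam using r_pos by (intro mult_left_mono) auto
    finally show ?thesis using s by simp
  qed
  note ab = arcsin_A1_bounds[OF k' ell_le s(2), folded \<eta>_def] and b = A1_bounds[OF k' ell_le]
  have \<theta>1: "pi / 2 - x \<le> \<theta>"
  proof -
    have "s * sin (pi / 2 - x) \<le> lam n r"
    proof -
      have "s * cos x \<le> 2 * r * cos x * cos x" using s(2) cx unfolding ellS by (intro mult_right_mono) auto
      then show ?thesis by (simp add: lam sin_diff mult_ac)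
    qed
    then show ?thesis
      unfolding \<theta>_def lam(2) using le_arcsin_divide[of "lam n r" s "pi / 2 - x"] lam0 s s0 x by simp
  qed
  have \<theta>2: "\<theta> < pi / 2"
  proof -
    have "lam n r / s < 1" "-1 < lam n r / s" using s s0 lam0 by (auto intro: less_le_trans[of _ 0])
    then show ?thesis unfolding \<theta>_def lam(2) using arcsin_lt_bounded by blast
  qed
  have sin\<theta>: "s * sin \<theta> = lam n r"
  proof -
    have "lam n r / s \<le> 1" "-1 \<le> lam n r / s" using s s0 lam0 by (auto intro: order_trans[of _ 0])
    then show ?thesis unfolding \<theta>_def lam(2) using s0 by (simp add: sin_arcsin)
  qed
  let ?u = "\<theta> - (pi / 2 - x)" and ?v = "pi / 2 + x - \<theta>" and ?w = "ang (Suc k) - \<eta>"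
  have outside: "s * sin (ang (Suc k) + \<phi>) \<le> lam n r" if "0 \<le> \<phi>" "\<phi> \<le> 2 * x" "\<phi> \<le> ?u \<or> ?v \<le> \<phi>" for \<phi>
  proof -
    have "sin (ang (Suc k) + \<phi>) \<le> sin \<theta>"
    proof (cases "\<phi> \<le> ?u")
      case True
      then show ?thesis unfolding angs using \<theta>2 that x by (intro sin_monotone_2pi_le) auto
    next
      case False
      then have "?v \<le> \<phi>" using that by simp
      have "sin (ang (Suc k) + \<phi>) = sin (pi - (ang (Suc k) + \<phi>))" by simp
      also have "\<dots> \<le> sin \<theta>"
        unfolding angs using \<open>?v \<le> \<phi>\<close> \<theta>2 that x by (intro sin_monotone_2pi_le) auto
      finally show ?thesis .
    qed
    then show ?thesis using s0 unfolding sin\<theta>[symmetric] by (intro mult_left_mono) auto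
  qed
  have inside: "lam n r < s * sin (ang (Suc k) + \<phi>)" if "?u < \<phi>" "\<phi> < ?v" for \<phi>
  proof -
    have "sin \<theta> < sin (ang (Suc k) + \<phi>)"
    proof (cases "\<phi> \<le> x")
      case True
      then show ?thesis unfolding angs using \<theta>1 that x by (intro sin_monotone_2pi) auto
    next
      case False
      have "sin \<theta> < sin (pi - (ang (Suc k) + \<phi>))"
        unfolding angs using False \<theta>1 that x by (intro sin_monotone_2pi) auto
      then show ?thesis by simp
    qed
    then show ?thesis using s0 unfolding sin\<theta>[symmetric] by (intro mult_strict_left_mono) auto
  qed
  \<comment> \<open>The transition lies in the second half of the window, and \<open>?u < x\<close>;
    so it cannot lie to the left of the gap, and only a position inside the gap remains to be
    excluded.\<close>
  have w: "x \<le> ?w"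
  proof -
    have "A1 n r k \<le> s * sin (pi / 2 - 2 * x)"
    proof -
      have "2 * r * cos (3 * x) * cos x \<le> 2 * r * (cos (2 * x) * cos x) * cos x"
        using c3 r_pos cx by (intro mult_right_mono mult_left_mono) auto
      also have "\<dots> = lam n r * cos (2 * x)" by (simp add: lam)
      also have "\<dots> \<le> s * cos (2 * x)"
        using s x by (intro mult_right_mono cos_ge_zero) auto
      finally show ?thesis by (simp add: A1k sin_diff)
    qed
    then have "\<eta> \<le> pi / 2 - 2 * x"
      unfolding \<eta>_def using arcsin_divide_le[OF b(1,2), of "pi / 2 - 2 * x"] x by simp
    then show ?thesis unfolding angs by simp
  qed
  text \<open>At the transition angle \<open>?w\<close> there is a chord of length \<open>s\<close>, so \<open>?w\<close> is outside the
    interval \<open>(?u, ?v)\<close> of directions without such a chord.\<close>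
  have wv: "?v \<le> ?w"
  proof (cases "k = 0")
    case True
    then have "\<eta> = 0" by (simp add: \<eta>_def A1_eq)
    moreover have "pi / 2 = 3 * x" using angs(3) True by simp
    ultimately show ?thesis using \<theta>1 unfolding angs by simp
  next
    case False
    have "s * sin (ang (Suc k) - ?w) \<le> A1 n r k"
    proof -
      have "-1 \<le> A1 n r k / s" "A1 n r k / s \<le> 1" using b s0 by (simp_all add: field_simps)
      then show ?thesis using s0 by (simp add: \<eta>_def sin_arcsin)
    qed
    from chord_top_narrow(1)[OF _ k' _ _ ell_le this]
    have "has_chord P s (chord_pos (ang k) s (?w - pi / real n)) (ang k + ?w)"
      using False ab ang_Suc[of k] by simp
    then have "\<not> lam n r < s * sin (ang (Suc k) + ?w)"
      using no_chord_odd[of s k ?w] s0 by auto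
    then have "\<not> (?u < ?w \<and> ?w < ?v)" using inside[of ?w] by blast
    moreover have "?u < ?w" using w \<theta>2 by linarith
    ultimately show ?thesis by linarith
  qed
  have w2: "?w \<le> 2 * x" using ab(2) ang_Suc[of k] x(3) by linarith
  have I1: "(chord_top P s has_integral (chord_pos_int (ang (Suc k)) s ?u - chord_pos_int (ang (Suc k)) s 0)) {ang k + 0..ang k + ?u}"
    using \<theta>1 \<theta>2 w w2 outside unfolding A1S[symmetric]
    by (intro wide_has_integral[OF k2 ell_le s(2)]) (auto simp: \<eta>_def[symmetric])
  have I2: "(chord_top P s has_integral 0) {ang k + ?u..ang k + ?v}"
  proof (rule has_integral_spike_interior[of "\<lambda>_. 0" 0 "ang k + ?u" "ang k + ?v" "chord_top P s", unfolded box_real])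
    fix y assume y: "y \<in> {ang k + ?u<..<ang k + ?v}"
    then have "lam n r < s * sin (ang (Suc k) + (y - ang k))" by (intro inside) auto
    from no_chord_odd[OF this] have "\<not> has_chord P s p (ang k + (y - ang k))" for p
      using s0 by simp
    then show "chord_top P s y = 0" by (simp add: chord_top_def)
  qed (rule has_integral_0)
  have I3: "(chord_top P s has_integral (chord_pos_int (ang (Suc k)) s ?w - chord_pos_int (ang (Suc k)) s ?v)) {ang k + ?v..ang k + ?w}"
    using \<theta>1 \<theta>2 wv w2 outside x(1) unfolding A1S[symmetric]
    by (intro wide_has_integral[OF k2 ell_le s(2)]) (auto simp: \<eta>_def[symmetric])
  have "(chord_top P s has_integral (chord_pos_int (ang (Suc k)) s ?u - chord_pos_int (ang (Suc k)) s 0 + 0 +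
     (chord_pos_int (ang (Suc k)) s ?w - chord_pos_int (ang (Suc k)) s ?v))) {ang k + 0..ang k + ?w}"
    by (rule has_integral_combine3[OF _ _ _ I1 I2 I3]) (use \<theta>1 \<theta>2 wv in auto)
  then have "(chord_top P s has_integral (chord_pos_int (ang (Suc k)) s ?u - chord_pos_int (ang (Suc k)) s 0 + 0 +
     (chord_pos_int (ang (Suc k)) s ?w - chord_pos_int (ang (Suc k)) s ?v) + - chord_pos_int (ang k) s (ang k - \<eta>))) {ang k + 0..ang k + pi / real n}"
    by (rule has_integral_combine[OF _ _ _ narrow_has_integral[OF k' ell_le s(2), folded \<eta>_def], rotated 2])
      (use ab ang_Suc[of k] in auto)
  moreover have "chord_pos_int (ang (Suc k)) s ?u = - chord_pos_int (ang (Suc k)) s (B2 n - \<theta>)"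
    unfolding chord_pos_int_minus[symmetric] B2 by simp
  moreover have "?v = B2 n + pi / real n - \<theta>" unfolding B2 x(3) by simp
  ultimately have J: "(chord_top P s has_integral ?J) {real k * pi / real n..real k * pi / real n + pi / real n}"
    by (simp add: ang_def algebra_simps)
  show "line_measure P s = ennreal (2 * real n * ?J)" "0 \<le> ?J"
    by (rule line_measure_polygon[OF J])+
qed

text \<open>The bound is the longest diagonal. For even n it is 2 r. For odd n and x = pi / (2 n) it
  is 2 r cos x = \<lambda> / cos x; in the whole window |\<phi> - x| \<le> x, so a longer chord has
  a projection of length s cos (\<phi> - x) > \<lambda>.\<close>

lemma line_measure_beyond_diameter:
  assumes "ell n r (Suc (KK n)) < s"
  shows "line_measure P s = 0"
proof -
  let ?k = "KK n"
  have none: "\<not> has_chord P s p (ang ?k + \<phi>)" if \<phi>: "0 \<le> \<phi>" "\<phi> \<le> pi / real n" for p \<phi>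
  proof (cases "even n")
    case True
    then have "n = 2 * Suc ?k" using n_ge by (auto simp: KK_def)
    then have "real n = 2 * real (Suc ?k)" by (metis of_nat_mult of_nat_numeral)
    then have "ang (Suc ?k) = pi / 2" by (simp add: ang_def field_simps)
    then have "2 * r < s" using assms unfolding ell_eq by (simp only: sin_pi_half mult_1_right)
    then show ?thesis using has_chord_le_diameter[of s p] by fastforce
  next
    case False
    then have "n = 2 * ?k + 3" using n_ge by (auto simp: KK_def elim!: oddE)
    then have nk: "real n = 2 * real ?k + 3" by linarith
    define x where "x = pi / (2 * real n)"
    have x: "0 < x" "x < pi / 2" "pi / real n = 2 * x"
    proof -
      have "x = (pi / real n) / 2" by (simp add: x_def)
      moreover have "0 < y / 2 \<and> y / 2 < pi / 2" if "0 < y" "y < pi / 2" for y :: real using that by simp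
      ultimately show "0 < x" "x < pi / 2" using pi_n_bounds(1,3) by (simp_all only:)
    qed (simp add: x_def)
    have ang: "ang (Suc ?k) = pi / 2 - x" unfolding ang_def x_def using nk by (simp add: field_simps)
    have cx: "0 < cos x" using x by (intro cos_gt_zero) auto
    have "2 * r * cos x < s" using assms unfolding ell_eq ang by (simp add: sin_diff)
    then have "2 * r * cos x * cos x < s * cos x" using cx by (intro mult_strict_right_mono)
    then have "lam n r < s * cos x" by (simp add: lam_def x_def power2_eq_square)
    also have "s * cos x \<le> s * sin (ang (Suc ?k) + \<phi>)"
    proof (rule mult_left_mono)
      have "cos x \<le> cos (\<bar>\<phi> - x\<bar>)" using \<phi> x pi_gt_zero by (intro cos_monotone_0_pi_le) linarith+
      also have "\<dots> = cos (x - \<phi>)" using cos_minus[of "x - \<phi>"] by (simp add: cos_abs_real)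
      also have "\<dots> = sin (pi / 2 - (x - \<phi>))" using sin_diff[of "pi / 2" "x - \<phi>"] by simp
      also have "pi / 2 - (x - \<phi>) = ang (Suc ?k) + \<phi>" unfolding ang by simp
      finally show "cos x \<le> sin (ang (Suc ?k) + \<phi>)" .
      show "0 \<le> s" using \<open>2 * r * cos x < s\<close> cx r_pos by (smt (verit) mult_pos_pos)
    qed
    finally have "lam n r < s * sin (ang (Suc ?k) + \<phi>)" .
    moreover have "0 \<le> s" using \<open>2 * r * cos x < s\<close> cx r_pos by (smt (verit) mult_pos_pos)
    ultimately show ?thesis by (rule no_chord_odd)
  qed
  have "(chord_top P s has_integral 0) {ang ?k..ang ?k + pi / real n}"
  proof (rule has_integral_eq[OF _ has_integral_0])
    fix y assume "y \<in> {ang ?k..ang ?k + pi / real n}"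
    then have "\<not> has_chord P s p (ang ?k + (y - ang ?k))" for p by (intro none) auto
    then show "0 = chord_top P s y" by (simp add: chord_top_def)
  qed
  then have "line_measure P s = ennreal (2 * real n * 0)"
    by (intro line_measure_polygon(1)) (simp add: ang_def)
  then show ?thesis by simp
qed

end

subsection \<open>The antiderivatives and the area\<close>

text \<open>The derivative of \<open>hstar\<close> against the expanded
  \<open>chord_pos_int\<close>. The trigonometric values, the root and the arcsine are free
  variables, so the identity is rational and clearing denominators proves it.\<close>

lemma hstar_algebra:
  fixes r sp S C t w \<eta> b :: real
  assumes "t \<noteq> 0" "r \<noteq> 0" "sp \<noteq> 0" "S \<noteq> 0" "C \<noteq> 0"
  shows "1 / (4 * r) * (1 / sp) * (s2b * (1 / (2 * S * C)) - 2 * b * (C2 / (2 * S * C))) * t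
    + a * (cb * (cp / sp) * (1 / C) - a / (2 * r) * s2b * (1 / sp) * (1 / (2 * S * C))) * (1 / t)
    + - (sb * (cp / sp) * (1 / C) + a / (2 * r) * c2b * (1 / sp) * (1 / (2 * S * C))) * (w / t)
    + 1 / (2 * r) * (1 / sp) * (C2 / (2 * S * C)) * (t * \<eta>)
    = - ((2 * (r * cp) * S * (sb * (w / t) - cb * (a / t))
         - t / 2 * ((s2b * (1 - 2 * (a / t)\<^sup>2) - c2b * (2 * (a / t) * (w / t))) / 2 - (b - \<eta>) * C2)) / (2 * S * C)) / (r * sp)"
  using assms by (simp add: field_simps power2_eq_square)

lemma sqrt_one_minus_square_divide:
  fixes a t :: real
  assumes "0 < t"
  shows "sqrt (1 - (a / t)\<^sup>2) = sqrt (t\<^sup>2 - a\<^sup>2) / t"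
proof -
  have "1 - (a / t)\<^sup>2 = (t\<^sup>2 - a\<^sup>2) / t\<^sup>2" using assms by (simp add: field_simps)
  then show ?thesis using assms by (simp add: real_sqrt_divide)
qed

context
  fixes a t :: real
  assumes a: "0 \<le> a" "a < t"
begin

lemma ratio_less_one: "a / t < 1" "- 1 < a / t" "0 < t"
proof -
  show "0 < t" using a by simp
  then show "a / t < 1" using a by simp
  have "0 \<le> a / t" using a \<open>0 < t\<close> by simp
  then show "- 1 < a / t" by linarith
qed

lemma DERIV_arcsin_divide:
  "((\<lambda>t. arcsin (a / t)) has_real_derivative - a / (t * sqrt (t\<^sup>2 - a\<^sup>2))) (at t)"
proof -
  have "((\<lambda>t. a / t) has_real_derivative - a / t\<^sup>2) (at t)"
    using ratio_less_one(3) by (auto intro!: derivative_eq_intros simp: power2_eq_square)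
  from DERIV_chain2[OF DERIV_arcsin[OF ratio_less_one(2,1)] this]
  have "((\<lambda>t. arcsin (a / t)) has_real_derivative inverse (sqrt (t\<^sup>2 - a\<^sup>2) / t) * (- a / t\<^sup>2)) (at t)"
    unfolding sqrt_one_minus_square_divide[OF ratio_less_one(3)] .
  moreover have "inverse (w / t) * (- a / t\<^sup>2) = - a / (t * w)" for w
    using ratio_less_one(3) by (cases "w = 0") (simp_all add: field_simps power2_eq_square)
  ultimately show ?thesis by simp
qed

lemma sqrt_diff_pos: "0 < sqrt (t\<^sup>2 - a\<^sup>2)" "(sqrt (t\<^sup>2 - a\<^sup>2))\<^sup>2 = t\<^sup>2 - a\<^sup>2"
proof -
  have "a\<^sup>2 < t\<^sup>2" using a by (intro power_strict_mono) auto
  then show "0 < sqrt (t\<^sup>2 - a\<^sup>2)" "(sqrt (t\<^sup>2 - a\<^sup>2))\<^sup>2 = t\<^sup>2 - a\<^sup>2" by simp_all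
qed

lemma DERIV_sqrt_diff: "((\<lambda>t. sqrt (t\<^sup>2 - a\<^sup>2)) has_real_derivative t / sqrt (t\<^sup>2 - a\<^sup>2)) (at t)"
  using sqrt_diff_pos(1) by (auto intro!: derivative_eq_intros simp: divide_simps)

lemma DERIV_L3: "((\<lambda>t. L3 t a) has_real_derivative sqrt (t\<^sup>2 - a\<^sup>2) / t) (at t)"
proof -
  let ?w = "sqrt (t\<^sup>2 - a\<^sup>2)"
  have "((\<lambda>t. L3 t a) has_real_derivative t / ?w + a * (- a / (t * ?w))) (at t)"
    unfolding L3_def by (intro DERIV_add DERIV_cmult DERIV_sqrt_diff DERIV_arcsin_divide)
  moreover have "t / ?w + a * (- a / (t * ?w)) = (t\<^sup>2 - a\<^sup>2) / (t * ?w)"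
    using sqrt_diff_pos(1) ratio_less_one(3) by (simp add: field_simps power2_eq_square)
  moreover have "w\<^sup>2 / (t * w) = w / t" if "0 < w" for w :: real
    using that by (simp add: power2_eq_square)
  from this[OF sqrt_diff_pos(1)] have "(t\<^sup>2 - a\<^sup>2) / (t * ?w) = ?w / t"
    unfolding sqrt_diff_pos(2) .
  ultimately show ?thesis by simp
qed

lemma DERIV_L4: "((\<lambda>t. L4 t a) has_real_derivative t * arcsin (a / t)) (at t)"
proof -
  let ?w = "sqrt (t\<^sup>2 - a\<^sup>2)"
  have "((\<lambda>t. t\<^sup>2) has_real_derivative 2 * t) (at t)" by (auto intro!: derivative_eq_intros)
  from DERIV_mult[OF this DERIV_arcsin_divide]
  have "((\<lambda>t. t\<^sup>2 * arcsin (a / t)) has_real_derivative 2 * t * arcsin (a / t) + - a / (t * ?w) * t\<^sup>2) (at t)" .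
  from DERIV_cmult[OF DERIV_add[OF DERIV_cmult[OF DERIV_sqrt_diff, of a] this], of "1/2"]
  have "((\<lambda>t. L4 t a) has_real_derivative 1 / 2 * (a * (t / ?w) + (2 * t * arcsin (a / t) + - a / (t * ?w) * t\<^sup>2))) (at t)"
    unfolding L4_def .
  moreover have "1 / 2 * (a * (t / ?w) + (2 * t * arcsin (a / t) + - a / (t * ?w) * t\<^sup>2)) = t * arcsin (a / t)"
    using ratio_less_one(3) by (simp add: field_simps power2_eq_square)
  ultimately show ?thesis by simp
qed

end

context regular_polygon
begin

text \<open>By the addition formulas, \<open>chord_pos_int (ang k) t (b - arcsin (a / t))\<close> is
  a combination of the four functions t, 1 / t, sqrt (t^2 - a^2) / t and t arcsin (a / t) of t.
  These are the derivatives of \<open>L1\<close> to \<open>L4\<close>, and the Theta functions are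
  the coefficients. The divisor r sin (pi / n), half a side, is the perimeter over the number 2 n of
  windows.\<close>

lemma DERIV_hstar:
  assumes a: "0 \<le> a" "a < t" and k: "k = 0 \<or> 2 * k < n"
  shows "((\<lambda>t. hstar n r k t a b) has_real_derivative
    - chord_pos_int (ang k) t (b - arcsin (a / t)) / (r * sin (pi / real n))) (at t)"
proof (cases "k = 0")
  case True
  then show ?thesis by (simp add: hstar_def chord_pos_int_def)
next
  case False
  define S C where "S = sin (ang k)" and "C = cos (ang k)"
  have t: "t > 0" using a by simp
  have S: "S > 0" using False k sin_ang_pos[of k] by (simp add: S_def)
  have C: "C > 0" using False k ang_less_half[of k] ang_pos[of k] unfolding C_def by (intro cos_gt_zero) auto
  have sp: "0 < sin (pi / real n)" using pi_n_bounds pi_gt_zero by (intro sin_gt_zero) linarith+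
  have sin2: "sin (2 * ang k) = 2 * S * C" by (simp add: S_def C_def sin_double)
  let ?w = "sqrt (t\<^sup>2 - a\<^sup>2)" and ?\<eta> = "arcsin (a / t)"
  note ratio = ratio_less_one[OF a]
  have trig: "sin ?\<eta> = a / t" "cos ?\<eta> = ?w / t"
    using ratio by (simp_all add: sin_arcsin cos_arcsin sqrt_one_minus_square_divide)
  let ?f = "\<lambda>t. Theta1 n r k a b * L1 t a + Theta2 n r k a b * L2 t a + Theta3 n r k a b * L3 t a + Theta4 n r k a b * L4 t a"
  have "((\<lambda>t. L1 t a) has_real_derivative t) (at t)"
    unfolding L1_def by (auto intro!: derivative_eq_intros)
  moreover have "((\<lambda>t. L2 t a) has_real_derivative 1 / t) (at t)"
    unfolding L2_def using t by (auto intro!: derivative_eq_intros)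
  ultimately have "(?f has_real_derivative Theta1 n r k a b * t + Theta2 n r k a b * (1 / t)
      + Theta3 n r k a b * (?w / t) + Theta4 n r k a b * (t * ?\<eta>)) (at t)"
    by (intro DERIV_add DERIV_cmult DERIV_L3[OF a] DERIV_L4[OF a])
  moreover have "Theta1 n r k a b * t + Theta2 n r k a b * (1 / t) + Theta3 n r k a b * (?w / t) + Theta4 n r k a b * (t * ?\<eta>)
     = - chord_pos_int (ang k) t (b - ?\<eta>) / (r * sin (pi / real n))"
  proof -
    have \<Theta>: "2 * real k * pi / real n = 2 * ang k" "real k * pi / real n = ang k" by (simp_all add: ang_def)
    have s: "sin (b - ?\<eta>) = sin b * (?w / t) - cos b * (a / t)"
      by (simp add: sin_diff trig)
    have "sin (2 * (b - ?\<eta>)) = sin (2 * b - 2 * ?\<eta>)" by (simp add: right_diff_distrib)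
    also have "\<dots> = sin (2 * b) * (1 - 2 * (a / t)\<^sup>2) - cos (2 * b) * (2 * (a / t) * (?w / t))"
      unfolding sin_diff cos_double_sin[of ?\<eta>] sin_double[of ?\<eta>] trig ..
    finally have s2: "sin (2 * (b - ?\<eta>)) = \<dots>" .
    show ?thesis
      unfolding Theta1_def Theta2_def Theta3_def Theta4_def csc_def sec_def cot_def \<Theta> chord_pos_int_def s s2 sin2 S_def[symmetric] C_def[symmetric]
      by (rule hstar_algebra) (use t r_pos sp S C in auto)
  qed
  ultimately have "(?f has_real_derivative - chord_pos_int (ang k) t (b - ?\<eta>) / (r * sin (pi / real n))) (at t)" by simp
  then show ?thesis
  proof (rule has_field_derivative_transform_within_open[where S = "{0<..}"])
    show "?f x = hstar n r k x a b" if "x \<in> {0<..}" for x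
      using that False by (simp add: hstar_def)
  qed (use t in auto)
qed

text \<open>The derivative formula stops at t = a, and t = a does occur as the end of a range: a = 0
  at the start of the lowest one, a = \<lambda> where the odd case changes. Continuity covers these
  points. For a = 0 the coefficient \<open>Theta2\<close> vanishes and takes the logarithm with it,
  so the value 0 set at t = 0 is the continuous one.\<close>

lemma continuous_on_hstar:
  assumes "0 \<le> a" "a \<le> x" "0 < x \<or> a = 0"
  shows "continuous_on {x..y} (\<lambda>t. hstar n r k t a b)"
proof (cases "a = 0")
  case True
  have "hstar n r k t a b = (if k = 0 then 0 else Theta1 n r k a b * (t\<^sup>2 / 2) + Theta3 n r k a b * sqrt (t\<^sup>2))" for t
    using True by (auto simp: hstar_def L1_def L2_def L3_def L4_def Theta2_def)
  then show ?thesis by (cases "k = 0") (auto intro!: continuous_intros)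
next
  case False
  have eq: "hstar n r k t a b = (if k = 0 then 0 else Theta1 n r k a b * L1 t a + Theta2 n r k a b * L2 t a
      + Theta3 n r k a b * L3 t a + Theta4 n r k a b * L4 t a)" if "t \<in> {x..y}" for t
    using that assms False by (auto simp: hstar_def)
  have cont: "continuous_on {x..y} (\<lambda>t. if k = 0 then 0 else Theta1 n r k a b * L1 t a + Theta2 n r k a b * L2 t a
      + Theta3 n r k a b * L3 t a + Theta4 n r k a b * L4 t a)"
  proof -
    have "continuous_on {x..y} (\<lambda>t. arcsin (a / t))"
    proof (rule continuous_on_arcsin)
      show "continuous_on {x..y} ((/) a)"
        by (intro continuous_intros) (use assms False in auto)
      show "\<forall>t\<in>{x..y}. - 1 \<le> a / t \<and> a / t \<le> 1"
      proof
        fix t assume "t \<in> {x..y}"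
        then have "0 < t" "a \<le> t" using assms False by auto
        then have "0 \<le> a / t" "a / t \<le> 1" using assms by auto
        then show "- 1 \<le> a / t \<and> a / t \<le> 1" by auto
      qed
    qed
    moreover have "continuous_on {x..y} ln"
      by (intro continuous_intros) (use assms False in auto)
    ultimately show ?thesis
      unfolding L1_def L2_def L3_def L4_def by (cases "k = 0") (auto intro!: continuous_intros)
  qed
  show ?thesis by (rule continuous_on_eq[OF cont]) (simp only: eq)
qed

section \<open>The area of the polygon from its radial function\<close>

definition radius_at :: "real \<Rightarrow> real" where
  "radius_at \<phi> = Sup {q. line_pt 0 \<phi> q \<in> P}"

text \<open>The line through the centre with normal \<phi> runs in direction \<phi> + pi / 2, hence
  the shift: \<psi> is the angle between the ray and the side normal pi / n, and the ray leaves the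
  polygon at distance \<open>apothem / cos \<psi>\<close>.\<close>

lemma radius_at_eq:
  assumes "\<bar>\<psi>\<bar> \<le> pi / real n"
  shows "radius_at (pi / real n - pi / 2 + \<psi>) = apothem / cos \<psi>"
    and "line_pt 0 (pi / real n - pi / 2 + \<psi>) (apothem / cos \<psi>) \<in> P"
    and "0 < apothem / cos \<psi>"
proof -
  let ?\<phi> = "pi / real n - pi / 2 + \<psi>"
  have facet: "facet_angle n (pi / real n)" by (rule facet_angleI[of _ 0]) simp
  have c: "0 < cos \<psi>" using assms pi_n_bounds by (intro cos_gt_zero_pi) linarith+
  have cn: "0 < cos (pi / real n)" using pi_n_bounds by (intro cos_gt_zero_pi) linarith+
  then have ap: "0 < apothem" using r_pos by simp
  then show "0 < apothem / cos \<psi>" using c by simp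
  have angle: "pi / real n - ?\<phi> = pi / 2 - \<psi>" by simp
  have lt: "\<bar>\<psi>\<bar> < pi / 2" using assms pi_n_bounds by linarith
  then have "0 \<le> tan \<bar>\<psi>\<bar>" by (intro tan_pos_pi2_le) auto
  then have "\<bar>tan \<psi>\<bar> = tan \<bar>\<psi>\<bar>" by (cases "\<psi> \<ge> 0") auto
  also have "\<dots> \<le> tan (pi / real n)"
  proof (cases "\<bar>\<psi>\<bar> = pi / real n")
    case False
    then have "tan \<bar>\<psi>\<bar> < tan (pi / real n)"
      using assms pi_n_bounds pi_gt_zero by (intro tan_monotone) linarith+
    then show ?thesis by simp
  qed simp
  finally have tan_le: "apothem * \<bar>tan \<psi>\<bar> \<le> apothem * tan (pi / real n)" using ap by (intro mult_left_mono) auto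
  have "\<bar>apothem * tan \<psi>\<bar> \<le> r * sin (pi / real n)"
  proof -
    have "\<bar>apothem * tan \<psi>\<bar> = apothem * \<bar>tan \<psi>\<bar>" unfolding abs_mult[of apothem] using ap by (simp only: abs_of_pos)
    moreover have "apothem * tan (pi / real n) = r * sin (pi / real n)" using cn by (simp add: tan_def)
    ultimately show ?thesis using tan_le by (simp only:)
  qed
  from side_in_polygon[OF facet this]
  have "line_pt (apothem * sin \<psi> - apothem * tan \<psi> * cos \<psi>) ?\<phi> (apothem * cos \<psi> + apothem * tan \<psi> * sin \<psi>) \<in> P"
    by (subst (asm) line_pt_change_angle[of _ _ _ ?\<phi>]) (simp only: angle, simp add: sin_diff cos_diff)
  moreover have "apothem * sin \<psi> - apothem * tan \<psi> * cos \<psi> = 0" using c by (simp add: tan_def)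
  moreover have "apothem * cos \<psi> + apothem * tan \<psi> * sin \<psi> = apothem * (cos \<psi> * cos \<psi> + sin \<psi> * sin \<psi>) / cos \<psi>"
    using c by (simp add: tan_def field_simps del: sin_cos_squared_add3)
  ultimately show mem: "line_pt 0 ?\<phi> (apothem / cos \<psi>) \<in> P" by simp
  show "radius_at ?\<phi> = apothem / cos \<psi>"
    unfolding radius_at_def
  proof (rule cSup_eq_maximum)
    fix q assume "q \<in> {q. line_pt 0 ?\<phi> q \<in> P}"
    then have "q * sin (pi / 2 - \<psi>) \<le> apothem"
      using polygon_facet[OF _ facet, of "line_pt 0 ?\<phi> q"] unfolding inner_line_pt angle by simp
    then show "q \<le> apothem / cos \<psi>" using c by (simp add: sin_diff pos_le_divide_eq)
  qed (use mem in simp)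
qed

lemma radius_at_period: "radius_at (\<phi> + 2 * pi / real n) = radius_at \<phi>"
proof -
  have "line_pt 0 (\<phi> + 2 * pi / real n) q \<in> P \<longleftrightarrow> line_pt 0 \<phi> q \<in> P" for q
    using polygon_rotate[of 0 \<phi> q 1] polygon_rotate[of 0 "\<phi> + 2 * pi / real n" q "-1"] by auto
  then show ?thesis by (simp add: radius_at_def)
qed

lemma positive_in_slice: "\<exists>q>0. line_pt 0 \<phi> q \<in> P"
proof -
  define T where "T = 2 * pi / real n"
  define c where "c = \<lfloor>(\<phi> - (- pi / 2)) / T\<rfloor>"
  have T: "T > 0" "pi / real n = T / 2" by (simp_all add: T_def)
  have "of_int c \<le> (\<phi> - (- pi / 2)) / T" "(\<phi> - (- pi / 2)) / T < of_int c + 1"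
    unfolding c_def by linarith+
  then have "of_int c * T \<le> \<phi> + pi / 2" "\<phi> + pi / 2 < of_int c * T + T"
    using T by (simp_all add: field_simps)
  then have "\<bar>\<phi> - of_int c * T + pi / 2 - pi / real n\<bar> \<le> pi / real n"
    unfolding T(2) by linarith
  note * = radius_at_eq(2,3)[OF this]
  have "pi / real n - pi / 2 + (\<phi> - of_int c * T + pi / 2 - pi / real n) + of_int c * (2 * pi / real n) = \<phi>"
    by (simp add: T_def)
  with polygon_rotate[OF *(1), of c] *(2) show ?thesis by auto
qed

text \<open>A line through the centre extends by \<open>radius_at \<phi>\<close> one way and by
  \<open>radius_at (\<phi> + pi)\<close> the other, so |\<rho>| integrates along it to half the sum
  of the squares. The area is therefore the integral of half the squared radius over a full turn, n
  times that over one side, where \<open>apothem\<^sup>2 / 2 * tan \<psi>\<close> is an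
  antiderivative.\<close>

lemma emeasure_polygon: "emeasure lborel P = ennreal (area n r)"
proof -
  have [measurable]: "P \<in> sets borel" using compact_polygon by (simp add: borel_compact)
  define f where "f \<phi> = (radius_at \<phi>)\<^sup>2 / 2" for \<phi>
  have slice: "(\<integral>\<^sup>+\<rho>. ennreal \<bar>\<rho>\<bar> * indicator P (line_pt 0 \<phi> \<rho>) \<partial>lborel) = ennreal (f \<phi> + f (\<phi> + pi))" for \<phi>
  proof (cases rule: slice_cases[OF compact_polygon convex_polygon, where p = 0 and \<phi> = \<phi>])
    case 1
    then show ?thesis using positive_in_slice[of \<phi>] by blast
  next
    case (2 a b)
    have mem: "line_pt 0 \<phi> q \<in> P \<longleftrightarrow> a \<le> q \<and> q \<le> b" for q
      using arg_cong[OF 2(2), of "\<lambda>A. q \<in> A"] by (simp only: mem_Collect_eq atLeastAtMost_iff)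
    obtain q where "0 < q" "a \<le> q" "q \<le> b" using positive_in_slice[of \<phi>] mem by blast
    then have b: "0 < b" by simp
    obtain q where "0 < q" "line_pt 0 (\<phi> + pi) q \<in> P" using positive_in_slice[of "\<phi> + pi"] by blast
    then have a: "a < 0" using mem[of "- q"] by (simp add: line_pt_plus_pi)
    have rb: "radius_at \<phi> = b" using 2 by (simp add: radius_at_def)
    have ra: "radius_at (\<phi> + pi) = - a"
      unfolding radius_at_def by (rule cSup_eq_maximum) (use mem 2(1) in \<open>auto simp: line_pt_plus_pi\<close>)
    have "((\<lambda>\<rho>. \<bar>\<rho>\<bar>) has_integral ((- (0\<^sup>2 / 2)) - (- (a\<^sup>2 / 2)) + (b\<^sup>2 / 2 - 0\<^sup>2 / 2))) {a..b}"
    proof (rule has_integral_combine[of a 0 b])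
      have "((\<lambda>\<rho>. - \<rho>) has_integral ((- (0\<^sup>2 / 2)) - (- (a\<^sup>2 / 2)))) {a..0}"
        using a by (intro fundamental_theorem_of_calculus)
          (auto intro!: derivative_eq_intros simp flip: has_real_derivative_iff_has_vector_derivative)
      then show "((\<lambda>\<rho>. \<bar>\<rho>\<bar>) has_integral ((- (0\<^sup>2 / 2)) - (- (a\<^sup>2 / 2)))) {a..0}"
        by (rule has_integral_eq[rotated]) auto
      have "((\<lambda>\<rho>. \<rho>) has_integral (b\<^sup>2 / 2 - 0\<^sup>2 / 2)) {0..b}"
        using b by (intro fundamental_theorem_of_calculus)
          (auto intro!: derivative_eq_intros simp flip: has_real_derivative_iff_has_vector_derivative)
      then show "((\<lambda>\<rho>. \<bar>\<rho>\<bar>) has_integral (b\<^sup>2 / 2 - 0\<^sup>2 / 2)) {0..b}"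
        by (rule has_integral_eq[rotated]) auto
    qed (use a b in auto)
    from nn_integral_has_integral_lebesgue'[OF _ this]
    have "(\<integral>\<^sup>+\<rho>. ennreal \<bar>\<rho>\<bar> * indicator {a..b} \<rho> \<partial>lborel) = ennreal (b\<^sup>2 / 2 + a\<^sup>2 / 2)"
      by (simp add: add.commute)
    moreover have "indicator {a..b} \<rho> = (indicator P (line_pt 0 \<phi> \<rho>) :: ennreal)" for \<rho>
      using mem[of \<rho>] by (auto split: split_indicator)
    ultimately show ?thesis unfolding f_def rb ra by simp
  qed
  have "(f has_integral (apothem\<^sup>2 / 2 * tan (pi / real n) - apothem\<^sup>2 / 2 * tan (- (pi / real n))))
      {pi / real n - pi / 2 + - (pi / real n)..pi / real n - pi / 2 + pi / real n}"
  proof -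
    have "((\<lambda>\<psi>. (apothem / cos \<psi>)\<^sup>2 / 2) has_integral (apothem\<^sup>2 / 2 * tan (pi / real n) - apothem\<^sup>2 / 2 * tan (- (pi / real n))))
        {- (pi / real n)..pi / real n}"
    proof (rule fundamental_theorem_of_calculus)
      fix \<psi> assume "\<psi> \<in> {- (pi / real n)..pi / real n}"
      then have "- (pi / real n) \<le> \<psi>" "\<psi> \<le> pi / real n" by auto
      then have "0 < cos \<psi>" using pi_n_bounds by (intro cos_gt_zero_pi) linarith+
      have eq: "apothem\<^sup>2 / 2 * inverse ((cos \<psi>)\<^sup>2) = (apothem / cos \<psi>)\<^sup>2 / 2"
        by (subst power_divide) (simp only: divide_inverse mult_ac)
      from \<open>0 < cos \<psi>\<close> have "((\<lambda>\<psi>. apothem\<^sup>2 / 2 * tan \<psi>) has_real_derivative apothem\<^sup>2 / 2 * inverse ((cos \<psi>)\<^sup>2)) (at \<psi>)"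
        by (intro DERIV_cmult DERIV_tan) auto
      then show "((\<lambda>\<psi>. apothem\<^sup>2 / 2 * tan \<psi>) has_vector_derivative (apothem / cos \<psi>)\<^sup>2 / 2) (at \<psi> within {- (pi / real n)..pi / real n})"
        unfolding eq has_real_derivative_iff_has_vector_derivative[symmetric]
        by (rule has_field_derivative_at_within)
    qed (use pi_n_bounds in linarith)
    then have "((f \<circ> (+) (pi / real n - pi / 2)) has_integral (apothem\<^sup>2 / 2 * tan (pi / real n) - apothem\<^sup>2 / 2 * tan (- (pi / real n))))
        {- (pi / real n)..pi / real n}"
      by (rule has_integral_eq[rotated]) (simp add: f_def radius_at_eq(1) abs_le_iff)
    then show ?thesis
      unfolding has_integral_shift_Icc_real by (simp only: add.commute)
  qed
  moreover have "apothem\<^sup>2 / 2 * tan (pi / real n) - apothem\<^sup>2 / 2 * tan (- (pi / real n)) = r\<^sup>2 * cos (pi / real n) * sin (pi / real n)"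
  proof -
    have "0 < cos (pi / real n)" using pi_n_bounds by (intro cos_gt_zero_pi) linarith+
    then show ?thesis by (simp add: tan_def field_simps power2_eq_square)
  qed
  moreover have "pi / real n - pi / 2 + pi / real n = pi / real n - pi / 2 + - (pi / real n) + 2 * pi / real n" by simp
  ultimately have "(f has_integral (r\<^sup>2 * cos (pi / real n) * sin (pi / real n)))
      {pi / real n - pi / 2 + - (pi / real n)..pi / real n - pi / 2 + - (pi / real n) + 2 * pi / real n}"
    by (simp only:)
  from has_integral_periodic[OF _ _ this, of n "- pi / 2"]
  have "(f has_integral (real n * (r\<^sup>2 * cos (pi / real n) * sin (pi / real n)))) {- pi / 2..- pi / 2 + 2 * pi}"
    by (simp add: f_def radius_at_period)
  from nn_integral_half_period(1)[OF _ this]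
  have "(\<integral>\<^sup>+\<phi>. indicator {-pi/2<..<pi/2} \<phi> * ennreal (f \<phi> + f (\<phi> + pi)) \<partial>lborel) =
      ennreal (real n * (r\<^sup>2 * cos (pi / real n) * sin (pi / real n)))"
    by (simp add: f_def)
  moreover have "emeasure lborel P = (\<integral>\<^sup>+z. indicator P z \<partial>lborel)" by simp
  moreover have "(\<integral>\<^sup>+z. indicator P z \<partial>lborel) = (\<integral>\<^sup>+\<phi>. indicator {-pi/2<..<pi/2} \<phi> *
      (\<integral>\<^sup>+\<rho>. ennreal \<bar>\<rho>\<bar> * indicator P (line_pt 0 \<phi> \<rho>) \<partial>lborel) \<partial>lborel)"
    by (rule nn_integral_polar) simp
  moreover have "real n * (r\<^sup>2 * cos (pi / real n) * sin (pi / real n)) = area n r"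
  proof -
    have "sin (2 * pi / real n) = 2 * sin (pi / real n) * cos (pi / real n)"
      using sin_double[of "pi / real n"] by simp
    then show ?thesis by (simp add: area_def)
  qed
  ultimately show ?thesis by (simp only: slice)
qed

end

subsection \<open>Distribution of the distance\<close>

context regular_polygon
begin

abbreviation "u \<equiv> perim n r"
abbreviation "tail s \<equiv> enn2real (line_measure P s)"

lemma sin_pi_n_pos: "0 < sin (pi / real n)"
  using pi_n_bounds pi_gt_zero by (intro sin_gt_zero) linarith+

lemma perim_eq: "u = 2 * real n * (r * sin (pi / real n))"
  by (simp add: perim_def)

lemma perim_pos: "0 < u"
  using sin_pi_n_pos r_pos by (simp add: perim_def)

lemma B1_eq: "B1 n k = ang k" "ang k + pi / real n = ang (Suc k)"
  by (simp_all add: B1_def ang_def field_simps)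

lemma lam_pos: "0 < lam n r"
proof -
  have "0 < cos (pi / real n)" using pi_n_bounds by (intro cos_gt_zero_pi) linarith+
  then show ?thesis using r_pos by (simp add: lam_eq add_pos_pos)
qed

lemma ell_mono:
  assumes "j \<le> k" "2 * k \<le> n"
  shows "ell n r j \<le> ell n r k"
proof -
  have "ang j \<le> ang k" using assms(1) by (simp add: ang_def divide_right_mono mult_right_mono)
  then have "sin (ang j) \<le> sin (ang k)"
    using ang_nonneg[of j] ang_le_half[OF assms(2)] pi_gt_zero by (intro sin_monotone_2pi_le) linarith+
  then show ?thesis using r_pos by (simp add: ell_eq)
qed

lemma ell_nonneg: "2 * k \<le> n \<Longrightarrow> 0 \<le> ell n r k"
  using sin_ang_nonneg[of k] r_pos by (simp add: ell_eq)

lemma ell_pos: "0 < k \<Longrightarrow> 2 * k \<le> n \<Longrightarrow> 0 < ell n r k"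
  using sin_ang_pos[of k] r_pos by (simp add: ell_eq)

lemma odd_angles:
  assumes "n = 2 * k + 3"
  defines "x \<equiv> pi / (2 * real n)"
  shows "0 < x" "x \<le> pi / 6" "ang k = pi / 2 - 3 * x" "ang (Suc k) = pi / 2 - x"
proof -
  have nk: "real n = 2 * real k + 3" unfolding assms(1) by simp
  have x: "x = (pi / real n) / 2" by (simp add: x_def)
  show "0 < x" by (simp add: x_def)
  have "y / 2 \<le> pi / 6" if "y \<le> pi / 3" for y :: real using that by simp
  with pi_n_bounds(2) show "x \<le> pi / 6" unfolding x by (simp only:)
  show *: "ang (Suc k) = pi / 2 - x" unfolding ang_def x_def using nk by (simp add: field_simps)
  then show "ang k = pi / 2 - 3 * x" using ang_Suc[of k] x by simp
qed

lemma ell_less_lam: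
  assumes "n = 2 * k + 3"
  shows "ell n r k < lam n r" "lam n r < ell n r (Suc k)"
proof -
  define x where "x = pi / (2 * real n)"
  note x = odd_angles[OF assms, folded x_def]
  have cx: "0 < cos x" using x(1,2) pi_gt_zero by (intro cos_gt_zero_pi) linarith+
  have "cos (3 * x) = cos (2 * x) * cos x - sin (2 * x) * sin x"
    using cos_add[of "2 * x" x] by simp
  moreover have "0 \<le> sin (2 * x) * sin x"
    using x(1,2) by (intro mult_nonneg_nonneg sin_ge_zero) auto
  moreover have "cos (2 * x) * cos x < cos x * cos x"
    using x(1,2) cx by (intro mult_strict_right_mono cos_monotone_0_pi) auto
  ultimately have "cos (3 * x) < cos x * cos x" by linarith
  then show "ell n r k < lam n r"
    using r_pos by (simp add: ell_eq lam_def x(3) sin_diff x_def[symmetric] power2_eq_square)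
  have "cos x < 1" using cos_monotone_0_pi[of 0 x] x(1,2) by simp
  then have "cos x * cos x < cos x * 1" using cx by (intro mult_strict_left_mono)
  then show "lam n r < ell n r (Suc k)"
    using r_pos by (simp add: ell_eq lam_def x(4) sin_diff x_def[symmetric] power2_eq_square)
qed

text \<open>The lowest range at \<open>s = 0\<close>, where the transition angle is 0 by the
  convention 0 / 0 = 0. One window gives r sin (pi / n), half a side, and the 2 n windows give the
  perimeter.\<close>

lemma line_measure_0: "line_measure P 0 = ennreal u"
proof -
  have "line_measure P 0 = ennreal (2 * real n * (chord_pos_int (ang (Suc 0)) 0 (ang (Suc 0) - arcsin (A1 n r 0 / 0))
      - chord_pos_int (ang 0) 0 (ang 0 - arcsin (A1 n r 0 / 0))))"
    using n_ge lam_pos ell_pos[of "Suc 0"] by (intro line_measure_regular(1)) (auto simp: ell_eq)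
  also have "chord_pos_int (ang (Suc 0)) 0 (ang (Suc 0) - arcsin (A1 n r 0 / 0)) - chord_pos_int (ang 0) 0 (ang 0 - arcsin (A1 n r 0 / 0))
     = r * sin (pi / real n)"
  proof -
    have "0 < cos (pi / real n)" using pi_n_bounds by (intro cos_gt_zero_pi) linarith+
    then show ?thesis
      using sin_pi_n_pos by (simp add: chord_pos_int_def ang_Suc sin_double[of "pi / real n", simplified])
  qed
  finally show ?thesis by (simp add: perim_eq)
qed

lemma line_measure_le: "0 \<le> s \<Longrightarrow> line_measure P s \<le> ennreal u"
  using line_measure_antimono[OF compact_polygon convex_polygon order_refl] line_measure_0 by metis

lemma line_measure_eq_tail: "0 \<le> s \<Longrightarrow> line_measure P s = ennreal (tail s)"
  using le_less_trans[OF line_measure_le ennreal_less_top] by simp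

lemma tail_divide:
  assumes "line_measure P s = ennreal (2 * real n * J)" "0 \<le> J"
  shows "tail s / u = J / (r * sin (pi / real n))"
  using assms by (simp add: perim_eq enn2real_ennreal)

lemma FTC_tail:
  assumes "a \<le> b" "continuous_on {a..b} H"
    and "\<And>s. a < s \<Longrightarrow> s < b \<Longrightarrow> (H has_real_derivative 1 - tail s / u) (at s)"
  shows "((\<lambda>s. 1 - tail s / u) has_integral (H b - H a)) {a..b}"
  using assms by (intro fundamental_theorem_of_calculus_interior)
    (auto simp flip: has_real_derivative_iff_has_vector_derivative)

section \<open>Antiderivatives of the distribution function on each range\<close>

definition H_regular :: "nat \<Rightarrow> real \<Rightarrow> real" where
  "H_regular k t = t - hstar n r k t (A1 n r k) (B1 n k) + hstar n r (k + 1) t (A1 n r k) (B1 n k + pi / real n)"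

lemma A1_conditions:
  assumes "2 * Suc k \<le> n"
  shows "0 \<le> A1 n r k" "A1 n r k \<le> ell n r k" "0 < ell n r k \<or> A1 n r k = 0"
proof -
  show "0 \<le> A1 n r k" "A1 n r k \<le> ell n r k" using A1_bounds[OF assms order_refl] by auto
  show "0 < ell n r k \<or> A1 n r k = 0"
    using ell_pos[of k] assms by (cases "k = 0") (auto simp: A1_eq)
qed

lemma tail_integral_regular:
  assumes k: "2 * Suc k < n" and t: "ell n r k \<le> t" "t \<le> ell n r (Suc k)"
    and wide: "2 * Suc (Suc k) \<le> n \<or> t \<le> lam n r"
  shows "((\<lambda>s. 1 - tail s / u) has_integral (H_regular k t - H_regular k (ell n r k))) {ell n r k..t}"
proof (rule FTC_tail[OF t(1)])
  have k': "2 * Suc k \<le> n" using k by simp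
  note A = A1_conditions[OF k']
  show "continuous_on {ell n r k..t} (H_regular k)"
    unfolding H_regular_def[abs_def] by (intro continuous_intros continuous_on_hstar A)
  fix s assume s: "ell n r k < s" "s < t"
  then have A1s: "A1 n r k < s" using A(2) by linarith
  let ?\<eta> = "arcsin (A1 n r k / s)" and ?c = "r * sin (pi / real n)"
  have tail: "tail s / u = (chord_pos_int (ang (Suc k)) s (ang (Suc k) - ?\<eta>) - chord_pos_int (ang k) s (ang k - ?\<eta>)) / ?c"
    by (rule tail_divide; rule line_measure_regular[OF k]) (use s t wide in auto)
  have deriv: "(H_regular k has_real_derivative 1 - - chord_pos_int (ang k) s (B1 n k - ?\<eta>) / ?c
      + - chord_pos_int (ang (k + 1)) s (B1 n k + pi / real n - ?\<eta>) / ?c) (at s)"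
    unfolding H_regular_def[abs_def]
    by (intro DERIV_add DERIV_diff DERIV_ident DERIV_hstar A(1) A1s) (use k in auto)
  show "(H_regular k has_real_derivative 1 - tail s / u) (at s)"
    by (rule DERIV_cong[OF deriv]) (simp add: tail B1_eq diff_divide_distrib)
qed

definition H_even :: "nat \<Rightarrow> real \<Rightarrow> real" where
  "H_even k t = t - hstar n r k t (A1 n r k) (B1 n k)"

lemma tail_integral_even:
  assumes k: "2 * Suc k = n" and t: "ell n r k \<le> t" "t \<le> ell n r (Suc k)"
  shows "((\<lambda>s. 1 - tail s / u) has_integral (H_even k t - H_even k (ell n r k))) {ell n r k..t}"
proof (rule FTC_tail[OF t(1)])
  have k': "2 * Suc k \<le> n" using k by simp
  note A = A1_conditions[OF k']
  show "continuous_on {ell n r k..t} (H_even k)"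
    unfolding H_even_def[abs_def] by (intro continuous_intros continuous_on_hstar A)
  fix s assume s: "ell n r k < s" "s < t"
  then have A1s: "A1 n r k < s" using A(2) by linarith
  let ?\<eta> = "arcsin (A1 n r k / s)" and ?c = "r * sin (pi / real n)"
  have tail: "tail s / u = - chord_pos_int (ang k) s (ang k - ?\<eta>) / ?c"
    by (rule tail_divide; rule line_measure_even[OF k]) (use s t in auto)
  have deriv: "(H_even k has_real_derivative 1 - - chord_pos_int (ang k) s (B1 n k - ?\<eta>) / ?c) (at s)"
    unfolding H_even_def[abs_def]
    by (intro DERIV_diff DERIV_ident DERIV_hstar A(1) A1s) (use k in auto)
  show "(H_even k has_real_derivative 1 - tail s / u) (at s)"
    by (rule DERIV_cong[OF deriv]) (simp add: tail B1_eq)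
qed

text \<open>The last two summands are constants that make it agree with \<open>H_regular\<close> at
  \<lambda>, so the two antiderivatives glue there.\<close>

definition H_odd :: "nat \<Rightarrow> real \<Rightarrow> real" where
  "H_odd k t = t - hstar n r k t (A1 n r k) (B1 n k) + hstar n r (k + 1) t (A1 n r k) (B1 n k + pi / real n)
    - hstar n r (k + 1) t (A2 n r) (B2 n + pi / real n) - hstar n r (k + 1) t (A2 n r) (B2 n)
    + hstar n r (k + 1) (lam n r) (A2 n r) (B2 n + pi / real n) + hstar n r (k + 1) (lam n r) (A2 n r) (B2 n)"

lemma A2_eq: "A2 n r = lam n r"
  by (simp add: A2_def lam_def)

lemma tail_integral_odd:
  assumes k: "n = 2 * k + 3" and t: "lam n r \<le> t" "t \<le> ell n r (Suc k)"
  shows "((\<lambda>s. 1 - tail s / u) has_integral (H_odd k t - H_odd k (lam n r))) {lam n r..t}"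
proof (rule FTC_tail[OF t(1)])
  have k': "2 * Suc k \<le> n" using k by simp
  note A = A1_conditions[OF k'] and L = ell_less_lam(1)[OF k]
  have A1L: "A1 n r k \<le> lam n r" using A(2) L by linarith
  show "continuous_on {lam n r..t} (H_odd k)"
    unfolding H_odd_def[abs_def] A2_eq using lam_pos A1L
    by (intro continuous_intros continuous_on_hstar A(1)) auto
  fix s assume s: "lam n r < s" "s < t"
  then have A1s: "A1 n r k < s" and A2s: "A2 n r < s" using A1L by (auto simp: A2_eq)
  have A2: "0 \<le> A2 n r" using lam_pos by (simp add: A2_eq)
  let ?\<eta> = "arcsin (A1 n r k / s)" and ?\<theta> = "arcsin (A2 n r / s)" and ?c = "r * sin (pi / real n)"
  have tail: "tail s / u = (chord_pos_int (ang (Suc k)) s (ang (Suc k) - ?\<eta>) - chord_pos_int (ang k) s (ang k - ?\<eta>)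
      - chord_pos_int (ang (Suc k)) s (B2 n + pi / real n - ?\<theta>) - chord_pos_int (ang (Suc k)) s (B2 n - ?\<theta>)) / ?c"
    by (rule tail_divide; rule line_measure_odd[OF k]) (use s t in auto)
  have deriv: "(H_odd k has_real_derivative 1 - - chord_pos_int (ang k) s (B1 n k - ?\<eta>) / ?c
      + - chord_pos_int (ang (k + 1)) s (B1 n k + pi / real n - ?\<eta>) / ?c
      - - chord_pos_int (ang (k + 1)) s (B2 n + pi / real n - ?\<theta>) / ?c - - chord_pos_int (ang (k + 1)) s (B2 n - ?\<theta>) / ?c + 0 + 0) (at s)"
    unfolding H_odd_def[abs_def]
    by (intro DERIV_add DERIV_diff DERIV_ident DERIV_const DERIV_hstar A(1) A2 A1s A2s) (use k in auto)
  show "(H_odd k has_real_derivative 1 - tail s / u) (at s)"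
    by (rule DERIV_cong[OF deriv]) (simp add: tail B1_eq diff_divide_distrib)
qed

lemma KK_even: "even n \<Longrightarrow> 2 * Suc (KK n) = n"
  using n_ge by (auto simp: KK_def)

lemma KK_odd: "odd n \<Longrightarrow> n = 2 * KK n + 3"
  using n_ge by (auto simp: KK_def elim!: oddE)

lemma KK_le: "2 * Suc (KK n) \<le> n"
proof (cases "even n")
  case True
  then show ?thesis using KK_even by simp
next
  case False
  show ?thesis using KK_odd[OF False] unfolding mult_Suc_right by linarith
qed

lemma tail_integral_piece:
  assumes k: "k \<le> KK n" and t: "ell n r k \<le> t" "t \<le> ell n r (Suc k)"
  shows "((\<lambda>s. 1 - tail s / u) has_integral Jstar n r k (ell n r k) t) {ell n r k..t}"
proof (cases "even n")
  case True
  note K = KK_even[OF True]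
  show ?thesis
  proof (cases "k = KK n")
    case True
    then show ?thesis
      using tail_integral_even[of k t] K t \<open>even n\<close> by (simp add: Jstar_def Hstar_def H_even_def)
  next
    case False
    then have "Suc k \<le> KK n" using k by simp
    then have "2 * Suc (Suc k) \<le> n" using K unfolding mult_Suc_right by linarith
    moreover from this have "2 * Suc k < n" unfolding mult_Suc_right by linarith
    ultimately show ?thesis
      using tail_integral_regular[of k t] t True False by (simp add: Jstar_def Hstar_def H_regular_def)
  qed
next
  case False
  note K = KK_odd[OF False]
  have k2: "2 * Suc k < n" using k K unfolding mult_Suc_right by linarith
  note L = ell_less_lam[OF K]
  have lt: "ell n r k < lam n r"
    using ell_mono[of k "KK n"] k K L(1) by linarith
  have Hr: "Hstar n r k x = H_regular k x" if "x < lam n r" for x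
    using that False by (simp add: Hstar_def H_regular_def)
  show ?thesis
  proof (cases "t < lam n r")
    case True
    then show ?thesis
      using tail_integral_regular[OF k2 t] lt by (simp add: Jstar_def Hr)
  next
    case ge: False
    \<comment> \<open>All lower ranges end at or before \<open>ell n r (KK n)\<close>, which is less
      than \<lambda>. This is why the branch of \<open>Hstar\<close> above \<lambda> may mention
      \<open>KK n\<close> in place of \<open>k\<close>.\<close>
    have kK: "k = KK n"
    proof (rule ccontr)
      assume "k \<noteq> KK n"
      then have "ell n r (Suc k) \<le> ell n r (KK n)" using k K by (intro ell_mono) auto
      then show False using ge t L(1) by linarith
    qed
    have Ho: "Hstar n r k t = H_odd k t"
      using ge False kK by (simp add: Hstar_def H_odd_def)
    have "((\<lambda>s. 1 - tail s / u) has_integral (H_regular k (lam n r) - H_regular k (ell n r k))) {ell n r k..lam n r}"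
      using L lt kK by (intro tail_integral_regular k2) auto
    moreover have "((\<lambda>s. 1 - tail s / u) has_integral (H_odd k t - H_odd k (lam n r))) {lam n r..t}"
      using ge t K kK by (intro tail_integral_odd) auto
    ultimately have "((\<lambda>s. 1 - tail s / u) has_integral (H_regular k (lam n r) - H_regular k (ell n r k) + (H_odd k t - H_odd k (lam n r)))) {ell n r k..t}"
      by (rule has_integral_combine[rotated 2]) (use lt ge in auto)
    moreover have "H_odd k (lam n r) = H_regular k (lam n r)"
      by (simp add: H_odd_def H_regular_def)
    ultimately show ?thesis by (simp add: Jstar_def Ho Hr[OF lt])
  qed
qed

lemma tail_integral_sum:
  assumes "k \<le> Suc (KK n)"
  shows "((\<lambda>s. 1 - tail s / u) has_integral (\<Sum>\<nu><k. Jstar n r \<nu> (ell n r \<nu>) (ell n r (\<nu> + 1)))) {0..ell n r k}"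
  using assms
proof (induction k)
  case 0
  show ?case using has_integral_refl(2)[of _ 0] by (simp add: ell_eq)
next
  case (Suc k)
  have le: "ell n r k \<le> ell n r (Suc k)" "0 \<le> ell n r k"
    using Suc.prems KK_le by (auto intro!: ell_mono ell_nonneg)
  have "((\<lambda>s. 1 - tail s / u) has_integral ((\<Sum>\<nu><k. Jstar n r \<nu> (ell n r \<nu>) (ell n r (\<nu> + 1))) + Jstar n r k (ell n r k) (ell n r (Suc k)))) {0..ell n r (Suc k)}"
    by (rule has_integral_combine[OF _ _ Suc.IH tail_integral_piece]) (use le Suc.prems in auto)
  then show ?case by simp
qed

lemma cldf_integral:
  assumes "k \<le> KK n" "ell n r k \<le> t" "t \<le> ell n r (Suc k)"
  shows "((\<lambda>s. 1 - tail s / u) has_integral integral {0..t} (cldf n r)) {0..t}"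
    and "integral {0..t} (cldf n r) = (\<Sum>\<nu><k. Jstar n r \<nu> (ell n r \<nu>) (ell n r (\<nu> + 1))) + Jstar n r k (ell n r k) t"
proof -
  let ?I = "(\<Sum>\<nu><k. Jstar n r \<nu> (ell n r \<nu>) (ell n r (\<nu> + 1))) + Jstar n r k (ell n r k) t"
  let ?N = "{s \<in> {0..}. short_chord_measure P s \<noteq> tail 0 - tail s}"
  have I: "((\<lambda>s. 1 - tail s / u) has_integral ?I) {0..t}"
    by (rule has_integral_combine[OF _ _ tail_integral_sum tail_integral_piece])
      (use assms KK_le in \<open>auto intro!: ell_nonneg\<close>)
  have "countable ?N"
    using line_measure_0 by (intro countable_short_chord_measure compact_polygon convex_polygon) simp
  then have "negligible ?N"
    using countable_imp_null_set_lborel null_sets_completionI negligible_iff_null_sets by blast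
  moreover have "cldf n r s = 1 - tail s / u" if "s \<in> {0..t} - ?N" for s
  proof -
    have "cldf n r s = short_chord_measure P s / u"
      by (simp add: cldf_def short_chord_measure_def chord_len_def)
    also have "\<dots> = (u - tail s) / u"
      using that perim_pos by (simp add: line_measure_0)
    finally show ?thesis using perim_pos by (simp add: diff_divide_distrib)
  qed
  ultimately have "(cldf n r has_integral ?I) {0..t}"
    using I by (rule has_integral_spike)
  then show eq: "integral {0..t} (cldf n r) = ?I" by (rule integral_unique)
  show "((\<lambda>s. 1 - tail s / u) has_integral integral {0..t} (cldf n r)) {0..t}"
    unfolding eq by (rule I)
qed

lemma ell_interval:
  assumes "0 \<le> t" "t < ell n r (Suc (KK n))"
  obtains k where "k \<le> KK n" "ell n r k \<le> t" "t < ell n r (Suc k)"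
proof -
  define k where "k = (LEAST j. t < ell n r (Suc j))"
  \<comment> \<open>The least index makes the range unique without appeal to monotonicity:
    minimality gives the lower bound and the hypothesis on \<open>t\<close> gives
    \<open>k \<le> KK n\<close>.\<close>
  have "t < ell n r (Suc k)" unfolding k_def by (rule LeastI[of "\<lambda>j. t < ell n r (Suc j)", OF assms(2)])
  moreover have "k \<le> KK n" unfolding k_def by (rule Least_le[of "\<lambda>j. t < ell n r (Suc j)", OF assms(2)])
  moreover have "ell n r k \<le> t"
  proof (cases k)
    case 0
    then show ?thesis using assms(1) by (simp add: ell_eq)
  next
    case (Suc j)
    then have "\<not> t < ell n r (Suc j)" using not_less_Least[of j "\<lambda>j. t < ell n r (Suc j)"] by (simp add: k_def)
    then show ?thesis using Suc by simp
  qed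
  ultimately show thesis using that by blast
qed

section \<open>From the integrated distribution function to the density\<close>

definition long_chords :: "real \<Rightarrow> ennreal" where
  "long_chords \<rho> = (\<integral>\<^sup>+\<sigma>. indicator {\<rho>..} \<sigma> * line_measure P \<sigma> \<partial>lborel)"

lemma borel_measurable_line_measure [measurable]: "line_measure P \<in> borel_measurable borel"
proof -
  note [measurable] = chords_measurable[OF compact_polygon]
  show ?thesis unfolding line_measure_def[abs_def] by measurable
qed

lemma borel_measurable_long_chords [measurable]: "long_chords \<in> borel_measurable borel"
  unfolding long_chords_def[abs_def] by measurable

lemma area_pos: "0 < area n r"
proof -
  have "2 * (pi / real n) < pi" using pi_n_bounds(3) by linarith
  then have "2 * pi / real n < pi" by (simp only: times_divide_eq_right)
  then have "0 < sin (2 * pi / real n)" by (intro sin_gt_zero) auto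
  then show ?thesis using r_pos by (simp add: area_def)
qed

text \<open>The total pi A less the part over [0, \<rho>], which is u times the integral of 1 - F.
  The second claim holds because the part is at most the whole; it is needed to pass between
  \<open>ennreal\<close> and real subtraction later.\<close>

lemma long_chords_eq:
  assumes "0 \<le> \<rho>" "\<rho> < ell n r (Suc (KK n))"
  shows "long_chords \<rho> = ennreal (pi * area n r - u * (\<rho> - integral {0..\<rho>} (cldf n r)))"
    and "0 \<le> pi * area n r - u * (\<rho> - integral {0..\<rho>} (cldf n r))"
proof -
  let ?I = "integral {0..\<rho>} (cldf n r)"
  obtain k where "k \<le> KK n" "ell n r k \<le> \<rho>" "\<rho> < ell n r (Suc k)"
    using ell_interval[OF assms] .
  then have "((\<lambda>s. 1 - tail s / u) has_integral ?I) {0..\<rho>}"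
    using cldf_integral(1)[of k \<rho>] by simp
  moreover have "((\<lambda>s. 1) has_integral \<rho>) {0..\<rho>}"
    using has_integral_const_real[of "1::real" 0 \<rho>] assms(1) by simp
  ultimately have "((\<lambda>s. u * (1 - (1 - tail s / u))) has_integral (u * (\<rho> - ?I))) {0..\<rho>}"
    by (intro has_integral_mult_right has_integral_diff)
  then have int: "(tail has_integral (u * (\<rho> - ?I))) {0..\<rho>}"
    using perim_pos by simp
  have nonneg: "0 \<le> u * (\<rho> - ?I)"
    by (rule has_integral_nonneg[OF int]) simp
  have "(\<integral>\<^sup>+\<sigma>. indicator {0..\<rho>} \<sigma> * line_measure P \<sigma> \<partial>lborel) = (\<integral>\<^sup>+\<sigma>. ennreal (tail \<sigma>) * indicator {0..\<rho>} \<sigma> \<partial>lborel)"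
    by (intro nn_integral_cong) (auto simp: line_measure_eq_tail[symmetric] split: split_indicator)
  also have "\<dots> = ennreal (u * (\<rho> - ?I))"
    by (rule nn_integral_has_integral_lebesgue'[OF _ int]) simp
  finally have short: "(\<integral>\<^sup>+\<sigma>. indicator {0..\<rho>} \<sigma> * line_measure P \<sigma> \<partial>lborel) = ennreal (u * (\<rho> - ?I))" .
  have "ennreal (pi * area n r) = (\<integral>\<^sup>+\<sigma>. indicator {0..} \<sigma> * line_measure P \<sigma> \<partial>lborel)"
    using nn_integral_total_chord_length[OF compact_polygon convex_polygon] area_pos
    by (simp add: emeasure_polygon ennreal_mult)
  also have "\<dots> = (\<integral>\<^sup>+\<sigma>. indicator {0..\<rho>} \<sigma> * line_measure P \<sigma> + indicator {\<rho>..} \<sigma> * line_measure P \<sigma> \<partial>lborel)"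
    using AE_lborel_singleton[of \<rho>] assms(1)
    by (intro nn_integral_cong_AE) (auto elim!: eventually_mono split: split_indicator)
  also have "\<dots> = ennreal (u * (\<rho> - ?I)) + long_chords \<rho>"
    unfolding short[symmetric] long_chords_def by (rule nn_integral_add) measurable
  finally have sum: "ennreal (pi * area n r) = ennreal (u * (\<rho> - ?I)) + long_chords \<rho>" .
  then have "ennreal (u * (\<rho> - ?I)) \<le> ennreal (pi * area n r)" by simp
  then show "0 \<le> pi * area n r - u * (\<rho> - ?I)"
    using area_pos by (simp add: ennreal_le_iff)
  have "long_chords \<rho> = ennreal (pi * area n r) - ennreal (u * (\<rho> - ?I))"
    unfolding sum by (simp add: ennreal_add_diff_cancel_left)
  then show "long_chords \<rho> = ennreal (pi * area n r - u * (\<rho> - ?I))"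
    using nonneg by (simp add: ennreal_minus)
qed

lemma long_chords_eq_0:
  assumes "ell n r (Suc (KK n)) \<le> \<rho>"
  shows "long_chords \<rho> = 0"
proof -
  have "long_chords \<rho> = integral\<^sup>N lborel (\<lambda>_ :: real. 0)"
    unfolding long_chords_def
  proof (rule nn_integral_cong_AE)
    show "AE \<sigma> in lborel. indicator {\<rho>..} \<sigma> * line_measure P \<sigma> = 0"
      using AE_lborel_singleton[of \<rho>]
    proof eventually_elim
      case (elim \<sigma>)
      then show ?case using line_measure_beyond_diameter[of \<sigma>] assms by (auto split: split_indicator)
    qed
  qed
  then show ?thesis by simp
qed

text \<open>Beyond the longest diagonal \<open>long_chords\<close> vanishes, so the right-hand side
  carries no cut-off of its own and is a single formula on the whole line. As a parameter integral
  it also shows that \<open>gdens\<close> is measurable.\<close>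

lemma gdens_eq:
  "0 \<le> gdens n r t" "ennreal (gdens n r t) = indicator {0..} t * (ennreal (2 * t / (area n r)\<^sup>2) * long_chords t)"
proof -
  have "0 \<le> gdens n r t \<and> ennreal (gdens n r t) = indicator {0..} t * (ennreal (2 * t / (area n r)\<^sup>2) * long_chords t)"
  proof (cases "0 \<le> t \<and> t < ell n r (Suc (KK n))")
    case True
    let ?J = "pi * area n r - u * (t - integral {0..t} (cldf n r))"
    define c where "c = 2 * t / (area n r)\<^sup>2"
    have c: "0 \<le> c" using True by (simp add: c_def)
    have g: "gdens n r t = c * ?J"
      using True area_pos by (simp add: gdens_def c_def field_simps power2_eq_square)
    have J: "long_chords t = ennreal ?J" "0 \<le> ?J"
      using True long_chords_eq[of t] by blast+
    have "ennreal (gdens n r t) = ennreal c * long_chords t"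
      unfolding g J(1) by (rule ennreal_mult[OF c J(2)])
    moreover have "0 \<le> gdens n r t"
      unfolding g by (rule mult_nonneg_nonneg[OF c J(2)])
    ultimately show ?thesis using True by (simp add: c_def)
  next
    case False
    then have "gdens n r t = 0" by (auto simp: gdens_def)
    then show ?thesis using False long_chords_eq_0[of t] by (auto split: split_indicator)
  qed
  then show "0 \<le> gdens n r t" "ennreal (gdens n r t) = indicator {0..} t * (ennreal (2 * t / (area n r)\<^sup>2) * long_chords t)"
    by auto
qed

lemma borel_measurable_gdens [measurable]: "gdens n r \<in> borel_measurable borel"
proof -
  have "gdens n r = (\<lambda>t. enn2real (indicator {0..} t * (ennreal (2 * t / (area n r)\<^sup>2) * long_chords t)))"
    using gdens_eq by (auto simp: gdens_eq(2)[symmetric])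
  then show ?thesis by simp
qed

text \<open>It suffices to match distribution functions: the measure of the pairs at distance at
  most \<open>a\<close>, divided by the measure A^2 of all pairs, is the integral of
  \<open>gdens\<close> up to \<open>a\<close>.\<close>

lemma distributed_distance:
  "distributed (uniform_measure lborel (P \<times> P)) lborel (\<lambda>(x, y). dist x y) (\<lambda>t. ennreal (gdens n r t))"
proof -
  let ?M = "uniform_measure lborel (P \<times> P)"
  have [measurable]: "P \<in> sets borel" using compact_polygon by (simp add: borel_compact)
  have PP: "P \<times> P \<in> sets lborel"
    using compact_Times[OF compact_polygon compact_polygon] by (simp add: borel_compact)
  have em: "emeasure lborel (P \<times> P) = ennreal ((area n r)\<^sup>2)"
  proof -
    have "emeasure (lborel \<Otimes>\<^sub>M lborel) (P \<times> P) = emeasure lborel P * emeasure lborel P"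
      by (rule lborel.emeasure_pair_measure_Times) simp_all
    then show ?thesis
      using area_pos by (simp add: lborel_prod emeasure_polygon power2_eq_square ennreal_mult)
  qed
  interpret M: prob_space ?M
    by (rule prob_space_uniform_measure) (use em area_pos in auto)
  have dist: "(\<lambda>(x, y). dist x y) \<in> borel_measurable (borel :: (point \<times> point) measure)"
    by (intro borel_measurable_continuous_onI) (auto simp: split_beta' intro!: continuous_intros)
  have cdf: "emeasure ?M {z \<in> space ?M. (\<lambda>(x, y). dist x y) z \<le> a} = (\<integral>\<^sup>+t. ennreal (gdens n r t) * indicator {..a} t \<partial>lborel)" for a
  proof -
    have "closed {z :: point \<times> point. (\<lambda>(x, y). dist x y) z \<le> a}"
      by (intro closed_Collect_le) (auto simp: split_beta' intro!: continuous_intros)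
    then have cl: "{z :: point \<times> point. (\<lambda>(x, y). dist x y) z \<le> a} \<in> sets lborel" by simp
    have "emeasure ?M {z \<in> space ?M. (\<lambda>(x, y). dist x y) z \<le> a} =
        emeasure lborel {z \<in> P \<times> P. dist (fst z) (snd z) \<le> a} / ennreal ((area n r)\<^sup>2)"
      using emeasure_uniform_measure[OF PP cl] by (simp add: em Int_def split_beta')
    also have "emeasure lborel {z \<in> P \<times> P. dist (fst z) (snd z) \<le> a} =
        2 * (\<integral>\<^sup>+\<rho>. indicator {0..a} \<rho> * (ennreal \<rho> * long_chords \<rho>) \<partial>lborel)"
      unfolding long_chords_def by (rule emeasure_pairs_at_distance[OF compact_polygon convex_polygon])
    also have "\<dots> / ennreal ((area n r)\<^sup>2) = ennreal (2 / (area n r)\<^sup>2) * (\<integral>\<^sup>+\<rho>. indicator {0..a} \<rho> * (ennreal \<rho> * long_chords \<rho>) \<partial>lborel)"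
    proof -
      have "ennreal (2 / (area n r)\<^sup>2) = 2 / ennreal ((area n r)\<^sup>2)"
        using area_pos divide_ennreal[of 2 "(area n r)\<^sup>2"] by simp
      then show ?thesis by (simp add: divide_ennreal_def mult_ac)
    qed
    also have "\<dots> = (\<integral>\<^sup>+\<rho>. ennreal (2 / (area n r)\<^sup>2) * (indicator {0..a} \<rho> * (ennreal \<rho> * long_chords \<rho>)) \<partial>lborel)"
      by (rule nn_integral_cmult[symmetric]) measurable
    also have "\<dots> = (\<integral>\<^sup>+t. ennreal (gdens n r t) * indicator {..a} t \<partial>lborel)"
    proof (rule nn_integral_cong)
      fix t
      have "ennreal (2 * t / (area n r)\<^sup>2) = ennreal (2 / (area n r)\<^sup>2) * ennreal t" if "0 \<le> t"
        using that by (simp add: ennreal_mult[symmetric])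
      then show "ennreal (2 / (area n r)\<^sup>2) * (indicator {0..a} t * (ennreal t * long_chords t)) = ennreal (gdens n r t) * indicator {..a} t"
        unfolding gdens_eq(2) by (auto simp: mult_ac split: split_indicator)
    qed
    finally show ?thesis .
  qed
  show ?thesis
  proof (rule distributedI_borel_atMost[where g = "\<lambda>a. M.prob {z \<in> space ?M. (\<lambda>(x, y). dist x y) z \<le> a}"])
    show "(\<lambda>(x, y). dist x y) \<in> borel_measurable ?M" using dist by simp
    show "AE x in lborel. 0 \<le> gdens n r x" using gdens_eq(1) by simp
    fix a
    show prob: "emeasure ?M {z \<in> space ?M. (\<lambda>(x, y). dist x y) z \<le> a} = ennreal (M.prob {z \<in> space ?M. (\<lambda>(x, y). dist x y) z \<le> a})"
      by (rule M.emeasure_eq_measure)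
    have "(\<integral>\<^sup>+x. ennreal (gdens n r x * indicator {..a} x) \<partial>lborel) = (\<integral>\<^sup>+x. ennreal (gdens n r x) * indicator {..a} x \<partial>lborel)"
      by (intro nn_integral_cong) (simp split: split_indicator)
    also have "\<dots> = ennreal (M.prob {z \<in> space ?M. (\<lambda>(x, y). dist x y) z \<le> a})"
      by (rule trans[OF cdf[symmetric] prob])
    finally show "(\<integral>\<^sup>+x. ennreal (gdens n r x * indicator {..a} x) \<partial>lborel) = ennreal (M.prob {z \<in> space ?M. (\<lambda>(x, y). dist x y) z \<le> a})" .
  qed measurable
qed

end

theorem theorem2:
  fixes n :: nat and r :: real
  assumes "n \<ge> 3" and "r > 0"
  shows "distributed (uniform_measure lborel (polygon n r \<times> polygon n r)) lborel
            (\<lambda>(x, y). dist x y) (\<lambda>t. ennreal (gdens n r t))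
         \<and> (\<forall>k \<le> KK n. \<forall>t. ell n r k \<le> t \<and> t < ell n r (k + 1) \<longrightarrow>
              integral {0..t} (cldf n r) =
                (\<Sum>\<nu><k. Jstar n r \<nu> (ell n r \<nu>) (ell n r (\<nu> + 1))) + Jstar n r k (ell n r k) t)"
proof -
  interpret regular_polygon n r by unfold_locales (fact assms)+
  show ?thesis
    using distributed_distance cldf_integral(2) by simp
qed

end
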